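(* Let $n\ge 1$ and let $D\subset\mathbb{RP}^n$ be a properly convex open set. Then its elliptic tube $D^e\subset\mathbb{CP}^n$ is complete Kobayashi hyperbolic (i.e. the Kobayashi pseudodistance of $D^e$ is a complete distance), it is taut, and it is hyperconvex.
   Context: A set $E\subset\mathbb{RP}^n$ is convex if it contains no projective line and its intersection with every projective line is connected. A convex set $E\subset\mathbb{RP}^n$ is properly convex if it is not contained in a projective hyperplane and contains no affine line (a projective line minus a point). Elliptic tubes: regard $\mathbb{RP}^n\subset\mathbb{CP}^n$ and write $\pi$ for the projections $\mathbb{R}^{n+1}\setminus\{0\}\to\mathbb{RP}^n$, $\mathbb{C}^{n+1}\setminus\{0\}\to\mathbb{CP}^n$. A closed segment $I\subset\mathbb{RP}^n$ with endpoints $a_0,a_1$ can be written as $I=\pi(\{c_0v_0+c_1v_1\neq 0 : c_0,c_1\in\mathbb{R},\ c_0c_1\ge 0\})$ for suitable $v_0,v_1\in\mathbb{R}^{n+1}$ with $\pi(v_i)=a_i$; put $I^e=\pi(\{c_0v_0+c_1v_1\neq 0 : c_0,c_1\in\mathbb{C},\ \mathrm{Re}(c_0\overline{c_1})\ge 0\})$. For $D\subset\mathbb{RP}^n$, the elliptic tube is $D^e=\bigcup\{I^e : I\subset D \text{ a closed segment}\}\subset\mathbb{CP}^n$. If $D$ is open and bounded in an affine chart $\mathbb{RP}^n\setminus H$, then $D^e$ is an open set, bounded in the affine chart $\mathbb{CP}^n\setminus H^{\mathbb{C}}$, where $H^{\mathbb C}$ is the complexification of $H$. Taut: every sequence of holomorphic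 maps from the unit disk to $D^e$ has a subsequence that either converges locally uniformly to a holomorphic map into $D^e$ or is compactly divergent. Hyperconvex: $D^e$ admits a continuous negative plurisubharmonic exhaustion function $\rho:D^e\to(-\infty,0)$, i.e. $\{\rho<c\}$ is relatively compact in $D^e$ for every $c<0$. *)

theory Defs
  imports "HOL-Complex_Analysis.Complex_Analysis"
begin

section \<open>Projective space\<close>

text \<open>
  The points of the projective space of \<open>'a ^ 'n\<close> are its one-dimensional linear subspaces, so the
  projective dimension is \<open>CARD('n) - 1\<close>.  The real and the complex projective \<open>n\<close>-space are
  the types \<open>(real, 'n) proj_space\<close> and \<open>(complex, 'n) proj_space\<close> with \<open>CARD('n) = n + 1\<close>.
\<close>

typedef (overloaded) ('a, 'n) proj_space =
    "{L :: ('a::field ^ 'n::finite) set. \<exists>v. v \<noteq> 0 \<and> L = range (\<lambda>c. c *s v)}"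
  morphisms line_of Abs_proj_space
proof -
  have "(1 :: 'a ^ 'n) \<noteq> 0"
    by (simp add: vec_eq_iff)
  then show ?thesis
    by blast
qed

text \<open>The projection from the nonzero vectors; \<open>proj_pt 0\<close> has no meaning.\<close>

definition proj_pt :: "'a::field ^ 'n::finite \<Rightarrow> ('a, 'n) proj_space"
  where "proj_pt v = Abs_proj_space (range (\<lambda>c. c *s v))"

lemma line_of_proj_pt: "v \<noteq> 0 \<Longrightarrow> line_of (proj_pt v) = range (\<lambda>c. c *s v)"
  unfolding proj_pt_def by (rule Abs_proj_space_inverse) blast

lemma proj_pt_eq_iff:
  fixes v w :: "'a::field ^ 'n::finite"
  assumes "v \<noteq> 0" "w \<noteq> 0"
  shows "proj_pt v = proj_pt w \<longleftrightarrow> (\<exists>c. c \<noteq> 0 \<and> w = c *s v)"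
proof
  assume "proj_pt v = proj_pt w"
  then have "range (\<lambda>c. c *s v) = range (\<lambda>c. c *s w)"
    using assms by (metis line_of_proj_pt)
  moreover have "w \<in> range (\<lambda>c. c *s w)"
    by (rule range_eqI[where x = 1]) simp
  ultimately obtain c where "w = c *s v"
    by auto
  then show "\<exists>c. c \<noteq> 0 \<and> w = c *s v"
    using assms by (metis vector_smult_lzero)
next
  assume "\<exists>c. c \<noteq> 0 \<and> w = c *s v"
  then obtain c where c: "c \<noteq> 0" "w = c *s v"
    by blast
  have "d *s v \<in> range (\<lambda>c. c *s w)" for d
    using c by (intro range_eqI[where x = "d / c"]) (simp add: vector_smult_assoc)
  moreover have "d *s w \<in> range (\<lambda>c. c *s v)" for d
    using c by (intro range_eqI[where x = "d * c"]) (simp add: vector_smult_assoc)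
  ultimately have "range (\<lambda>c. c *s v) = range (\<lambda>c. c *s w)"
    by blast
  then show "proj_pt v = proj_pt w"
    by (simp add: proj_pt_def)
qed

lemma proj_pt_surj: "\<exists>v. v \<noteq> 0 \<and> proj_pt v = p"
  by (cases p) (auto simp: proj_pt_def)

text \<open>The quotient topology.\<close>

instantiation proj_space :: (real_normed_field, finite) topological_space
begin

definition open_proj_space :: "('a, 'b) proj_space set \<Rightarrow> bool"
  where "open_proj_space U \<longleftrightarrow> open {v. v \<noteq> 0 \<and> proj_pt v \<in> U}"

instance
proof
  have "{v :: 'a ^ 'b. v \<noteq> 0} = - {0}"
    by auto
  then show "open (UNIV :: ('a, 'b) proj_space set)"
    by (simp add: open_proj_space_def open_Compl)
next
  fix S T :: "('a, 'b) proj_space set"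
  assume "open S" "open T"
  moreover have "{v. v \<noteq> 0 \<and> proj_pt v \<in> S \<inter> T} =
      {v. v \<noteq> 0 \<and> proj_pt v \<in> S} \<inter> {v. v \<noteq> 0 \<and> proj_pt v \<in> T}"
    by auto
  ultimately show "open (S \<inter> T)"
    by (simp only: open_proj_space_def open_Int)
next
  fix K :: "('a, 'b) proj_space set set"
  assume "\<forall>S\<in>K. open S"
  moreover have "{v. v \<noteq> 0 \<and> proj_pt v \<in> \<Union>K} = (\<Union>S\<in>K. {v. v \<noteq> 0 \<and> proj_pt v \<in> S})"
    by auto
  ultimately show "open (\<Union>K)"
    by (simp only: open_proj_space_def open_UN)
qed

end

section \<open>Convexity in real projective space\<close>

definition projective_line :: "('a::field, 'n::finite) proj_space set \<Rightarrow> bool"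
  where "projective_line L \<longleftrightarrow>
    (\<exists>V. vec.subspace V \<and> vec.dim V = 2 \<and> L = proj_pt ` (V - {0}))"

definition projective_hyperplane :: "('a::field, 'n::finite) proj_space set \<Rightarrow> bool"
  where "projective_hyperplane H \<longleftrightarrow>
    (\<exists>V. vec.subspace V \<and> vec.dim V + 1 = CARD('n) \<and> H = proj_pt ` (V - {0}))"

definition affine_line :: "('a::field, 'n::finite) proj_space set \<Rightarrow> bool"
  where "affine_line A \<longleftrightarrow> (\<exists>L p. projective_line L \<and> p \<in> L \<and> A = L - {p})"

definition proj_convex :: "(real, 'n::finite) proj_space set \<Rightarrow> bool"
  where "proj_convex E \<longleftrightarrow>
    (\<forall>L. projective_line L \<longrightarrow> \<not> L \<subseteq> E) \<and> (\<forall>L. projective_line L \<longrightarrow> connected (E \<inter> L))"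

definition properly_convex :: "(real, 'n::finite) proj_space set \<Rightarrow> bool"
  where "properly_convex E \<longleftrightarrow>
    proj_convex E \<and>
    (\<forall>H. projective_hyperplane H \<longrightarrow> \<not> E \<subseteq> H) \<and>
    (\<forall>A. affine_line A \<longrightarrow> \<not> A \<subseteq> E)"

section \<open>Elliptic tubes\<close>

definition complexify :: "real ^ 'n \<Rightarrow> complex ^ 'n"
  where "complexify v = (\<chi> i. complex_of_real (v $ i))"

text \<open>
  For nonzero \<open>v0\<close>, \<open>v1\<close>, one of the two closed segments with endpoints \<open>proj_pt v0\<close> and
  \<open>proj_pt v1\<close> (replacing \<open>v1\<close> by \<open>- v1\<close> gives the other one), and the corresponding subset of
  the complex projective space.  If the endpoints coincide, both are the single point.
\<close>

definition closed_segment_proj :: "real ^ 'n::finite \<Rightarrow> real ^ 'n \<Rightarrow> (real, 'n) proj_space set"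
  where "closed_segment_proj v0 v1 =
    proj_pt ` ({c0 *s v0 + c1 *s v1 | c0 c1. c0 * c1 \<ge> 0} - {0})"

definition elliptic_segment :: "real ^ 'n::finite \<Rightarrow> real ^ 'n \<Rightarrow> (complex, 'n) proj_space set"
  where "elliptic_segment v0 v1 =
    proj_pt ` ({c0 *s complexify v0 + c1 *s complexify v1 | c0 c1. Re (c0 * cnj c1) \<ge> 0} - {0})"

definition elliptic_tube :: "(real, 'n::finite) proj_space set \<Rightarrow> (complex, 'n) proj_space set"
  where "elliptic_tube D =
    \<Union>{elliptic_segment v0 v1 | v0 v1. v0 \<noteq> 0 \<and> v1 \<noteq> 0 \<and> closed_segment_proj v0 v1 \<subseteq> D}"

section \<open>Holomorphic maps into complex projective space\<close>

text \<open>
  The standard chart number \<open>j\<close> sends a point to its representative whose \<open>j\<close>-th coordinate is 1;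
  the target is the affine hyperplane of these vectors, not \<open>complex ^ m\<close> with one index removed.
\<close>

definition chart_dom :: "'n \<Rightarrow> ('a::field, 'n::finite) proj_space set"
  where "chart_dom j = {proj_pt x | x. x $ j = 1}"

definition affine_coords :: "'n \<Rightarrow> ('a::field, 'n::finite) proj_space \<Rightarrow> 'a ^ 'n"
  where "affine_coords j p = (THE x. x $ j = 1 \<and> proj_pt x = p)"

lemma affine_coords_proj_pt:
  fixes v :: "'a::field ^ 'n::finite"
  assumes "v $ j \<noteq> 0"
  shows "affine_coords j (proj_pt v) = (1 / (v $ j)) *s v"
  unfolding affine_coords_def
proof (rule the_equality)
  have v: "v \<noteq> 0"
    using assms by auto
  let ?w = "(1 / (v $ j)) *s v"
  have wj: "?w $ j = 1"
    using assms by simp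
  then have w: "?w \<noteq> 0"
    by (metis zero_index zero_neq_one)
  have "proj_pt v = proj_pt ?w"
    using proj_pt_eq_iff[OF v w] assms by (metis divide_eq_0_iff zero_neq_one)
  then show "?w $ j = 1 \<and> proj_pt ?w = proj_pt v"
    using wj by simp
  fix x :: "'a ^ 'n"
  assume x: "x $ j = 1 \<and> proj_pt x = proj_pt v"
  then have "x \<noteq> 0"
    by (metis zero_index zero_neq_one)
  then obtain c where c: "x = c *s v"
    using x proj_pt_eq_iff[OF v] by metis
  then have "c * v $ j = 1"
    using x by simp
  then have "c = 1 / v $ j"
    using assms by (simp add: field_simps)
  then show "x = ?w"
    using c by simp
qed

definition holomorphic_into_proj ::
    "(complex \<Rightarrow> (complex, 'n::finite) proj_space) \<Rightarrow> complex set \<Rightarrow> bool"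
  where "holomorphic_into_proj f S \<longleftrightarrow>
    continuous_on S f \<and>
    (\<forall>j i. (\<lambda>z. affine_coords j (f z) $ i) holomorphic_on {z \<in> S. f z \<in> chart_dom j})"

abbreviation unit_disc :: "complex set"
  where "unit_disc \<equiv> ball 0 1"

definition holomorphic_discs ::
    "(complex, 'n::finite) proj_space set \<Rightarrow> (complex \<Rightarrow> (complex, 'n) proj_space) set"
  where "holomorphic_discs \<Omega> = {f. holomorphic_into_proj f unit_disc \<and> f ` unit_disc \<subseteq> \<Omega>}"

section \<open>Kobayashi hyperbolicity\<close>

definition poincare_dist :: "complex \<Rightarrow> complex \<Rightarrow> real"
  where "poincare_dist z w = artanh (cmod ((z - w) / (1 - cnj w * z)))"

definition kobayashi_chain_lengths ::
    "(complex, 'n::finite) proj_space set \<Rightarrow> (complex, 'n) proj_space \<Rightarrow> (complex, 'n) proj_space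
      \<Rightarrow> real set"
  where "kobayashi_chain_lengths \<Omega> p q =
    {(\<Sum>k<m. poincare_dist (a k) (b k)) | (m :: nat) x f a b.
      x 0 = p \<and> x m = q \<and>
      (\<forall>k<m. f k \<in> holomorphic_discs \<Omega> \<and> a k \<in> unit_disc \<and> b k \<in> unit_disc \<and>
        f k (a k) = x k \<and> f k (b k) = x (Suc k))}"

text \<open>Extended values, so that the value is \<open>\<infinity>\<close> if there is no chain from \<open>p\<close> to \<open>q\<close>.\<close>

definition kobayashi ::
    "(complex, 'n::finite) proj_space set \<Rightarrow> (complex, 'n) proj_space \<Rightarrow> (complex, 'n) proj_space
      \<Rightarrow> ennreal"
  where "kobayashi \<Omega> p q = (INF l \<in> kobayashi_chain_lengths \<Omega> p q. ennreal l)"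

definition complete_kobayashi_hyperbolic :: "(complex, 'n::finite) proj_space set \<Rightarrow> bool"
  where "complete_kobayashi_hyperbolic \<Omega> \<longleftrightarrow>
    (\<forall>p\<in>\<Omega>. \<forall>q\<in>\<Omega>. kobayashi \<Omega> p q < \<infinity>) \<and>
    Metric_space \<Omega> (\<lambda>p q. enn2real (kobayashi \<Omega> p q)) \<and>
    Metric_space.mcomplete \<Omega> (\<lambda>p q. enn2real (kobayashi \<Omega> p q))"

section \<open>Tautness\<close>

text \<open>
  Local uniform convergence to a continuous limit \<open>g\<close>, expressed in the charts: near every point,
  \<open>g\<close> and almost all \<open>f k\<close> take values in a common chart and converge uniformly there.
\<close>

definition locally_uniformly_to ::
    "(nat \<Rightarrow> complex \<Rightarrow> (complex, 'n::finite) proj_space) \<Rightarrow> (complex \<Rightarrow> (complex, 'n) proj_space)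
      \<Rightarrow> complex set \<Rightarrow> bool"
  where "locally_uniformly_to f g S \<longleftrightarrow>
    (\<forall>z\<in>S. \<exists>N j. open N \<and> z \<in> N \<and> N \<subseteq> S \<and> g ` N \<subseteq> chart_dom j \<and>
      (\<forall>\<^sub>F k in sequentially. f k ` N \<subseteq> chart_dom j) \<and>
      uniform_limit N (\<lambda>k w. affine_coords j (f k w)) (\<lambda>w. affine_coords j (g w)) sequentially)"

definition compactly_divergent ::
    "(nat \<Rightarrow> complex \<Rightarrow> (complex, 'n::finite) proj_space) \<Rightarrow> complex set
      \<Rightarrow> (complex, 'n) proj_space set \<Rightarrow> bool"
  where "compactly_divergent f S \<Omega> \<longleftrightarrow>
    (\<forall>K L. compact K \<and> K \<subseteq> S \<and> compact L \<and> L \<subseteq> \<Omega> \<longrightarrow>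
      (\<forall>\<^sub>F k in sequentially. f k ` K \<inter> L = {}))"

definition taut :: "(complex, 'n::finite) proj_space set \<Rightarrow> bool"
  where "taut \<Omega> \<longleftrightarrow>
    (\<forall>f. (\<forall>k. f k \<in> holomorphic_discs \<Omega>) \<longrightarrow>
      (\<exists>r :: nat \<Rightarrow> nat. strict_mono r \<and>
        ((\<exists>g \<in> holomorphic_discs \<Omega>. locally_uniformly_to (f \<circ> r) g unit_disc) \<or>
         compactly_divergent (f \<circ> r) unit_disc \<Omega>)))"

section \<open>Hyperconvexity\<close>

definition upper_semicontinuous_on :: "'a::topological_space set \<Rightarrow> ('a \<Rightarrow> real) \<Rightarrow> bool"
  where "upper_semicontinuous_on S u \<longleftrightarrow> (\<forall>c. openin (top_of_set S) {x \<in> S. u x < c})"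

text \<open>
  Only finite-valued functions are needed, i.e. \<open>- \<infinity>\<close> is not a value.  A finite-valued subharmonic
  function is integrable over the circles in question; this has to be stated, since the Bochner
  integral of a function that is not integrable is 0.
\<close>

definition subharmonic_on :: "complex set \<Rightarrow> (complex \<Rightarrow> real) \<Rightarrow> bool"
  where "subharmonic_on S u \<longleftrightarrow>
    upper_semicontinuous_on S u \<and>
    (\<forall>a r. 0 < r \<and> cball a r \<subseteq> S \<longrightarrow>
      set_integrable lborel {0..2 * pi} (\<lambda>t. u (a + of_real r * cis t)) \<and>
      u a \<le> 1 / (2 * pi) * (LINT t:{0..2 * pi}|lborel. u (a + of_real r * cis t)))"

text \<open>
  Plurisubharmonicity in every standard chart: \<open>a + l *s b\<close> runs through the complex lines of
  the affine hyperplane of vectors with \<open>j\<close>-th coordinate 1.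
\<close>

definition plurisubharmonic_on ::
    "(complex, 'n::finite) proj_space set \<Rightarrow> ((complex, 'n) proj_space \<Rightarrow> real) \<Rightarrow> bool"
  where "plurisubharmonic_on \<Omega> \<rho> \<longleftrightarrow>
    upper_semicontinuous_on \<Omega> \<rho> \<and>
    (\<forall>j a b. a $ j = 1 \<and> b $ j = 0 \<longrightarrow>
      subharmonic_on {l. proj_pt (a + l *s b) \<in> \<Omega>} (\<lambda>l. \<rho> (proj_pt (a + l *s b))))"

definition hyperconvex :: "(complex, 'n::finite) proj_space set \<Rightarrow> bool"
  where "hyperconvex \<Omega> \<longleftrightarrow>
    (\<exists>\<rho>. continuous_on \<Omega> \<rho> \<and> plurisubharmonic_on \<Omega> \<rho> \<and> (\<forall>p\<in>\<Omega>. \<rho> p < 0) \<and>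
      (\<forall>c<0. \<exists>K. compact K \<and> K \<subseteq> \<Omega> \<and> {p \<in> \<Omega>. \<rho> p < c} \<subseteq> K))"

end

theory Submission
  imports Defs
begin

text \<open>
  The preimage of a properly convex open set \<open>D\<close> is \<open>C \<union> - C\<close> for an open convex cone \<open>C\<close> whose
  closure contains no line, and rotating two complex coefficients at an angle of at most
  \<open>\<pi> / 2\<close> into the first quadrant shows that the elliptic tube is the image of \<open>C + \<i> C\<close>.  Hence it
  is the set of all points at which the quotients \<open>f / g\<close> of functionals \<open>f\<close>, \<open>g\<close> in the dual cone
  have positive real part.  Let \<open>E\<close> be the infimum of \<open>Re (f / g)\<close> over all unit vectors \<open>f\<close>, \<open>g\<close> of
  the dual cone.  The sets \<open>E \<ge> \<delta>\<close> with \<open>\<delta> > 0\<close> are compact, so \<open>- E\<close> is a plurisubharmonic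
  exhaustion, and by Harnack's inequality \<open>ln E\<close> is Lipschitz for the Kobayashi pseudodistance.
  As the tube is bounded in an affine chart, so are the affine coordinates.  Hence Kobayashi
  balls are relatively compact, which gives completeness; and the limit of a sequence of discs
  supplied by Montel's theorem lies in the tube everywhere as soon as \<open>E\<close> does not tend to 0 at
  the centres, whereas otherwise \<open>E\<close> tends to 0 uniformly on compact sets.
\<close>

section \<open>The topology of projective space\<close>

text \<open>Positivity of \<open>Re (f / g)\<close> for all pairs says that the values
  \<open>f z\<close>, with \<open>f\<close> in the dual cone, pairwise enclose angles below
  \<open>\<pi> / 2\<close>; by compactness this holds exactly when one rotation carries them all
  into the open first quadrant. This is why pairs of functionals describe the points that are
  complex multiples of vectors in \<open>C + \<i> C\<close>. The working form of the bound is
  \<open>\<delta> |g|^2 \<le> Re (f * cnj g)\<close>: without denominators it is a closed condition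
  on all vectors. An infimum of continuous functions is a priori only upper semicontinuous. The
  missing half comes from Harnack's inequality, whose constant does not depend on \<open>f\<close>
  and \<open>g\<close>; the same inequality keeps limits of Cauchy sequences and of discs away from
  the boundary. Dividing by a functional from the interior of the dual cone gives bounded
  holomorphic coordinates and prevents limits of representatives from being 0.\<close>

lemma proj_pt_smult:
  fixes v :: "'a::field ^ 'n::finite"
  assumes "c \<noteq> 0" "v \<noteq> 0"
  shows "proj_pt (c *s v) = proj_pt v"
proof -
  have "c *s v \<noteq> 0"
    using assms by simp
  then show ?thesis
    using proj_pt_eq_iff[of v "c *s v"] assms by metis
qed

lemma proj_pt_uminus:
  fixes v :: "'a::field ^ 'n::finite"
  assumes "v \<noteq> 0"
  shows "proj_pt (- v) = proj_pt v"
  using proj_pt_smult[of "-1" v] assms by (simp add: vector_sneg_minus1[symmetric])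

lemma proj_pt_scaleR:
  fixes v :: "real ^ 'n::finite"
  assumes "c \<noteq> 0" "v \<noteq> 0"
  shows "proj_pt (c *\<^sub>R v) = proj_pt v"
  using proj_pt_smult[OF assms] by (simp add: scalar_mult_eq_scaleR)

lemma continuous_on_proj_pt:
  "continuous_on {v :: 'a::real_normed_field ^ 'n::finite. v \<noteq> 0} proj_pt"
proof -
  have "open {v :: 'a ^ 'n. v \<noteq> 0}"
    using open_Compl[of "{0 :: 'a ^ 'n}"] by (simp add: Compl_eq)
  moreover have "proj_pt -` B \<inter> {v :: 'a ^ 'n. v \<noteq> 0} = {v. v \<noteq> 0 \<and> proj_pt v \<in> B}" for B
    by auto
  ultimately show ?thesis
    by (simp add: continuous_on_open_vimage open_proj_space_def)
qed

text \<open>The universal property of the quotient topology, over an open set so that continuity can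
  be tested on open preimages.\<close>

lemma continuous_on_proj_space:
  fixes f :: "('a::real_normed_field, 'n::finite) proj_space \<Rightarrow> 'b::topological_space"
  assumes "open \<Omega>" and "continuous_on {v. v \<noteq> 0 \<and> proj_pt v \<in> \<Omega>} (\<lambda>v. f (proj_pt v))"
  shows "continuous_on \<Omega> f"
proof -
  have cone: "open {v. v \<noteq> 0 \<and> proj_pt v \<in> \<Omega>}"
    using assms(1) by (simp add: open_proj_space_def)
  have "open (f -` B \<inter> \<Omega>)" if "open B" for B
  proof -
    have "open ((\<lambda>v. f (proj_pt v)) -` B \<inter> {v. v \<noteq> 0 \<and> proj_pt v \<in> \<Omega>})"
      using assms(2) that continuous_on_open_vimage[OF cone] by blast
    also have "(\<lambda>v. f (proj_pt v)) -` B \<inter> {v. v \<noteq> 0 \<and> proj_pt v \<in> \<Omega>} =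
        {v. v \<noteq> 0 \<and> proj_pt v \<in> f -` B \<inter> \<Omega>}"
      by auto
    finally show ?thesis
      by (simp add: open_proj_space_def)
  qed
  then show ?thesis
    using continuous_on_open_vimage[OF assms(1)] by blast
qed

lemma proj_pt_in_chart_dom_iff:
  fixes v :: "'a::field ^ 'n::finite"
  assumes "v \<noteq> 0"
  shows "proj_pt v \<in> chart_dom j \<longleftrightarrow> v $ j \<noteq> 0"
proof
  assume "proj_pt v \<in> chart_dom j"
  then obtain x where x: "x $ j = 1" "proj_pt v = proj_pt x"
    by (auto simp: chart_dom_def)
  then have "x \<noteq> 0"
    by auto
  then show "v $ j \<noteq> 0"
    using x assms proj_pt_eq_iff[of v x] by auto
next
  assume v: "v $ j \<noteq> 0"
  have "proj_pt v = proj_pt ((1 / v $ j) *s v)"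
    using v assms by (simp add: proj_pt_smult)
  moreover have "((1 / v $ j) *s v) $ j = 1"
    using v by simp
  ultimately show "proj_pt v \<in> chart_dom j"
    unfolding chart_dom_def by blast
qed

lemma open_chart_dom:
  "open (chart_dom j :: ('a::real_normed_field, 'n::finite) proj_space set)"
proof -
  have "{v :: 'a ^ 'n. v \<noteq> 0 \<and> proj_pt v \<in> chart_dom j} = {v. v $ j \<noteq> 0}"
    using proj_pt_in_chart_dom_iff by (metis zero_index)
  moreover have "open {v :: 'a ^ 'n. v $ j \<noteq> 0}"
    by (intro open_Collect_neq continuous_intros)
  ultimately show ?thesis
    by (simp add: open_proj_space_def)
qed

section \<open>The cone over a properly convex set\<close>

lemma projective_line_through:
  fixes v w :: "real ^ 'n::finite"
  assumes "v \<noteq> 0" "\<nexists>c. w = c *\<^sub>R v"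
  shows "projective_line (proj_pt ` (span {v, w} - {0}))"
proof -
  have "w \<notin> span {v}"
    using assms(2) by (auto simp: span_singleton)
  then have "independent {w, v}" "v \<noteq> w"
    using assms by (auto simp: independent_insert span_base)
  then have "dim (span {v, w}) = 2"
    by (simp add: dim_eq_card_independent insert_commute)
  then show ?thesis
    unfolding projective_line_def
    by (intro exI[where x = "span {v, w}"]) (simp add: dim_vec_eq subspace_vec_eq)
qed

lemma span_pair_eq:
  fixes v w :: "'a::real_vector"
  shows "span {v, w} = {a *\<^sub>R v + b *\<^sub>R w | a b. True}"
proof (intro set_eqI iffI)
  fix x assume "x \<in> span {v, w}"
  then obtain a b where "x - a *\<^sub>R v = b *\<^sub>R w"
    by (auto simp: span_insert[of v] span_singleton)
  then have "x = a *\<^sub>R v + b *\<^sub>R w"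
    by (simp add: algebra_simps)
  then show "x \<in> {a *\<^sub>R v + b *\<^sub>R w | a b. True}"
    by blast
next
  fix x assume "x \<in> {a *\<^sub>R v + b *\<^sub>R w | a b. True}"
  then show "x \<in> span {v, w}"
    by (auto intro: span_add span_scale span_base)
qed

text \<open>Cramer's rule for the Gram matrix of \<open>v\<close> and \<open>w\<close>: its
  determinant \<open>?d\<close> vanishes only in the equality case of Cauchy-Schwarz, which
  independence excludes. The pair reads off coordinates in the plane of \<open>v\<close> and
  \<open>w\<close>.\<close>

lemma dual_pair:
  fixes v w :: "'a::real_inner"
  assumes "v \<noteq> 0" "\<nexists>c. w = c *\<^sub>R v"
  obtains p q where "p \<bullet> v = 1" "p \<bullet> w = 0" "q \<bullet> v = 0" "q \<bullet> w = 1"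
proof -
  let ?d = "(v \<bullet> v) * (w \<bullet> w) - (v \<bullet> w)^2"
  have "?d \<noteq> 0"
  proof
    assume "?d = 0"
    have "(v \<bullet> v) *\<^sub>R w - (v \<bullet> w) *\<^sub>R v = 0"
    proof -
      have "((v \<bullet> v) *\<^sub>R w - (v \<bullet> w) *\<^sub>R v) \<bullet> ((v \<bullet> v) *\<^sub>R w - (v \<bullet> w) *\<^sub>R v) = (v \<bullet> v) * ?d"
        by (simp add: inner_diff_left inner_diff_right inner_commute algebra_simps power2_eq_square)
      then show ?thesis
        using \<open>?d = 0\<close> by (metis inner_eq_zero_iff mult_zero_right)
    qed
    then have "w = ((v \<bullet> w) / (v \<bullet> v)) *\<^sub>R v"
      using assms(1) by (simp add: eq_vector_fraction_iff)
    then show False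
      using assms(2) by blast
  qed
  then show thesis
    by (intro that[of "((w \<bullet> w) / ?d) *\<^sub>R v - ((v \<bullet> w) / ?d) *\<^sub>R w"
          "((v \<bullet> v) / ?d) *\<^sub>R w - ((v \<bullet> w) / ?d) *\<^sub>R v"])
      (simp_all add: inner_diff_left inner_commute[of w v] diff_divide_distrib[symmetric]
        power2_eq_square mult.commute)
qed

text \<open>A projective line is a circle, and the two segments are its arcs between
  \<open>v\<close> and \<open>w\<close>. If each arc had a point outside \<open>D\<close>, these two
  points would cut the line into two open arcs, one containing \<open>v\<close> and the other
  \<open>w\<close>, against connectedness.\<close>

lemma segment_dichotomy:
  fixes v w :: "real ^ 'n::finite"
  assumes D: "proj_convex D" and vw: "v \<noteq> 0" "\<nexists>c. w = c *\<^sub>R v"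
    and in_D: "proj_pt v \<in> D" "proj_pt w \<in> D"
  shows "proj_pt ` closed_segment v w \<subseteq> D \<or> proj_pt ` closed_segment v (- w) \<subseteq> D"
proof (rule ccontr)
  assume "\<not> ?thesis"
  then obtain a b where a: "a \<in> closed_segment v w" "proj_pt a \<notin> D"
    and b: "b \<in> closed_segment v (- w)" "proj_pt b \<notin> D"
    by blast
  have "w \<noteq> 0"
    using vw by (metis scaleR_zero_left)
  obtain s where s: "a = (1 - s) *\<^sub>R v + s *\<^sub>R w" "0 \<le> s" "s \<le> 1"
    using a by (auto simp: in_segment)
  obtain t where t: "b = (1 - t) *\<^sub>R v - t *\<^sub>R w" "0 \<le> t" "t \<le> 1"
    using b by (auto simp: in_segment)
  have "s \<noteq> 0" "s \<noteq> 1" "t \<noteq> 0" "t \<noteq> 1"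
    using a b s t in_D proj_pt_uminus[OF \<open>w \<noteq> 0\<close>] by auto
  then have st: "0 < s" "s < 1" "0 < t" "t < 1"
    using s t by auto
  obtain p q where pq: "p \<bullet> v = 1" "p \<bullet> w = 0" "q \<bullet> v = 0" "q \<bullet> w = 1"
    using dual_pair[OF vw] by blast
  \<comment> \<open>On the line, \<open>h\<close> vanishes only at \<open>a\<close> and \<open>b\<close>, and it separates \<open>v\<close> from \<open>w\<close>.\<close>
  define h where "h u = (s * (p \<bullet> u) - (1 - s) * (q \<bullet> u)) * (t * (p \<bullet> u) + (1 - t) * (q \<bullet> u))" for u
  \<comment> \<open>The even degree makes the sign of \<open>h\<close> independent of the
    representative.\<close>
  have h_scale: "h (c *s u) = c^2 * h u" for c u
    by (simp add: h_def scalar_mult_eq_scaleR power2_eq_square algebra_simps)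
  have cont_h: "continuous_on UNIV h"
    unfolding h_def by (intro continuous_intros)
  define P where "P = {proj_pt u | u. u \<noteq> 0 \<and> h u > 0}"
  define N where "N = {proj_pt u | u. u \<noteq> 0 \<and> h u < 0}"
  have P_iff: "proj_pt u \<in> P \<longleftrightarrow> h u > 0" and N_iff: "proj_pt u \<in> N \<longleftrightarrow> h u < 0" if "u \<noteq> 0" for u
    using that h_scale by (auto simp: P_def N_def proj_pt_eq_iff zero_less_mult_iff mult_less_0_iff)
  have "open P" "open N"
  proof -
    have "h 0 = 0"
      by (simp add: h_def)
    then have "{u. u \<noteq> 0 \<and> proj_pt u \<in> P} = {u. h u > 0}" "{u. u \<noteq> 0 \<and> proj_pt u \<in> N} = {u. h u < 0}"
      using P_iff N_iff by (metis less_irrefl)+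
    then show "open P" "open N"
      unfolding open_proj_space_def
      using cont_h by (auto intro!: open_Collect_less continuous_intros)
  qed
  let ?L = "proj_pt ` (span {v, w} - {0})"
  have "connected (D \<inter> ?L)"
    using D projective_line_through[OF vw] by (simp add: proj_convex_def)
  moreover have "D \<inter> ?L \<subseteq> P \<union> N"
  proof
    fix x assume "x \<in> D \<inter> ?L"
    then obtain \<alpha> \<beta> where x: "x = proj_pt (\<alpha> *\<^sub>R v + \<beta> *\<^sub>R w)" "\<alpha> *\<^sub>R v + \<beta> *\<^sub>R w \<noteq> 0" "x \<in> D"
      by (auto simp: span_pair_eq)
    let ?u = "\<alpha> *\<^sub>R v + \<beta> *\<^sub>R w"
    have pu: "p \<bullet> ?u = \<alpha>" "q \<bullet> ?u = \<beta>"
      using pq by (auto simp: inner_add_right)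
    have "h ?u \<noteq> 0"
    proof
      assume "h ?u = 0"
      then consider "s * \<alpha> = (1 - s) * \<beta>" | "t * \<alpha> = - (1 - t) * \<beta>"
        unfolding h_def pu mult_eq_0_iff by (auto simp: algebra_simps add_eq_0_iff)
      then show False
      proof cases
        case 1
        then have "\<alpha> = (\<beta> / s) * (1 - s)"
          using st by (simp add: field_simps)
        then have "?u = (\<beta> / s) *\<^sub>R a"
          using st by (simp add: s scaleR_add_right)
        then show False
          using x a by (metis proj_pt_scaleR scaleR_eq_0_iff)
      next
        case 2
        then have "\<alpha> = - (\<beta> / t) * (1 - t)"
          using st by (simp add: field_simps)
        then have "?u = - (\<beta> / t) *\<^sub>R b"
          using st by (simp add: t scaleR_diff_right)
        then show False
          using x b by (metis proj_pt_scaleR scaleR_eq_0_iff)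
      qed
    qed
    then show "x \<in> P \<union> N"
      using x P_iff N_iff by (metis UnI1 UnI2 linorder_neqE_linordered_idom)
  qed
  moreover have "P \<inter> N \<inter> (D \<inter> ?L) = {}"
    using P_iff N_iff by fastforce
  moreover have "proj_pt v \<in> P" "proj_pt w \<in> N"
    using P_iff N_iff vw \<open>w \<noteq> 0\<close> st by (auto simp: h_def pq mult_pos_neg mult_neg_pos)
  moreover have "proj_pt v \<in> ?L" "proj_pt w \<in> ?L"
    using vw \<open>w \<noteq> 0\<close> by (auto intro: span_base)
  ultimately show False
    using connectedD[OF _ \<open>open P\<close> \<open>open N\<close>] in_D by blast
qed

text \<open>Together the two arcs make up a whole projective line, which a convex set may not
  contain. Dividing by \<open>\<alpha> + \<bar>\<beta>\<bar>\<close> puts a vector with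
  \<open>\<alpha> \<ge> 0\<close> on one of the segments; a change of sign covers the rest.\<close>

lemma segments_not_both:
  fixes v w :: "real ^ 'n::finite"
  assumes D: "proj_convex D" and vw: "v \<noteq> 0" "\<nexists>c. w = c *\<^sub>R v"
    and seg: "proj_pt ` closed_segment v w \<subseteq> D" "proj_pt ` closed_segment v (- w) \<subseteq> D"
  shows False
proof -
  have pos: "proj_pt (\<alpha> *\<^sub>R v + \<beta> *\<^sub>R w) \<in> D" if "\<alpha> \<ge> 0" "\<alpha> *\<^sub>R v + \<beta> *\<^sub>R w \<noteq> 0" for \<alpha> \<beta>
  proof -
    have "\<alpha> + \<bar>\<beta>\<bar> > 0"
      using that by (cases "\<beta> = 0") (auto simp: less_le)
    define u where "u = (1 / (\<alpha> + \<bar>\<beta>\<bar>)) *\<^sub>R (\<alpha> *\<^sub>R v + \<beta> *\<^sub>R w)"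
    have 1: "\<alpha> / (\<alpha> + \<bar>\<beta>\<bar>) = 1 - \<bar>\<beta>\<bar> / (\<alpha> + \<bar>\<beta>\<bar>)"
      using \<open>\<alpha> + \<bar>\<beta>\<bar> > 0\<close> by (simp add: field_simps)
    have "u \<in> closed_segment v w \<or> u \<in> closed_segment v (- w)"
    proof (cases "\<beta> \<ge> 0")
      case True
      then have "u = (1 - \<bar>\<beta>\<bar> / (\<alpha> + \<bar>\<beta>\<bar>)) *\<^sub>R v + (\<bar>\<beta>\<bar> / (\<alpha> + \<bar>\<beta>\<bar>)) *\<^sub>R w"
        unfolding 1[symmetric] by (simp add: u_def scaleR_add_right)
      then show ?thesis
        using \<open>\<alpha> + \<bar>\<beta>\<bar> > 0\<close> that(1) unfolding in_segment
        by (intro disjI1 exI[where x = "\<bar>\<beta>\<bar> / (\<alpha> + \<bar>\<beta>\<bar>)"]) (auto simp: field_simps)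
    next
      case False
      then have "u = (1 - \<bar>\<beta>\<bar> / (\<alpha> + \<bar>\<beta>\<bar>)) *\<^sub>R v + (\<bar>\<beta>\<bar> / (\<alpha> + \<bar>\<beta>\<bar>)) *\<^sub>R (- w)"
        unfolding 1[symmetric] by (simp add: u_def scaleR_add_right)
      then show ?thesis
        using \<open>\<alpha> + \<bar>\<beta>\<bar> > 0\<close> that(1) unfolding in_segment
        by (intro disjI2 exI[where x = "\<bar>\<beta>\<bar> / (\<alpha> + \<bar>\<beta>\<bar>)"]) (auto simp: field_simps)
    qed
    then have "proj_pt u \<in> D"
      using seg by blast
    then show ?thesis
      using that \<open>\<alpha> + \<bar>\<beta>\<bar> > 0\<close> by (simp add: u_def proj_pt_scaleR)
  qed
  have "proj_pt (\<alpha> *\<^sub>R v + \<beta> *\<^sub>R w) \<in> D" if "\<alpha> *\<^sub>R v + \<beta> *\<^sub>R w \<noteq> 0" for \<alpha> \<beta>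
  proof (cases "\<alpha> \<ge> 0")
    case False
    have eq: "(- \<alpha>) *\<^sub>R v + (- \<beta>) *\<^sub>R w = - (\<alpha> *\<^sub>R v + \<beta> *\<^sub>R w)"
      by simp
    then show ?thesis
      using pos[of "- \<alpha>" "- \<beta>", unfolded eq] False that proj_pt_uminus[OF that]
      by (metis neg_0_le_iff_le linear neg_equal_0_iff_equal)
  qed (use pos that in blast)
  then have "proj_pt ` (span {v, w} - {0}) \<subseteq> D"
    by (auto simp: span_pair_eq)
  then show False
    using D projective_line_through[OF vw] by (auto simp: proj_convex_def)
qed

text \<open>The dichotomy selects one of \<open>v\<close> and \<open>- v\<close> for every vector
  over \<open>D\<close>, and connectedness makes the selection consistent under addition.
  Pointedness of the closure reflects that \<open>D\<close> contains no affine line.\<close>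

lemma properly_convex_cone:
  fixes D :: "(real, 'n::finite) proj_space set"
  assumes "open D" and D: "properly_convex D" and "D \<noteq> {}"
  obtains C where "open C" "C \<noteq> {}" "\<And>x y. x \<in> C \<Longrightarrow> y \<in> C \<Longrightarrow> x + y \<in> C"
    "\<And>c x. 0 < c \<Longrightarrow> x \<in> C \<Longrightarrow> c *\<^sub>R x \<in> C"
    "\<And>x. x \<in> closure C \<Longrightarrow> - x \<in> closure C \<Longrightarrow> x = 0"
    "{v. v \<noteq> 0 \<and> proj_pt v \<in> D} = C \<union> uminus ` C"
proof -
  have conv: "proj_convex D"
    using D by (simp add: properly_convex_def)
  define U where "U = {v. v \<noteq> 0 \<and> proj_pt v \<in> D}"
  have "open U"
    using assms(1) by (simp add: U_def open_proj_space_def)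
  have U_uminus: "- v \<in> U" if "v \<in> U" for v
    using that proj_pt_uminus[of v] by (simp add: U_def)
  have U_scale: "c *\<^sub>R v \<in> U" if "v \<in> U" "c \<noteq> 0" for c v
    using that proj_pt_scaleR[of c v] by (simp add: U_def)
  obtain p where "p \<in> D"
    using assms(3) by blast
  then obtain v0 where v0: "v0 \<noteq> 0" "proj_pt v0 \<in> D" "v0 \<in> U"
    using proj_pt_surj[of p] by (auto simp: U_def)
  \<comment> \<open>This turns out to be the component of \<open>v0\<close> in \<open>U\<close>.
    Reaching \<open>v\<close> from \<open>v0\<close> along a segment in \<open>U\<close> is the form
    in which the dichotomy decides between \<open>v\<close> and \<open>- v\<close>.\<close>
  define C where "C = {v. closed_segment v0 v \<subseteq> U}"
  have CU: "C \<subseteq> U"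
    by (auto simp: C_def)
  have "0 \<notin> U"
    by (simp add: U_def)
  have not_both: False if "v \<in> C" "- v \<in> C" for v
  proof (cases "\<exists>c. v = c *\<^sub>R v0")
    case True
    then obtain c where c: "v = c *\<^sub>R v0" by blast
    \<comment> \<open>The segment lemmas do not cover collinear vectors. Here a nonpositive multiple
      of \<open>v0\<close> is excluded because the segment runs through 0, at parameter
      \<open>1 / (1 - c)\<close>.\<close>
    have zero: "0 \<in> closed_segment v0 (c *\<^sub>R v0)" if "c \<le> 0" for c
    proof -
      have "(1 - 1 / (1 - c)) *\<^sub>R v0 + (1 / (1 - c)) *\<^sub>R (c *\<^sub>R v0) = (1 - 1 / (1 - c) + c / (1 - c)) *\<^sub>R v0"
        by (simp add: algebra_simps)
      also have "1 - 1 / (1 - c) + c / (1 - c) = 0"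
        using \<open>c \<le> 0\<close> by (simp add: field_simps)
      finally show ?thesis
        using \<open>c \<le> 0\<close> unfolding in_segment
        by (intro exI[where x = "1 / (1 - c)"]) (auto simp: field_simps)
    qed
    show False
      using zero[of c] zero[of "- c"] c that \<open>0 \<notin> U\<close> by (cases "c \<le> 0") (auto simp: C_def)
  next
    case False
    then show False
      using segments_not_both[OF conv v0(1)] that by (auto simp: C_def U_def)
  qed
  have either: "v \<in> C \<or> - v \<in> C" if "v \<in> U" for v
  proof (cases "\<exists>c. v = c *\<^sub>R v0")
    case True
    have pos: "c *\<^sub>R v0 \<in> C" if "c > 0" for c
    proof -
      have "(1 - u) *\<^sub>R v0 + u *\<^sub>R (c *\<^sub>R v0) \<in> U" if "0 \<le> u" "u \<le> 1" for u
      proof -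
        have "(1 - u) + u * c > 0"
          using \<open>c > 0\<close> that by (cases "u = 1") (auto intro!: add_pos_nonneg)
        then show ?thesis
          using U_scale[OF v0(3), of "(1 - u) + u * c"] by (simp add: algebra_simps)
      qed
      then show ?thesis
        by (auto simp: C_def in_segment)
    qed
    obtain c where c: "v = c *\<^sub>R v0"
      using True by blast
    moreover have "c \<noteq> 0"
      using that c by (auto simp: U_def)
    ultimately show ?thesis
      using pos[of c] pos[of "- c"] by (cases "c > 0") auto
  next
    case False
    have "proj_pt ` closed_segment v0 v \<subseteq> D \<or> proj_pt ` closed_segment v0 (- v) \<subseteq> D"
      using segment_dichotomy[OF conv v0(1) False v0(2)] that by (auto simp: U_def)
    \<comment> \<open>A segment over \<open>D\<close> lies in \<open>U\<close> only if it misses 0,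
      where \<open>proj_pt\<close> has no meaning.\<close>
    moreover have "0 \<notin> closed_segment v0 (c *\<^sub>R v)" if "c \<noteq> 0" for c
    proof
      assume "0 \<in> closed_segment v0 (c *\<^sub>R v)"
      then obtain u where u: "(1 - u) *\<^sub>R v0 + (u * c) *\<^sub>R v = 0"
        by (auto simp: in_segment)
      then have "u \<noteq> 0"
        using v0(1) by auto
      then have "v = (- (1 - u) / (u * c)) *\<^sub>R v0"
        using u that by (simp add: eq_vector_fraction_iff add_eq_0_iff algebra_simps)
      then show False
        using False by blast
    qed
    from this[of 1] this[of "-1"] have "0 \<notin> closed_segment v0 v" "0 \<notin> closed_segment v0 (- v)"
      by auto
    ultimately have "closed_segment v0 v \<subseteq> U \<or> closed_segment v0 (- v) \<subseteq> U"
      by (force simp: U_def)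
    then show ?thesis
      by (simp add: C_def)
  qed
  have U_eq: "U = C \<union> uminus ` C"
  proof (intro equalityI subsetI)
    fix v assume "v \<in> U"
    then show "v \<in> C \<union> uminus ` C"
      using either[of v] image_eqI[of v uminus "- v" C] by auto
  qed (use CU U_uminus in auto)
  have "open C"
    unfolding open_contains_ball
  proof
    fix v assume "v \<in> C"
    \<comment> \<open>Compactness gives the segment a neighbourhood of uniform width in
      \<open>U\<close>; moving the endpoint by less than \<open>e\<close> moves each of its points
      by less than \<open>e\<close>.\<close>
    obtain e where e: "e > 0" "(\<Union>x\<in>closed_segment v0 v. ball x e) \<subseteq> U"
      using compact_subset_open_imp_ball_epsilon_subset[OF compact_segment \<open>open U\<close>] \<open>v \<in> C\<close>
      by (auto simp: C_def)
    have "v' \<in> C" if "dist v v' < e" for v'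
    proof -
      have "(1 - u) *\<^sub>R v0 + u *\<^sub>R v' \<in> U" if "0 \<le> u" "u \<le> 1" for u
      proof -
        have "dist ((1 - u) *\<^sub>R v0 + u *\<^sub>R v) ((1 - u) *\<^sub>R v0 + u *\<^sub>R v') = u * dist v v'"
          using that by (simp add: dist_norm scaleR_diff_right[symmetric])
        also have "\<dots> \<le> dist v v'"
          using that by (simp add: mult_left_le_one_le)
        finally have "(1 - u) *\<^sub>R v0 + u *\<^sub>R v' \<in> ball ((1 - u) *\<^sub>R v0 + u *\<^sub>R v) e"
          using \<open>dist v v' < e\<close> by simp
        moreover have "(1 - u) *\<^sub>R v0 + u *\<^sub>R v \<in> closed_segment v0 v"
          using that by (auto simp: in_segment)
        ultimately show ?thesis
          using e by blast
      qed
      then show ?thesis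
        by (auto simp: C_def in_segment)
    qed
    then show "\<exists>e>0. ball v e \<subseteq> C"
      using e by auto
  qed
  have "open (uminus ` C)"
    using \<open>open C\<close> by (rule open_negations)
  have "C \<inter> uminus ` C = {}"
    using not_both by auto
  \<comment> \<open>\<open>C\<close> and its negative are disjoint open sets covering
    \<open>U\<close>, so a connected part of \<open>U\<close> cannot change sides.\<close>
  have conn: "S \<subseteq> C" if "connected S" "S \<subseteq> U" "x \<in> S" "x \<in> C" for S x
    using connectedD[OF that(1) \<open>open C\<close> \<open>open (uminus ` C)\<close>] that U_eq \<open>C \<inter> uminus ` C = {}\<close> by blast
  have C_scale: "c *\<^sub>R x \<in> C" if "0 < c" "x \<in> C" for c x
  proof -
    have "x \<in> U"
      using that CU by blast
    have "connected ((\<lambda>t. t *\<^sub>R x) ` {0<..})"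
      by (intro connected_continuous_image continuous_intros connected_Ioi)
    moreover have "(\<lambda>t. t *\<^sub>R x) ` {0<..} \<subseteq> U"
      using U_scale[OF \<open>x \<in> U\<close>] by auto
    moreover have "x \<in> (\<lambda>t. t *\<^sub>R x) ` {0<..}"
      by (rule image_eqI[where x = 1]) auto
    ultimately have "(\<lambda>t. t *\<^sub>R x) ` {0<..} \<subseteq> C"
      using conn that(2) by blast
    then show ?thesis
      using that by auto
  qed
  \<comment> \<open>Of the two segments offered by the dichotomy, the one from \<open>x\<close> to
    \<open>- y\<close> would carry membership in \<open>C\<close> over to \<open>- y\<close>,
    against \<open>not_both\<close>.\<close>
  have seg_C: "closed_segment x y \<subseteq> C" if "x \<in> C" "y \<in> C" for x y
  proof (cases "\<exists>c. y = c *\<^sub>R x")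
    case True
    then obtain c where c: "y = c *\<^sub>R x"
      by blast
    have "c > 0"
    proof (rule ccontr)
      assume "\<not> c > 0"
      moreover have "c \<noteq> 0"
        using c that CU \<open>0 \<notin> U\<close> by auto
      ultimately have "(- 1 / c) *\<^sub>R y \<in> C"
        using C_scale[of "- 1 / c" y] that by (auto simp: divide_neg_neg)
      then show False
        using c \<open>c \<noteq> 0\<close> not_both[of x] that by simp
    qed
    have "(1 - u) *\<^sub>R x + u *\<^sub>R y \<in> C" if "0 \<le> u" "u \<le> 1" for u
    proof -
      have "(1 - u) + u * c > 0"
        using \<open>c > 0\<close> that by (cases "u = 1") (auto intro!: add_pos_nonneg)
      then show ?thesis
        using C_scale[OF _ \<open>x \<in> C\<close>, of "(1 - u) + u * c"] c by (simp add: algebra_simps)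
    qed
    then show ?thesis
      by (auto simp: in_segment)
  next
    case False
    have xy: "x \<noteq> 0" "proj_pt x \<in> D" "proj_pt y \<in> D" "x \<in> U" "y \<in> U"
      using that CU by (auto simp: U_def)
    have nz: "0 \<notin> closed_segment x (c *\<^sub>R y)" if "c \<noteq> 0" for c
    proof
      assume "0 \<in> closed_segment x (c *\<^sub>R y)"
      then obtain u where u: "(1 - u) *\<^sub>R x + (u * c) *\<^sub>R y = 0"
        by (auto simp: in_segment)
      then have "u \<noteq> 0"
        using xy(1) by auto
      then have "y = (- (1 - u) / (u * c)) *\<^sub>R x"
        using u that by (simp add: eq_vector_fraction_iff add_eq_0_iff algebra_simps)
      then show False
        using False by blast
    qed
    from nz[of 1] nz[of "-1"] have "0 \<notin> closed_segment x y" "0 \<notin> closed_segment x (- y)"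
      by auto
    moreover have "proj_pt ` closed_segment x y \<subseteq> D \<or> proj_pt ` closed_segment x (- y) \<subseteq> D"
      using segment_dichotomy[OF conv xy(1) False xy(2,3)] .
    ultimately consider "closed_segment x y \<subseteq> U" | "closed_segment x (- y) \<subseteq> U"
      by (force simp: U_def)
    then show ?thesis
    proof cases
      case 1
      then show ?thesis
        using conn[of "closed_segment x y" x] that by auto
    next
      case 2
      then have "- y \<in> C"
        using conn[of "closed_segment x (- y)" x] that by auto
      then show ?thesis
        using not_both that by blast
    qed
  qed
  have C_add: "x + y \<in> C" if "x \<in> C" "y \<in> C" for x y
  proof -
    have "(1 - 1/2) *\<^sub>R x + (1/2 :: real) *\<^sub>R y \<in> closed_segment x y"
      unfolding in_segment by (intro exI[where x = "1/2"]) auto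
    then have "2 *\<^sub>R ((1 - 1/2) *\<^sub>R x + (1/2 :: real) *\<^sub>R y) \<in> C"
      using seg_C[OF that] by (intro C_scale) auto
    then show ?thesis
      by (simp add: scaleR_add_right)
  qed
  \<comment> \<open>Approximating \<open>y\<close> by \<open>y'\<close> in \<open>C\<close> leaves
    an error \<open>y - y'\<close> that the open set \<open>C\<close> absorbs at
    \<open>x\<close>.\<close>
  have C_closure: "x + y \<in> C" if x: "x \<in> C" and y: "y \<in> closure C" for x y
  proof -
    obtain e where e: "e > 0" "ball x e \<subseteq> C"
      using \<open>open C\<close> x open_contains_ball by blast
    then obtain y' where y': "y' \<in> C" "dist y' y < e"
      using y closure_approachable by blast
    have "x + (y - y') \<in> ball x e"
      using y' by (simp add: dist_norm norm_minus_commute)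
    then have "(x + (y - y')) + y' \<in> C"
      using C_add e y' by blast
    then show ?thesis
      by simp
  qed
  have pointed: "x = 0" if x: "x \<in> closure C" "- x \<in> closure C" for x
  proof (rule ccontr)
    assume "x \<noteq> 0"
    have "C \<noteq> {}"
      using either[OF v0(3)] by blast
    then obtain v where v: "v \<in> C"
      by blast
    have closure_scale: "c *\<^sub>R y \<in> closure C" if "0 < c" "y \<in> closure C" for c y
    proof -
      have "(*\<^sub>R) c ` closure C = closure ((*\<^sub>R) c ` C)"
        by (rule closure_scaleR)
      also have "\<dots> \<subseteq> closure C"
        using C_scale \<open>0 < c\<close> by (intro closure_mono) auto
      finally show ?thesis
        using that by blast
    qed
    \<comment> \<open>If the closure contains both \<open>x\<close> and \<open>- x\<close>,
      absorption puts the full line through \<open>v\<close> in direction \<open>x\<close> into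
      \<open>C\<close>. Its image is a projective line without the point \<open>proj_pt x\<close>,
      that is, an affine line in \<open>D\<close>.\<close>
    have line: "v + t *\<^sub>R x \<in> C" for t
    proof (cases "t = 0")
      case False
      then have "t *\<^sub>R x \<in> closure C"
        using closure_scale[of t x] closure_scale[of "- t" "- x"] x by (cases "t > 0") auto
      then show ?thesis
        using C_closure[OF v] by blast
    qed (use v in simp)
    have indep: "\<nexists>c. v = c *\<^sub>R x"
    proof
      assume "\<exists>c. v = c *\<^sub>R x"
      then obtain c where "v = c *\<^sub>R x"
        by blast
      then have "v + (- c) *\<^sub>R x = 0"
        by simp
      then show False
        using line CU \<open>0 \<notin> U\<close> by (metis subsetD)
    qed
    let ?L = "proj_pt ` (span {x, v} - {0})"
    have "projective_line ?L"
      using projective_line_through[OF \<open>x \<noteq> 0\<close> indep] .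
    moreover have "proj_pt x \<in> ?L"
      using \<open>x \<noteq> 0\<close> by (auto intro: span_base)
    ultimately have "affine_line (?L - {proj_pt x})"
      unfolding affine_line_def by blast
    moreover have "?L - {proj_pt x} \<subseteq> D"
    proof
      fix q assume "q \<in> ?L - {proj_pt x}"
      then obtain \<alpha> \<beta> where q: "q = proj_pt (\<alpha> *\<^sub>R x + \<beta> *\<^sub>R v)" "\<alpha> *\<^sub>R x + \<beta> *\<^sub>R v \<noteq> 0" "q \<noteq> proj_pt x"
        by (auto simp: span_pair_eq)
      have "\<beta> \<noteq> 0"
      proof
        assume "\<beta> = 0"
        then show False
          using q proj_pt_scaleR[of \<alpha> x] \<open>x \<noteq> 0\<close> by auto
      qed
      then have "\<alpha> *\<^sub>R x + \<beta> *\<^sub>R v = \<beta> *\<^sub>R (v + (\<alpha> / \<beta>) *\<^sub>R x)"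
        by (simp add: algebra_simps)
      moreover have "\<beta> *\<^sub>R (v + (\<alpha> / \<beta>) *\<^sub>R x) \<in> U"
        using line CU \<open>\<beta> \<noteq> 0\<close> by (intro U_scale) auto
      ultimately show "q \<in> D"
        using q by (simp add: U_def)
    qed
    ultimately show False
      using D by (simp add: properly_convex_def)
  qed
  show thesis
    using that[OF \<open>open C\<close> _ C_add C_scale pointed] either[OF v0(3)] U_eq by (auto simp: U_def)
qed

section \<open>Estimates for holomorphic functions on the disc\<close>

lemma pseudohyperbolic_lt_1:
  assumes "a \<in> unit_disc" "b \<in> unit_disc"
  shows "cmod ((a - b) / (1 - cnj b * a)) < 1"
  using Moebius_function_norm_lt_1[of b a 0] assms by (simp add: Moebius_function_simple)

lemma pseudohyperbolic_sym:
  "cmod ((a - b) / (1 - cnj b * a)) = cmod ((b - a) / (1 - cnj a * b))"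
proof -
  have "1 - cnj a * b = cnj (1 - cnj b * a)"
    by (simp add: mult.commute)
  then have "cmod (1 - cnj a * b) = cmod (1 - cnj b * a)"
    by (simp only: complex_mod_cnj)
  then show ?thesis
    by (simp only: norm_divide norm_minus_commute)
qed

text \<open>Schwarz's lemma speaks about the centre; precomposing with \<open>m\<close> brings
  \<open>a\<close> there, and the modulus of the parameter of \<open>b\<close> is the
  pseudohyperbolic distance.\<close>

lemma moebius_automorphism:
  assumes "a \<in> unit_disc" "b \<in> unit_disc"
  obtains m \<zeta> where "m holomorphic_on unit_disc" "m ` unit_disc \<subseteq> unit_disc" "m 0 = a" "m \<zeta> = b"
    "\<zeta> \<in> unit_disc" "cmod \<zeta> = cmod ((a - b) / (1 - cnj b * a))"
proof -
  have ab: "cmod a < 1" "cmod b < 1"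
    using assms by auto
  show thesis
  proof (rule that[of "Moebius_function 0 (- a)" "Moebius_function 0 a b"])
    show "Moebius_function 0 (- a) holomorphic_on unit_disc"
      using ab by (intro Moebius_function_holomorphic) simp
    show "Moebius_function 0 (- a) ` unit_disc \<subseteq> unit_disc"
      using ab Moebius_function_norm_lt_1[of "- a" _ 0] by auto
    show "Moebius_function 0 (- a) 0 = a"
      by (simp add: Moebius_function_of_zero)
    show "Moebius_function 0 (- a) (Moebius_function 0 a b) = b"
      using ab by (intro Moebius_function_compose) auto
    show "Moebius_function 0 a b \<in> unit_disc"
      using Moebius_function_norm_lt_1[OF ab] by simp
    show "cmod (Moebius_function 0 a b) = cmod ((a - b) / (1 - cnj b * a))"
      by (simp only: Moebius_function_simple pseudohyperbolic_sym[of a b])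
  qed
qed

lemma poincare_dist_commute: "poincare_dist a b = poincare_dist b a"
  unfolding poincare_dist_def by (subst pseudohyperbolic_sym) simp

text \<open>Since \<open>artanh t\<close> is half of \<open>ln ((1 + t) / (1 - t))\<close>, the
  factor 2 turns the Poincare distance into the constant of Harnack's inequality.\<close>

lemma exp_poincare_dist:
  assumes "a \<in> unit_disc" "b \<in> unit_disc"
  defines "t \<equiv> cmod ((a - b) / (1 - cnj b * a))"
  shows "exp (- 2 * poincare_dist a b) = (1 - t) / (1 + t)"
proof -
  have "0 \<le> t" "t < 1"
    using pseudohyperbolic_lt_1 assms by auto
  then have "0 < (1 + t) / (1 - t)"
    by (simp add: add_pos_nonneg)
  moreover have "- 2 * poincare_dist a b = - ln ((1 + t) / (1 - t))"
    by (simp add: poincare_dist_def artanh_def t_def)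
  ultimately show ?thesis
    by (simp add: exp_minus)
qed

text \<open>From \<open>1 - x \<le> exp (- x)\<close>. The factor 2 is not sharp; any linear bound
  makes bounded holomorphic functions Lipschitz.\<close>

lemma pseudohyperbolic_le_poincare_dist:
  assumes "a \<in> unit_disc" "b \<in> unit_disc"
  shows "cmod ((a - b) / (1 - cnj b * a)) \<le> 2 * poincare_dist a b"
proof -
  let ?t = "cmod ((a - b) / (1 - cnj b * a))"
  have t: "0 \<le> ?t" "?t < 1"
    using pseudohyperbolic_lt_1 assms by auto
  have "1 - 2 * poincare_dist a b \<le> exp (- 2 * poincare_dist a b)"
    using exp_ge_add_one_self[of "- 2 * poincare_dist a b"] by simp
  also have "\<dots> = (1 - ?t) / (1 + ?t)"
    by (rule exp_poincare_dist[OF assms])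
  also have "\<dots> \<le> 1 - ?t"
    using t by (intro divide_le_eq_1_pos[THEN iffD2] | simp add: pos_divide_le_eq add_pos_nonneg mult_left_mono)+
  finally show ?thesis
    by linarith
qed

lemma poincare_dist_nonneg:
  assumes "a \<in> unit_disc" "b \<in> unit_disc"
  shows "0 \<le> poincare_dist a b"
  using pseudohyperbolic_le_poincare_dist[OF assms]
    norm_ge_zero[of "(a - b) / (1 - cnj b * a)"] by linarith

text \<open>Schwarz's lemma for \<open>h - h a\<close>, which is bounded by \<open>2 * B\<close>;
  the other factor 2 is that of the linear bound on the pseudohyperbolic distance.\<close>

lemma bounded_holomorphic_lipschitz:
  assumes h: "h holomorphic_on unit_disc" "\<And>z. z \<in> unit_disc \<Longrightarrow> cmod (h z) < B"
    and ab: "a \<in> unit_disc" "b \<in> unit_disc"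
  shows "cmod (h a - h b) \<le> 4 * B * poincare_dist a b"
proof -
  have "B > 0"
    using le_less_trans[OF norm_ge_zero h(2)[of 0]] by simp
  obtain m \<zeta> where m: "m holomorphic_on unit_disc" "m ` unit_disc \<subseteq> unit_disc" "m 0 = a" "m \<zeta> = b"
    "\<zeta> \<in> unit_disc" "cmod \<zeta> = cmod ((a - b) / (1 - cnj b * a))"
    using moebius_automorphism[OF ab] by blast
  define k where "k z = (h (m z) - h a) / of_real (2 * B)" for z
  have "(h \<circ> m) holomorphic_on unit_disc"
    using m h by (intro holomorphic_on_compose_gen)
  then have "k holomorphic_on unit_disc"
    unfolding k_def o_def using \<open>B > 0\<close> by (intro holomorphic_intros) auto
  moreover have "k 0 = 0"
    by (simp add: k_def m)
  moreover have "cmod (k z) < 1" if "cmod z < 1" for z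
  proof -
    have "m z \<in> unit_disc"
      using m(2) that by (auto simp: image_subset_iff)
    then have "cmod (h (m z) - h a) < 2 * B"
      using norm_triangle_ineq4[of "h (m z)" "h a"] h(2)[of "m z"] h(2)[OF ab(1)] by linarith
    then show ?thesis
      using \<open>B > 0\<close> by (simp add: k_def norm_divide norm_mult)
  qed
  ultimately have "cmod (k \<zeta>) \<le> cmod \<zeta>"
    using Schwarz_Lemma(1) m(5) by auto
  then have "cmod (h b - h a) \<le> 2 * B * cmod \<zeta>"
    using \<open>B > 0\<close> by (simp add: k_def m norm_divide norm_mult field_simps)
  also have "\<dots> \<le> 2 * B * (2 * poincare_dist a b)"
    using pseudohyperbolic_le_poincare_dist[OF ab] \<open>B > 0\<close> m(6) by (intro mult_left_mono) auto
  finally show ?thesis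
    by (simp add: norm_minus_commute)
qed

lemma harnack:
  assumes h: "h holomorphic_on unit_disc" "\<And>z. z \<in> unit_disc \<Longrightarrow> Re (h z) > 0"
    and ab: "a \<in> unit_disc" "b \<in> unit_disc"
  shows "exp (- 2 * poincare_dist a b) * Re (h a) \<le> Re (h b)"
proof -
  obtain m \<zeta> where m: "m holomorphic_on unit_disc" "m ` unit_disc \<subseteq> unit_disc" "m 0 = a" "m \<zeta> = b"
    "\<zeta> \<in> unit_disc" "cmod \<zeta> = cmod ((a - b) / (1 - cnj b * a))"
    using moebius_automorphism[OF ab] by blast
  have nz: "w + cnj (h a) \<noteq> 0" if "Re w > 0" for w
    using that h(2)[OF ab(1)] by (auto simp: complex_eq_iff)
  have hm: "Re (h (m z)) > 0" if "z \<in> unit_disc" for z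
    using m(2) h(2) that by blast
  \<comment> \<open>A Cayley transform, taking the right half-plane to the disc and
    \<open>h a\<close> to 0.\<close>
  define k where "k z = (h (m z) - h a) / (h (m z) + cnj (h a))" for z
  have "(h \<circ> m) holomorphic_on unit_disc"
    using m h by (intro holomorphic_on_compose_gen)
  then have "k holomorphic_on unit_disc"
    unfolding k_def o_def using nz hm by (intro holomorphic_intros) auto
  moreover have "k 0 = 0"
    by (simp add: k_def m)
  moreover have "cmod (k z) < 1" if "cmod z < 1" for z
  proof -
    have pos: "Re (h (m z)) > 0" "Re (h a) > 0"
      using hm h(2) ab that by auto
    have "(cmod (h (m z) - h a))^2 = (cmod (h (m z) + cnj (h a)))^2 - 4 * Re (h (m z)) * Re (h a)"
      unfolding cmod_power2 by (simp add: power2_eq_square algebra_simps)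
    also have "\<dots> < (cmod (h (m z) + cnj (h a)))^2"
      using pos by simp
    finally have "cmod (h (m z) - h a) < cmod (h (m z) + cnj (h a))"
      by (rule power2_less_imp_less) simp
    then show ?thesis
      using nz[OF pos(1)] by (simp add: k_def norm_divide)
  qed
  ultimately have k: "cmod (k \<zeta>) \<le> cmod \<zeta>"
    using Schwarz_Lemma(1) m(5) by auto
  define s where "s = cmod (k \<zeta>)"
  define t where "t = cmod \<zeta>"
  have st: "0 \<le> s" "s \<le> t" "t < 1"
    using k m(5) by (auto simp: s_def t_def)
  define w where "w = h b"
  define v where "v = h a"
  have wv: "Re w > 0" "Re v > 0"
    using h(2) ab by (auto simp: w_def v_def)
  have "w + cnj v \<noteq> 0"
    using nz[OF wv(1)] by (simp add: v_def)
  have s_eq: "s * cmod (w + cnj v) = cmod (w - v)"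
    using \<open>w + cnj v \<noteq> 0\<close> by (simp add: s_def k_def m w_def v_def norm_divide)

  have "cmod (of_real (2 * Re v)) \<le> cmod (w + cnj v) + cmod (w - v)"
  proof -
    have "of_real (2 * Re v) = (w + cnj v) - (w - v)"
      by (simp add: complex_eq_iff)
    then show ?thesis
      using norm_triangle_ineq4[of "w + cnj v" "w - v"] by simp
  qed
  then have 1: "2 * Re v \<le> (1 + s) * cmod (w + cnj v)"
    using wv s_eq by (simp add: algebra_simps)
  have 2: "(1 - s^2) * (cmod (w + cnj v))^2 = 4 * Re w * Re v"
  proof -
    have "s^2 * (cmod (w + cnj v))^2 = (cmod (w - v))^2"
      by (simp flip: s_eq add: power_mult_distrib)
    then show ?thesis
      unfolding left_diff_distrib cmod_power2 by (simp add: power2_eq_square algebra_simps)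
  qed
  \<comment> \<open>Squaring \<open>1\<close> produces the quantity that \<open>2\<close> evaluates.
    Cancelling \<open>4 * Re v\<close> leaves Harnack's inequality with \<open>s\<close>, and
    \<open>s \<le> t\<close> weakens it to the one with \<open>t\<close>.\<close>
  have "(2 * Re v)^2 \<le> ((1 + s) * cmod (w + cnj v))^2"
    using 1 wv by (intro power_mono) auto
  then have "(1 - s) * (2 * Re v)^2 \<le> (1 - s) * ((1 + s) * cmod (w + cnj v))^2"
    using st by (intro mult_left_mono) auto
  also have "\<dots> = (1 + s) * ((1 - s^2) * (cmod (w + cnj v))^2)"
    by (simp add: power2_eq_square algebra_simps)
  also have "\<dots> = (1 + s) * (4 * Re w * Re v)"
    by (simp only: 2)
  finally have "(1 - s) * Re v * (4 * Re v) \<le> (1 + s) * Re w * (4 * Re v)"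
    by (simp add: power2_eq_square algebra_simps)
  then have "(1 - s) * Re v \<le> (1 + s) * Re w"
    using wv by (simp add: mult_le_cancel_right)
  then have "(1 - t) * Re v \<le> (1 + t) * Re w"
    using st wv by (smt (verit) mult_right_mono)
  then have "(1 - t) / (1 + t) * Re v \<le> Re w"
    using st by (simp add: pos_divide_le_eq mult.commute)
  then show ?thesis
    unfolding exp_poincare_dist[OF ab] by (simp add: t_def m(6) w_def v_def)
qed

text \<open>Cauchy's integral formula: on the parametrised circle the denominator
  \<open>u - a\<close> cancels against the derivative, up to the factor \<open>\<i>\<close>.\<close>

lemma mean_value_holomorphic:
  assumes h: "h holomorphic_on S" "cball a r \<subseteq> S" "r > 0"
  shows "((\<lambda>t. h (a + of_real r * cis t)) has_integral (of_real (2 * pi) * h a)) {0..2 * pi}"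
proof -
  have "((\<lambda>u. h u / (u - a)) has_contour_integral (2 * of_real pi * \<i> * h a)) (part_circlepath a r 0 (2 * pi))"
    using Cauchy_integral_circlepath_simple[of h a r a] h holomorphic_on_subset
    by (auto simp: circlepath_def)
  then have "((\<lambda>t. h (a + r * cis t) / (a + r * cis t - a) * r * \<i> * cis t)
      has_integral (2 * of_real pi * \<i> * h a)) {0..2 * pi}"
    by (subst (asm) has_contour_integral_part_circlepath_iff) auto
  moreover have "h (a + r * cis t) / (a + r * cis t - a) * r * \<i> * cis t = \<i> * h (a + r * cis t)" for t
    using h(3) by simp
  ultimately have "((\<lambda>t. \<i> * h (a + r * cis t)) has_integral (2 * of_real pi * \<i> * h a)) {0..2 * pi}"
    by (simp only:)
  from has_integral_mult_right[OF this, of "- \<i>"]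
  have "((\<lambda>t. - \<i> * (\<i> * h (a + r * cis t))) has_integral - \<i> * (2 * of_real pi * \<i> * h a)) {0..2 * pi}" .
  moreover have "- \<i> * (\<i> * x) = x" "- \<i> * (2 * of_real pi * \<i> * x) = of_real (2 * pi) * x" for x
    by (simp_all add: complex_eq_iff)
  ultimately show ?thesis
    by (simp only:)
qed

section \<open>The Kobayashi pseudodistance\<close>

lemma norm_smult: "norm (c *s v) = cmod c * norm (v :: complex ^ 'n::finite)"
  by (simp add: norm_vec_def norm_mult L2_set_right_distrib)

lemma holomorphic_into_proj_proj_pt:
  fixes Z :: "complex \<Rightarrow> complex ^ 'n::finite"
  assumes "\<And>i. (\<lambda>z. Z z $ i) holomorphic_on S" "\<And>z. z \<in> S \<Longrightarrow> Z z \<noteq> 0"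
  shows "holomorphic_into_proj (\<lambda>z. proj_pt (Z z)) S"
  unfolding holomorphic_into_proj_def
proof (intro conjI allI)
  have "continuous_on S (\<lambda>z. \<chi> i. Z z $ i)"
    using assms(1) by (intro continuous_on_vec_lambda holomorphic_on_imp_continuous_on)
  then have "continuous_on S Z"
    by simp
  then show "continuous_on S (\<lambda>z. proj_pt (Z z))"
    using assms(2) by (intro continuous_on_compose2[OF continuous_on_proj_pt]) auto
  fix j i
  let ?S = "{z \<in> S. proj_pt (Z z) \<in> chart_dom j}"
  have nz: "Z z $ j \<noteq> 0" if "z \<in> ?S" for z
    using that assms(2) proj_pt_in_chart_dom_iff by blast
  have "(\<lambda>z. Z z $ i / Z z $ j) holomorphic_on ?S"
    using nz by (intro holomorphic_intros holomorphic_on_subset[OF assms(1)]) auto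
  then show "(\<lambda>z. affine_coords j (proj_pt (Z z)) $ i) holomorphic_on ?S"
    by (rule holomorphic_transform) (use nz in \<open>simp add: affine_coords_proj_pt\<close>)
qed

lemma kobayashi_chain_lengths_nonneg:
  assumes "l \<in> kobayashi_chain_lengths \<Omega> p q"
  shows "0 \<le> l"
  using assms unfolding kobayashi_chain_lengths_def by (auto intro!: sum_nonneg poincare_dist_nonneg)

lemma kobayashi_chain_lengths_commute:
  assumes "l \<in> kobayashi_chain_lengths \<Omega> p q"
  shows "l \<in> kobayashi_chain_lengths \<Omega> q p"
proof -
  obtain m x f a b where c: "l = (\<Sum>k<m. poincare_dist (a k) (b k))" "x 0 = p" "x m = q"
    "\<And>k. k < m \<Longrightarrow> f k \<in> holomorphic_discs \<Omega> \<and> a k \<in> unit_disc \<and> b k \<in> unit_disc \<and>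
        f k (a k) = x k \<and> f k (b k) = x (Suc k)"
    using assms unfolding kobayashi_chain_lengths_def by blast
  \<comment> \<open>Link \<open>k\<close> of the reversed chain is link \<open>m - Suc k\<close> run
    backwards, from \<open>x (m - k)\<close> to \<open>x (m - Suc k)\<close>.\<close>
  let ?r = "\<lambda>k. m - Suc k"
  have "l = (\<Sum>k<m. poincare_dist (b (?r k)) (a (?r k)))"
    using sum.nat_diff_reindex[of "\<lambda>k. poincare_dist (a k) (b k)" m]
    by (simp add: c(1) poincare_dist_commute)
  moreover have "f (?r k) \<in> holomorphic_discs \<Omega> \<and> b (?r k) \<in> unit_disc \<and> a (?r k) \<in> unit_disc \<and>
      f (?r k) (b (?r k)) = x (m - k) \<and> f (?r k) (a (?r k)) = x (m - Suc k)" if "k < m" for k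
    using c(4)[of "?r k"] that by (simp add: Suc_diff_Suc)
  ultimately show ?thesis
    unfolding kobayashi_chain_lengths_def
    by (intro CollectI exI[where x = m] exI[where x = "\<lambda>k. x (m - k)"] exI[where x = "\<lambda>k. f (?r k)"]
        exI[where x = "\<lambda>k. b (?r k)"] exI[where x = "\<lambda>k. a (?r k)"]) (auto simp: c(2,3))
qed

lemma kobayashi_commute: "kobayashi \<Omega> p q = kobayashi \<Omega> q p"
proof -
  have "kobayashi_chain_lengths \<Omega> p q = kobayashi_chain_lengths \<Omega> q p"
    using kobayashi_chain_lengths_commute by blast
  then show ?thesis
    by (simp add: kobayashi_def)
qed

lemma kobayashi_refl [simp]: "kobayashi \<Omega> p p = 0"
proof -
  have "0 \<in> kobayashi_chain_lengths \<Omega> p p"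
    unfolding kobayashi_chain_lengths_def
    by (intro CollectI exI[where x = "0::nat"] exI[where x = "\<lambda>_. p"]) auto
  then have "kobayashi \<Omega> p p \<le> ennreal 0"
    unfolding kobayashi_def by (rule INF_lower)
  then show ?thesis
    by simp
qed

lemma kobayashi_disc:
  assumes "f \<in> holomorphic_discs \<Omega>" "a \<in> unit_disc" "b \<in> unit_disc"
  shows "kobayashi \<Omega> (f a) (f b) \<le> ennreal (poincare_dist a b)"
proof -
  have "poincare_dist a b \<in> kobayashi_chain_lengths \<Omega> (f a) (f b)"
    unfolding kobayashi_chain_lengths_def
    by (intro CollectI exI[where x = "1::nat"] exI[where x = "\<lambda>k. if k = 0 then f a else f b"]
        exI[where x = "\<lambda>_. f"] exI[where x = "\<lambda>_. a"] exI[where x = "\<lambda>_. b"]) (use assms in auto)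
  then show ?thesis
    unfolding kobayashi_def by (rule INF_lower)
qed

lemma kobayashi_chain_lengths_add:
  assumes "l \<in> kobayashi_chain_lengths \<Omega> p q" "l' \<in> kobayashi_chain_lengths \<Omega> q s"
  shows "l + l' \<in> kobayashi_chain_lengths \<Omega> p s"
proof -
  obtain m x f a b where c: "l = (\<Sum>k<m. poincare_dist (a k) (b k))" "x 0 = p" "x m = q"
    "\<And>k. k < m \<Longrightarrow> f k \<in> holomorphic_discs \<Omega> \<and> a k \<in> unit_disc \<and> b k \<in> unit_disc \<and>
        f k (a k) = x k \<and> f k (b k) = x (Suc k)"
    using assms(1) unfolding kobayashi_chain_lengths_def by blast
  obtain m' x' f' a' b' where c': "l' = (\<Sum>k<m'. poincare_dist (a' k) (b' k))" "x' 0 = q" "x' m' = s"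
    "\<And>k. k < m' \<Longrightarrow> f' k \<in> holomorphic_discs \<Omega> \<and> a' k \<in> unit_disc \<and> b' k \<in> unit_disc \<and>
        f' k (a' k) = x' k \<and> f' k (b' k) = x' (Suc k)"
    using assms(2) unfolding kobayashi_chain_lengths_def by blast
  define A where "A k = (if k < m then a k else a' (k - m))" for k
  define B where "B k = (if k < m then b k else b' (k - m))" for k
  define F where "F k = (if k < m then f k else f' (k - m))" for k
  \<comment> \<open>At index \<open>m\<close> the node is already taken from \<open>x'\<close>; it
    agrees with \<open>x m\<close> because both are \<open>q\<close>.\<close>
  define X where "X k = (if k < m then x k else x' (k - m))" for k
  have "(\<Sum>k<m + n. poincare_dist (A k) (B k)) =
      (\<Sum>k<m. poincare_dist (A k) (B k)) + (\<Sum>k<n. poincare_dist (A (k + m)) (B (k + m)))" for n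
    by (induction n) (auto simp: add_ac)
  then have "l + l' = (\<Sum>k<m + m'. poincare_dist (A k) (B k))"
    by (simp add: c(1) c'(1) A_def B_def)
  moreover have "F k \<in> holomorphic_discs \<Omega> \<and> A k \<in> unit_disc \<and> B k \<in> unit_disc \<and>
      F k (A k) = X k \<and> F k (B k) = X (Suc k)" if "k < m + m'" for k
  proof (cases "k < m")
    case True
    have "X (Suc k) = x (Suc k)"
      using True c(3) c'(2) by (cases "Suc k = m") (auto simp: X_def)
    then show ?thesis
      using True c(4)[OF True] by (simp add: F_def A_def B_def X_def)
  next
    case False
    then show ?thesis
      using c'(4)[of "k - m"] that by (simp add: F_def A_def B_def X_def Suc_diff_le)
  qed
  moreover have "X 0 = p" "X (m + m') = s"
    using c c' by (auto simp: X_def)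
  ultimately show ?thesis
    unfolding kobayashi_chain_lengths_def by blast
qed

lemma kobayashi_triangle: "kobayashi \<Omega> p s \<le> kobayashi \<Omega> p q + kobayashi \<Omega> q s"
proof (cases "kobayashi \<Omega> p q = \<infinity> \<or> kobayashi \<Omega> q s = \<infinity>")
  case False
  show ?thesis
  proof (rule ennreal_le_epsilon)
    fix e :: real assume "e > 0"
    have approx: "\<exists>l. l \<in> kobayashi_chain_lengths \<Omega> u v \<and> ennreal l < kobayashi \<Omega> u v + ennreal (e / 2)"
      if "kobayashi \<Omega> u v \<noteq> \<infinity>" for u v
    proof -
      have "kobayashi \<Omega> u v < kobayashi \<Omega> u v + ennreal (e / 2)"
        using that \<open>e > 0\<close> by (cases "kobayashi \<Omega> u v") (auto simp: ennreal_less_iff simp flip: ennreal_plus)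
      then show ?thesis
        unfolding kobayashi_def by (auto simp: INF_less_iff)
    qed
    obtain l l' where l: "l \<in> kobayashi_chain_lengths \<Omega> p q" "ennreal l < kobayashi \<Omega> p q + ennreal (e / 2)"
      and l': "l' \<in> kobayashi_chain_lengths \<Omega> q s" "ennreal l' < kobayashi \<Omega> q s + ennreal (e / 2)"
      using approx False by blast
    have "kobayashi \<Omega> p s \<le> ennreal (l + l')"
      unfolding kobayashi_def using kobayashi_chain_lengths_add[OF l(1) l'(1)] by (rule INF_lower)
    also have "\<dots> = ennreal l + ennreal l'"
      using kobayashi_chain_lengths_nonneg l(1) l'(1) by (intro ennreal_plus) auto
    also have "\<dots> \<le> (kobayashi \<Omega> p q + ennreal (e / 2)) + (kobayashi \<Omega> q s + ennreal (e / 2))"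
      using l(2) l'(2) by (intro add_mono) auto
    also have "\<dots> = kobayashi \<Omega> p q + kobayashi \<Omega> q s + ennreal e"
      using \<open>e > 0\<close> by (simp add: ac_simps flip: ennreal_plus)
    finally show "kobayashi \<Omega> p s \<le> kobayashi \<Omega> p q + kobayashi \<Omega> q s + ennreal e" .
  qed
qed auto

text \<open>Estimates along single discs add up along a chain by the triangle inequality. The two
  lower bounds for the distance arise in this way, with \<open>G\<close> the logarithm of the energy
  or the normalised coordinates.\<close>

lemma kobayashi_lower_bound:
  fixes G :: "(complex, 'n::finite) proj_space \<Rightarrow> 'b::metric_space"
  assumes "L > 0" and disc: "\<And>f a b. f \<in> holomorphic_discs \<Omega> \<Longrightarrow> a \<in> unit_disc \<Longrightarrow> b \<in> unit_disc \<Longrightarrow>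
      dist (G (f a)) (G (f b)) \<le> L * poincare_dist a b"
  shows "ennreal (dist (G p) (G q) / L) \<le> kobayashi \<Omega> p q"
  unfolding kobayashi_def
proof (rule INF_greatest)
  fix l assume "l \<in> kobayashi_chain_lengths \<Omega> p q"
  then obtain m x f a b where c: "l = (\<Sum>k<m. poincare_dist (a k) (b k))" "x 0 = p" "x m = q"
    "\<And>k. k < m \<Longrightarrow> f k \<in> holomorphic_discs \<Omega> \<and> a k \<in> unit_disc \<and> b k \<in> unit_disc \<and>
        f k (a k) = x k \<and> f k (b k) = x (Suc k)"
    unfolding kobayashi_chain_lengths_def by blast
  have "dist (G (x 0)) (G (x k)) \<le> L * (\<Sum>k<k. poincare_dist (a k) (b k))" if "k \<le> m" for k
    using that
  proof (induction k)
    case (Suc k)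
    have "dist (G (x k)) (G (x (Suc k))) \<le> L * poincare_dist (a k) (b k)"
      using disc[of "f k" "a k" "b k"] c(4)[of k] Suc.prems by auto
    then show ?case
      using Suc dist_triangle[of "G (x 0)" "G (x (Suc k))" "G (x k)"] by (simp add: distrib_left)
  qed simp
  then have "dist (G p) (G q) \<le> L * l"
    using c by auto
  then show "ennreal (dist (G p) (G q) / L) \<le> ennreal l"
    using \<open>L > 0\<close> by (intro ennreal_leI) (simp add: pos_divide_le_eq mult.commute)
qed

lemma kobayashi_ball:
  fixes z w :: "complex ^ 'n::finite"
  assumes ball: "ball z r \<subseteq> {v. v \<noteq> 0 \<and> proj_pt v \<in> \<Omega>}" and w: "dist z w < r"
  shows "kobayashi \<Omega> (proj_pt z) (proj_pt w) \<le> ennreal (artanh (dist z w / r))"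
proof (cases "w = z")
  case False
  define d where "d = dist z w"
  have "d > 0" "d < r"
    using False w by (auto simp: d_def)
  \<comment> \<open>The complex line through \<open>z\<close> and \<open>w\<close>, scaled so that
    the unit disc stays in the ball; \<open>w\<close> sits at parameter
    \<open>d / r\<close>.\<close>
  define Z where "Z l = z + l *s (of_real (r / d) *s (w - z))" for l
  have Z_ball: "Z l \<in> ball z r" if "l \<in> unit_disc" for l
  proof -
    have "Z l - z = (l * of_real (r / d)) *s (w - z)"
      unfolding Z_def vector_smult_assoc by simp
    then have "dist (Z l) z = cmod (l * of_real (r / d)) * norm (w - z)"
      unfolding dist_norm by (simp only: norm_smult)
    then have "dist z (Z l) = cmod l * (r / d * norm (w - z))"
      using \<open>d > 0\<close> \<open>d < r\<close> by (simp add: dist_commute norm_mult norm_divide)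
    also have "norm (w - z) = d"
      by (simp add: d_def dist_norm norm_minus_commute)
    also have "cmod l * (r / d * d) = cmod l * r"
      using \<open>d > 0\<close> by simp
    finally show ?thesis
      using that \<open>d > 0\<close> \<open>d < r\<close> by simp
  qed
  have "holomorphic_into_proj (\<lambda>l. proj_pt (Z l)) unit_disc"
  proof (rule holomorphic_into_proj_proj_pt)
    show "(\<lambda>l. Z l $ i) holomorphic_on unit_disc" for i
      unfolding Z_def vector_add_component vector_smult_component
      by (intro holomorphic_intros)
  qed (use Z_ball ball in blast)
  moreover have "(\<lambda>l. proj_pt (Z l)) ` unit_disc \<subseteq> \<Omega>"
    using Z_ball ball by blast
  ultimately have disc: "(\<lambda>l. proj_pt (Z l)) \<in> holomorphic_discs \<Omega>"
    by (simp add: holomorphic_discs_def)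
  have "of_real (d / r) \<in> unit_disc"
    using \<open>d > 0\<close> \<open>d < r\<close> by (simp add: norm_divide)
  then have "kobayashi \<Omega> (proj_pt (Z 0)) (proj_pt (Z (of_real (d / r)))) \<le> ennreal (poincare_dist 0 (of_real (d / r)))"
    by (intro kobayashi_disc[OF disc]) auto
  moreover have "Z 0 = z" "Z (of_real (d / r)) = w"
    using \<open>d > 0\<close> \<open>d < r\<close> by (auto simp: Z_def vector_smult_assoc)
  moreover have "poincare_dist 0 (of_real (d / r)) = artanh (d / r)"
    using \<open>d > 0\<close> \<open>d < r\<close> by (simp add: poincare_dist_def norm_divide)
  ultimately show ?thesis
    by (simp add: d_def)
qed simp

text \<open>Finite distance is an equivalence relation whose classes are open by
  \<open>kobayashi_ball\<close>, so a connected set meets only one class.\<close>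

lemma kobayashi_finite:
  fixes \<Omega> :: "(complex, 'n::finite) proj_space set"
  assumes "open \<Omega>" and S: "connected S" "S \<subseteq> {v. v \<noteq> 0 \<and> proj_pt v \<in> \<Omega>}" and zw: "z \<in> S" "w \<in> S"
  shows "kobayashi \<Omega> (proj_pt z) (proj_pt w) < \<infinity>"
proof (rule connected_equivalence_relation[OF S(1) zw, where R = "\<lambda>z w. kobayashi \<Omega> (proj_pt z) (proj_pt w) < \<infinity>"])
  fix z assume "z \<in> S"
  then obtain r where r: "r > 0" "ball z r \<subseteq> {v. v \<noteq> 0 \<and> proj_pt v \<in> \<Omega>}"
    using S(2) assms(1) unfolding open_proj_space_def open_contains_ball by blast
  have "kobayashi \<Omega> (proj_pt z) (proj_pt w) < \<infinity>" if "w \<in> ball z r" for w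
    using kobayashi_ball[OF r(2), of w] that by (auto intro: le_less_trans)
  then show "\<exists>T. openin (top_of_set S) T \<and> z \<in> T \<and> (\<forall>w\<in>T. kobayashi \<Omega> (proj_pt z) (proj_pt w) < \<infinity>)"
    using \<open>z \<in> S\<close> r(1) by (intro exI[where x = "S \<inter> ball z r"]) (auto intro: openin_open_Int)
next
  fix x y z assume "kobayashi \<Omega> (proj_pt x) (proj_pt y) < \<infinity>" "kobayashi \<Omega> (proj_pt y) (proj_pt z) < \<infinity>"
  then show "kobayashi \<Omega> (proj_pt x) (proj_pt z) < \<infinity>"
    using kobayashi_triangle[of \<Omega> "proj_pt x" "proj_pt z" "proj_pt y"]
    by (auto intro: le_less_trans simp: ennreal_add_less_top)
qed (simp add: kobayashi_commute)

lemma tendsto_artanh_dist: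
  fixes z :: "'a::real_normed_vector"
  assumes "r > 0"
  shows "((\<lambda>w. artanh (dist z w / r)) \<longlongrightarrow> 0) (nhds z)"
proof -
  have "((\<lambda>w. artanh (dist z w / r)) \<longlongrightarrow> artanh (dist z z / r)) (nhds z)"
    using assms by (intro tendsto_intros filterlim_ident) auto
  then show ?thesis
    by simp
qed

section \<open>The dual cone\<close>


text \<open>The complex-linear extension of the real functional
  \<open>\<lambda>x. f \<bullet> x\<close>.\<close>

definition functional :: "real ^ 'n \<Rightarrow> complex ^ 'n \<Rightarrow> complex"
  where "functional f z = (\<Sum>i\<in>UNIV. of_real (f $ i) * z $ i)"

definition complex_vec :: "real ^ 'n \<Rightarrow> real ^ 'n \<Rightarrow> complex ^ 'n"
  where "complex_vec x y = (\<chi> i. Complex (x $ i) (y $ i))"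

lemma functional_complex_vec: "functional f (complex_vec x y) = Complex (f \<bullet> x) (f \<bullet> y)"
  by (simp add: functional_def complex_vec_def complex_eq_iff inner_vec_def)

lemma functional_smult [simp]: "functional f (c *s z) = c * functional f z"
  by (simp add: functional_def sum_distrib_left mult_ac)

lemma functional_scaleR_left [simp]: "functional (c *\<^sub>R f) z = of_real c * functional f z"
  by (simp add: functional_def sum_distrib_left mult_ac)

lemma functional_add_left: "functional (f + g) z = functional f z + functional g z"
  by (simp add: functional_def algebra_simps sum.distrib)

lemma functional_add: "functional f (z + w) = functional f z + functional f w"
  by (simp add: functional_def algebra_simps sum.distrib)

lemma functional_zero [simp]: "functional f 0 = 0"
  by (simp add: functional_def)

lemma functional_axis: "functional (axis i 1) z = z $ i"
  by (simp add: functional_def axis_def if_distrib if_distribR cong: if_cong)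

lemma functional_complexify: "functional f (complexify x) = of_real (f \<bullet> x)"
  by (simp add: functional_def complexify_def inner_vec_def)

lemma continuous_on_functional [continuous_intros]:
  "continuous_on S F \<Longrightarrow> continuous_on S (\<lambda>x. functional f (F x))"
  unfolding functional_def by (intro continuous_intros)

lemma continuous_on_functional_left [continuous_intros]:
  "continuous_on S F \<Longrightarrow> continuous_on S (\<lambda>x. functional (F x) z)"
  unfolding functional_def by (intro continuous_intros)

lemma tendsto_functional [tendsto_intros]:
  "(F \<longlongrightarrow> z) A \<Longrightarrow> ((\<lambda>x. functional f (F x)) \<longlongrightarrow> functional f z) A"
  unfolding functional_def by (intro tendsto_intros)

lemma norm_functional_le: "cmod (functional f z) \<le> norm f * norm z"
proof -
  have "cmod (functional f z) \<le> (\<Sum>i\<in>UNIV. \<bar>f $ i\<bar> * cmod (z $ i))"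
    unfolding functional_def by (rule sum_norm_le) (simp add: norm_mult)
  also have "\<dots> \<le> L2_set (\<lambda>i. f $ i) UNIV * L2_set (\<lambda>i. cmod (z $ i)) UNIV"
    using L2_set_mult_ineq[of "\<lambda>i. f $ i" "\<lambda>i. cmod (z $ i)" UNIV] by simp
  finally show ?thesis
    by (simp add: norm_vec_def L2_set_def)
qed

lemma complex_vec_eq: "complex_vec x y = complexify x + \<i> *s complexify y"
  by (simp add: complex_vec_def complexify_def vec_eq_iff complex_eq_iff)

lemma complex_vec_add: "complex_vec x y + complex_vec x' y' = complex_vec (x + x') (y + y')"
  by (simp add: complex_vec_def vec_eq_iff complex_eq_iff)

lemma complex_vec_scaleR: "c *\<^sub>R complex_vec x y = complex_vec (c *\<^sub>R x) (c *\<^sub>R y)"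
  by (simp add: complex_vec_def vec_eq_iff complex_eq_iff)

lemma complex_vec_Re_Im: "complex_vec (\<chi> i. Re (z $ i)) (\<chi> i. Im (z $ i)) = z"
  by (simp add: complex_vec_def vec_eq_iff complex_eq_iff)

lemma norm_complex_vec_le:
  fixes x y :: "real ^ 'n::finite"
  shows "norm (complex_vec x y) \<le> norm x + norm y"
proof -
  have "norm (complexify x) = norm x" for x :: "real ^ 'n"
    by (simp add: norm_vec_def complexify_def)
  then show ?thesis
    using norm_triangle_ineq[of "complexify x" "\<i> *s complexify y"]
    by (simp add: complex_vec_eq norm_smult)
qed

lemma Re_divide_cnj: "Re (a / b) = Re (a * cnj b) / (cmod b)^2"
  by (simp add: Re_divide cmod_power2)

locale proper_cone =
  fixes C :: "(real ^ 'n::finite) set"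
  assumes open_cone: "open C" and cone_nonempty: "C \<noteq> {}"
    and cone_add: "\<And>x y. x \<in> C \<Longrightarrow> y \<in> C \<Longrightarrow> x + y \<in> C"
    and cone_scale: "\<And>c x. 0 < c \<Longrightarrow> x \<in> C \<Longrightarrow> c *\<^sub>R x \<in> C"
    and cone_pointed: "\<And>x. x \<in> closure C \<Longrightarrow> - x \<in> closure C \<Longrightarrow> x = 0"
begin

lemma cone_convex: "convex C"
proof (rule convexI)
  fix x y u v assume xy: "x \<in> C" "y \<in> C" "0 \<le> u" "0 \<le> v" "u + v = (1::real)"
  then consider "u = 0" "v = 1" | "v = 0" "u = 1" | "u > 0" "v > 0"
    by linarith
  then show "u *\<^sub>R x + v *\<^sub>R y \<in> C"
    using xy cone_add cone_scale by cases auto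
qed


text \<open>Only the unit vectors of the dual cone are kept: they form a compact set, and if
  \<open>f\<close> could be scaled down, the infimum of \<open>Re (f / g)\<close> would never be
  positive.\<close>

definition dual :: "(real ^ 'n) set"
  where "dual = {f. norm f = 1 \<and> (\<forall>x\<in>C. 0 \<le> f \<bullet> x)}"

lemma norm_dual: "f \<in> dual \<Longrightarrow> norm f = 1"
  by (simp add: dual_def)

lemma norm_functional_dual_le: "f \<in> dual \<Longrightarrow> cmod (functional f z) \<le> norm z"
  using norm_functional_le[of f z] by (simp add: norm_dual)

lemma normalized_in_dual:
  assumes "f \<noteq> 0" "\<And>x. x \<in> C \<Longrightarrow> 0 \<le> f \<bullet> x"
  shows "(1 / norm f) *\<^sub>R f \<in> dual"
  using assms by (simp add: dual_def)

lemma compact_dual: "compact dual"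
proof -
  have "dual = sphere 0 1 \<inter> (\<Inter>x\<in>C. {f. 0 \<le> f \<bullet> x})"
    by (auto simp: dual_def)
  moreover have "closed (\<Inter>x\<in>C. {f. 0 \<le> f \<bullet> x})"
    by (intro closed_INT ballI closed_Collect_le continuous_intros)
  ultimately show ?thesis
    by (simp add: compact_Int_closed)
qed

text \<open>The open cone leaves room to move \<open>x\<close> by \<open>e\<close> in the direction
  \<open>- f\<close>, which lowers the value of the unit vector \<open>f\<close> by exactly
  \<open>e\<close>.\<close>

lemma dual_lower_bound:
  assumes "x \<in> C"
  obtains e where "e > 0" "\<And>f. f \<in> dual \<Longrightarrow> e \<le> f \<bullet> x"
proof -
  obtain e where e: "e > 0" "cball x e \<subseteq> C"
    using open_cone assms open_contains_cball by blast
  have "e \<le> f \<bullet> x" if f: "f \<in> dual" for f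
  proof -
    have "x - e *\<^sub>R f \<in> cball x e"
      using e f by (simp add: dist_norm norm_dual)
    then have "x - e *\<^sub>R f \<in> C"
      using e by blast
    then have "0 \<le> f \<bullet> (x - e *\<^sub>R f)"
      using f unfolding dual_def by blast
    moreover have "f \<bullet> f = 1"
      using f by (simp add: dot_square_norm norm_dual)
    ultimately show ?thesis
      by (simp add: inner_diff_right)
  qed
  then show thesis
    using that e by blast
qed

text \<open>Separation from a convex set yields only a threshold \<open>b\<close>; rescaling the
  points of a cone shows that \<open>a\<close> is nonnegative on \<open>C\<close> and that
  \<open>b \<le> 0\<close>.\<close>

lemma in_cone_if_dual_pos:
  assumes "\<And>f. f \<in> dual \<Longrightarrow> 0 < f \<bullet> x"
  shows "x \<in> C"
proof (rule ccontr)
  assume "x \<notin> C"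
  then obtain a b where a: "a \<noteq> 0" "a \<bullet> x \<le> b" "\<forall>y\<in>C. b \<le> a \<bullet> y"
    using separating_hyperplane_sets[of "{x}" C] cone_convex cone_nonempty by auto
  have nonneg: "0 \<le> a \<bullet> y" if "y \<in> C" for y
  proof (rule ccontr)
    assume neg: "\<not> 0 \<le> a \<bullet> y"
    define t where "t = (\<bar>b\<bar> + 1) / (- (a \<bullet> y))"
    have "t > 0"
      using neg by (simp add: t_def divide_pos_neg)
    have "b \<le> a \<bullet> (t *\<^sub>R y)"
      using a(3) cone_scale[OF \<open>t > 0\<close> \<open>y \<in> C\<close>] by blast
    also have "\<dots> = - (\<bar>b\<bar> + 1)"
      using neg by (simp add: t_def)
    finally show False
      by linarith
  qed
  have "b \<le> 0"
  proof (rule ccontr)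
    assume b: "\<not> b \<le> 0"
    obtain y where y: "y \<in> C"
      using cone_nonempty by blast
    \<comment> \<open>Shrinks \<open>y\<close> until its value falls below \<open>b\<close>; the
      added 1 keeps the denominator positive even if \<open>a \<bullet> y = 0\<close>.\<close>
    define t where "t = b / (2 * (a \<bullet> y + 1))"
    have "t > 0" "t * (a \<bullet> y) < b"
      using b nonneg[OF y] by (auto simp: t_def field_simps intro: add_nonneg_pos mult_nonneg_nonneg)
    then show False
      using a(3) cone_scale[OF \<open>t > 0\<close> y] by fastforce
  qed
  then have "a \<bullet> x \<le> 0"
    using a by linarith
  moreover have "0 < ((1 / norm a) *\<^sub>R a) \<bullet> x"
    using assms normalized_in_dual a nonneg by blast
  ultimately show False
    using a(1) by (simp add: zero_less_divide_iff)
qed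

text \<open>By pointedness the closure of \<open>C\<close> stays convex after removal of 0. Hence
  the convex hull of its compact set of unit vectors misses 0 and is strictly separated from it;
  homogeneity spreads the bound over \<open>C\<close>.\<close>

lemma exists_interior_functional:
  obtains u \<delta> where "\<delta> > 0" "u \<in> dual" "\<And>x. x \<in> C \<Longrightarrow> \<delta> * norm x \<le> u \<bullet> x"
proof -
  let ?P = "closure C"
  have add: "x + y \<in> ?P" if "x \<in> ?P" "y \<in> ?P" for x y
  proof -
    have "x + y \<in> closure (C + C)"
      using closure_sum[of C C] that set_plus_intro by blast
    also have "closure (C + C) \<subseteq> ?P"
      using cone_add by (intro closure_mono) (auto simp: set_plus_def)
    finally show ?thesis .
  qed
  have scale: "c *\<^sub>R x \<in> ?P" if "c > 0" "x \<in> ?P" for c x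
  proof -
    have "(*\<^sub>R) c ` ?P = closure ((*\<^sub>R) c ` C)"
      by (rule closure_scaleR)
    also have "\<dots> \<subseteq> ?P"
      using cone_scale that(1) by (intro closure_mono) auto
    finally show ?thesis
      using that by blast
  qed
  define S where "S = ?P \<inter> sphere 0 1"
  have "compact S"
    by (simp add: S_def closed_Int_compact)
  have "convex (?P - {0})"
  proof (rule convexI)
    fix x y a b assume xy: "x \<in> ?P - {0}" "y \<in> ?P - {0}" "0 \<le> a" "0 \<le> b" "a + b = (1::real)"
    then consider "a = 0" "b = 1" | "b = 0" "a = 1" | "a > 0" "b > 0"
      by linarith
    then show "a *\<^sub>R x + b *\<^sub>R y \<in> ?P - {0}"
    proof cases
      case 3
      then have in_P: "a *\<^sub>R x \<in> ?P" "b *\<^sub>R y \<in> ?P"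
        using scale xy by auto
      moreover have "a *\<^sub>R x + b *\<^sub>R y \<noteq> 0"
      proof
        assume "a *\<^sub>R x + b *\<^sub>R y = 0"
        then have "- (a *\<^sub>R x) \<in> ?P"
          using in_P by (metis add.inverse_inverse add_eq_0_iff)
        then show False
          using cone_pointed[OF in_P(1)] 3 xy by auto
      qed
      ultimately show ?thesis
        using add by blast
    qed (use xy in auto)
  qed
  then have "convex hull S \<subseteq> ?P - {0}"
    by (rule hull_minimal[rotated]) (auto simp: S_def)
  then have "0 \<notin> convex hull S"
    by blast
  then obtain a b where a: "a \<noteq> 0" "0 < b" "\<forall>x\<in>convex hull S. b < a \<bullet> x"
    using separating_hyperplane_closed_0[of "convex hull S"] \<open>compact S\<close>
      convex_convex_hull compact_convex_hull compact_imp_closed by metis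
  have bound: "b * norm x \<le> a \<bullet> x" if "x \<in> C" for x
  proof (cases "x = 0")
    case False
    have "x \<in> ?P"
      using that closure_subset by blast
    then have "(1 / norm x) *\<^sub>R x \<in> ?P"
      using False by (intro scale) auto
    then have "(1 / norm x) *\<^sub>R x \<in> S"
      using False by (simp add: S_def)
    from bspec[OF a(3) hull_inc[OF this]] have "b < (a \<bullet> x) / norm x"
      by simp
    then show ?thesis
      using False by (simp add: pos_less_divide_eq)
  qed simp
  show thesis
  proof (rule that[of "b / norm a" "(1 / norm a) *\<^sub>R a"])
    show "0 < b / norm a"
      using a by simp
    have "0 \<le> a \<bullet> x" if "x \<in> C" for x
      using bound[OF that] a(2) by (smt (verit) mult_nonneg_nonneg norm_ge_zero)
    then show "(1 / norm a) *\<^sub>R a \<in> dual"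
      by (intro normalized_in_dual a)
    show "b / norm a * norm x \<le> (1 / norm a) *\<^sub>R a \<bullet> x" if "x \<in> C" for x
      using divide_right_mono[OF bound[OF that], of "norm a"] by simp
  qed
qed

text \<open>Fixed once and for all, because the normalised coordinates depend on it: it defines the
  affine chart in which the tube is bounded.\<close>

definition unit_functional :: "real ^ 'n"
  where "unit_functional = (SOME u. u \<in> dual \<and> (\<exists>\<delta>>0. \<forall>x\<in>C. \<delta> * norm x \<le> u \<bullet> x))"

lemma unit_functional:
  shows "unit_functional \<in> dual" "\<exists>\<delta>>0. \<forall>x\<in>C. \<delta> * norm x \<le> unit_functional \<bullet> x"
proof -
  have "\<exists>u. u \<in> dual \<and> (\<exists>\<delta>>0. \<forall>x\<in>C. \<delta> * norm x \<le> u \<bullet> x)"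
    by (rule exists_interior_functional) blast
  from someI_ex[OF this] show "unit_functional \<in> dual" "\<exists>\<delta>>0. \<forall>x\<in>C. \<delta> * norm x \<le> unit_functional \<bullet> x"
    by (simp_all add: unit_functional_def)
qed

lemma dual_nonempty: "dual \<noteq> {}"
  using unit_functional(1) by blast

text \<open>An interior functional stays nonnegative on \<open>C\<close> when
  \<open>\<delta>\<close> times a coordinate functional is added. Both vanish at \<open>z\<close>,
  hence so does each coordinate.\<close>

lemma dual_separates:
  assumes "\<And>f. f \<in> dual \<Longrightarrow> functional f z = 0"
  shows "z = 0"
proof -
  let ?u = unit_functional
  obtain \<delta> where \<delta>: "\<delta> > 0" "\<And>x. x \<in> C \<Longrightarrow> \<delta> * norm x \<le> ?u \<bullet> x"
    using unit_functional(2) by blast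
  have "z $ i = 0" for i
  proof -
    let ?f = "?u + \<delta> *\<^sub>R axis i 1"
    have "functional ?f z = 0"
    proof (cases "?f = 0")
      case False
      have "0 \<le> ?f \<bullet> x" if "x \<in> C" for x
      proof -
        have "\<bar>x $ i\<bar> \<le> norm x"
          by (rule component_le_norm_cart)
        then have "- (\<delta> * norm x) \<le> \<delta> * x $ i"
          using mult_left_mono[of "\<bar>x $ i\<bar>" "norm x" \<delta>] \<delta>(1)
          by (smt (verit) mult_minus_right mult_left_mono)
        then show ?thesis
          using \<delta>(2)[OF that] by (simp add: inner_add_left inner_axis')
      qed
      then have "functional ((1 / norm ?f) *\<^sub>R ?f) z = 0"
        using assms normalized_in_dual[OF False] by blast
      then show ?thesis
        using False by (simp only: functional_scaleR_left) simp
    qed (simp add: functional_def)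
    then show ?thesis
      using assms[OF unit_functional(1)] \<delta>(1) by (simp add: functional_add_left functional_axis)
  qed
  then show ?thesis
    by (simp add: vec_eq_iff)
qed

section \<open>The tube over a cone\<close>

definition tube :: "(complex ^ 'n) set"
  where "tube = {complex_vec x y | x y. x \<in> C \<and> y \<in> C}"

definition tube_domain :: "(complex, 'n) proj_space set"
  where "tube_domain = proj_pt ` tube"

lemma tube_iff: "z \<in> tube \<longleftrightarrow> (\<chi> i. Re (z $ i)) \<in> C \<and> (\<chi> i. Im (z $ i)) \<in> C"
proof
  assume "z \<in> tube"
  then show "(\<chi> i. Re (z $ i)) \<in> C \<and> (\<chi> i. Im (z $ i)) \<in> C"
    by (auto simp: tube_def complex_vec_def)
next
  assume "(\<chi> i. Re (z $ i)) \<in> C \<and> (\<chi> i. Im (z $ i)) \<in> C"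
  then show "z \<in> tube"
    unfolding tube_def using complex_vec_Re_Im[of z] by force
qed

lemma tube_iff_dual:
  "z \<in> tube \<longleftrightarrow> (\<forall>f\<in>dual. 0 < Re (functional f z) \<and> 0 < Im (functional f z))"
proof -
  let ?x = "\<chi> i. Re (z $ i)" and ?y = "\<chi> i. Im (z $ i)"
  have "v \<in> C \<longleftrightarrow> (\<forall>f\<in>dual. 0 < f \<bullet> v)" for v
    using in_cone_if_dual_pos dual_lower_bound by (metis less_le_trans)
  moreover have "functional f z = Complex (f \<bullet> ?x) (f \<bullet> ?y)" for f
    using functional_complex_vec[of f ?x ?y] by (simp add: complex_vec_Re_Im)
  ultimately show ?thesis
    by (auto simp: tube_iff)
qed

lemma open_tube: "open tube"
proof -
  have "continuous_on UNIV (\<lambda>z :: complex ^ 'n. \<chi> i. Re (z $ i))"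
    "continuous_on UNIV (\<lambda>z :: complex ^ 'n. \<chi> i. Im (z $ i))"
    by (intro continuous_intros)+
  then have "open ((\<lambda>z. \<chi> i. Re (z $ i)) -` C \<inter> (\<lambda>z. \<chi> i. Im (z $ i)) -` C)"
    using open_cone by (intro open_Int open_vimage) auto
  moreover have "tube = (\<lambda>z. \<chi> i. Re (z $ i)) -` C \<inter> (\<lambda>z. \<chi> i. Im (z $ i)) -` C"
    using tube_iff by auto
  ultimately show ?thesis
    by simp
qed

lemma convex_tube: "convex tube"
proof (rule convexI)
  fix z w u v assume "z \<in> tube" "w \<in> tube" and uv: "0 \<le> u" "0 \<le> v" "u + v = (1::real)"
  then obtain x y x' y' where "x \<in> C" "y \<in> C" "x' \<in> C" "y' \<in> C"
    and zw: "z = complex_vec x y" "w = complex_vec x' y'"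
    unfolding tube_def by blast
  then have "u *\<^sub>R x + v *\<^sub>R x' \<in> C" "u *\<^sub>R y + v *\<^sub>R y' \<in> C"
    using convexD[OF cone_convex] uv by blast+
  then show "u *\<^sub>R z + v *\<^sub>R w \<in> tube"
    unfolding tube_def zw complex_vec_scaleR complex_vec_add by blast
qed

lemma tube_nonzero: "z \<in> tube \<Longrightarrow> z \<noteq> 0"
  using tube_iff_dual[of z] unit_functional(1) by auto

text \<open>The saturation of \<open>tube\<close> under nonzero complex scalars. The smaller set
  \<open>tube\<close> is convex and provides connectedness; openness and homogeneous estimates
  belong to the saturation.\<close>

definition tube_cone :: "(complex ^ 'n) set"
  where "tube_cone = {z. z \<noteq> 0 \<and> proj_pt z \<in> tube_domain}"

lemma tube_cone_iff: "z \<in> tube_cone \<longleftrightarrow> (\<exists>c w. c \<noteq> 0 \<and> w \<in> tube \<and> z = c *s w)"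
proof
  assume "z \<in> tube_cone"
  then obtain w where "z \<noteq> 0" "w \<in> tube" "proj_pt z = proj_pt w"
    by (auto simp: tube_cone_def tube_domain_def)
  then show "\<exists>c w. c \<noteq> 0 \<and> w \<in> tube \<and> z = c *s w"
    using proj_pt_eq_iff[of w z] tube_nonzero by metis
next
  assume "\<exists>c w. c \<noteq> 0 \<and> w \<in> tube \<and> z = c *s w"
  then show "z \<in> tube_cone"
    using tube_nonzero by (auto simp: tube_cone_def tube_domain_def proj_pt_smult)
qed

lemma tube_subset_tube_cone: "tube \<subseteq> tube_cone"
  using tube_nonzero by (auto simp: tube_cone_def tube_domain_def)

lemma open_tube_cone: "open tube_cone"
proof -
  have "open ((\<lambda>z. c *s z) -` tube)" for c
  proof -
    have "continuous_on UNIV (\<lambda>z :: complex ^ 'n. c *s z)"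
      unfolding vector_scalar_mult_def by (intro continuous_intros)
    then show ?thesis
      using open_tube by (intro open_vimage) auto
  qed
  moreover have "tube_cone = (\<Union>c\<in>- {0}. (\<lambda>z. c *s z) -` tube)"
  proof (intro set_eqI iffI)
    fix z assume "z \<in> tube_cone"
    then obtain c w where "c \<noteq> 0" "w \<in> tube" "z = c *s w"
      by (auto simp: tube_cone_iff)
    then have "(1 / c) *s z \<in> tube" "1 / c \<noteq> 0"
      by (auto simp: vector_smult_assoc)
    then show "z \<in> (\<Union>c\<in>- {0}. (\<lambda>z. c *s z) -` tube)"
      by blast
  next
    fix z assume "z \<in> (\<Union>c\<in>- {0}. (\<lambda>z. c *s z) -` tube)"
    then obtain c where "c \<noteq> 0" "c *s z \<in> tube"
      by auto
    then have "1 / c \<noteq> 0" "z = (1 / c) *s (c *s z)"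
      by (auto simp: vector_smult_assoc)
    then show "z \<in> tube_cone"
      using \<open>c *s z \<in> tube\<close> tube_cone_iff by blast
  qed
  ultimately show ?thesis
    by (simp add: open_UN)
qed

lemma open_tube_domain: "open tube_domain"
  using open_tube_cone by (simp add: open_proj_space_def tube_cone_def)

text \<open>
  A functional value of minimal slope can be rotated onto the positive real axis; all the others
  then lie in the half-open first quadrant, which a further small rotation makes open.
\<close>

lemma tube_cone_if_bound:
  assumes "z \<noteq> 0" "\<delta> > 0"
    and bound: "\<And>f g. f \<in> dual \<Longrightarrow> g \<in> dual \<Longrightarrow>
      \<delta> * (cmod (functional g z))^2 \<le> Re (functional f z * cnj (functional g z))"
  shows "z \<in> tube_cone"
proof -
  \<comment> \<open>The bound is \<open>Re (f / g) \<ge> \<delta>\<close> cleared of denominators,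
    so nonvanishing has to be derived from it: if \<open>f\<close> vanished at \<open>z\<close>,
    every \<open>g\<close> would.\<close>
  have nonzero: "functional f z \<noteq> 0" if f: "f \<in> dual" for f
  proof
    assume f0: "functional f z = 0"
    obtain g where "g \<in> dual" "functional g z \<noteq> 0"
      using dual_separates assms(1) by blast
    then show False
      using bound[OF f, of g] f0 \<open>\<delta> > 0\<close> by (simp add: mult_le_0_iff)
  qed
  let ?u = unit_functional
  \<comment> \<open>After division by the value of the unit functional all values lie in the right
    half-plane, where the slope \<open>s\<close> is defined and continuous.\<close>
  define z1 where "z1 = (1 / functional ?u z) *s z"
  have z1: "functional f z1 = functional f z / functional ?u z" for f
    by (simp add: z1_def)
  have Re_pos: "Re (functional f z / functional g z) > 0" if f: "f \<in> dual" and g: "g \<in> dual" for f g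
  proof -
    have "0 < \<delta> * (cmod (functional g z))^2"
      using nonzero[OF g] \<open>\<delta> > 0\<close> by simp
    also have "\<dots> \<le> Re (functional f z * cnj (functional g z))"
      by (rule bound[OF f g])
    finally show ?thesis
      using nonzero[OF g] by (simp only: Re_divide_cnj) simp
  qed
  define s where "s f = Im (functional f z1) / Re (functional f z1)" for f
  have "continuous_on dual s"
    unfolding s_def using Re_pos[OF _ unit_functional(1)]
    by (intro continuous_intros) (force simp: z1)
  then obtain f1 where f1: "f1 \<in> dual" "\<And>f. f \<in> dual \<Longrightarrow> s f1 \<le> s f"
    using continuous_attains_inf[OF compact_dual dual_nonempty] by blast
  \<comment> \<open>Rotates the value of \<open>f1\<close>, the one of least argument, onto the
    positive real axis; no other value then lies below that axis.\<close>
  define z2 where "z2 = cnj (functional f1 z1) *s z1"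
  have z2_Im: "Im (functional f z2) \<ge> 0" if f: "f \<in> dual" for f
  proof -
    have pos: "Re (functional f z1) > 0" "Re (functional f1 z1) > 0"
      using Re_pos[OF _ unit_functional(1)] f f1(1) by (auto simp: z1)
    then have "Im (functional f1 z1) * Re (functional f z1) \<le> Im (functional f z1) * Re (functional f1 z1)"
      using f1(2)[OF f] by (simp add: s_def field_simps)
    then show ?thesis
      by (simp add: z2_def algebra_simps)
  qed
  define c where "c = cnj (functional f1 z1) / functional ?u z"
  have z2_eq: "z2 = c *s z"
    by (simp add: z2_def z1_def c_def vector_smult_assoc)
  have "c \<noteq> 0"
    using nonzero f1(1) unit_functional(1) by (simp add: c_def z1)
  \<comment> \<open>The bound with \<open>g = f1\<close> gives this lower bound for the real parts,
    uniformly in \<open>f\<close>.\<close>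
  define m where "m = \<delta> * (cmod (functional f1 z1))^2"
  have "m > 0"
    using nonzero f1(1) unit_functional(1) \<open>\<delta> > 0\<close> by (simp add: m_def z1)
  have z2_Re: "Re (functional f z2) \<ge> m" if f: "f \<in> dual" for f
  proof -
    have "functional f z2 = functional f z * cnj (functional f1 z) / of_real ((cmod (functional ?u z))^2)"
      unfolding z2_def functional_smult z1 complex_norm_square by (simp add: mult.commute)
    then have "Re (functional f z2) = Re (functional f z * cnj (functional f1 z)) / (cmod (functional ?u z))^2"
      by (simp only: Re_divide_of_real)
    moreover have "m = \<delta> * (cmod (functional f1 z))^2 / (cmod (functional ?u z))^2"
      by (simp add: m_def z1 norm_divide power_divide)
    ultimately show ?thesis
      using divide_right_mono[OF bound[OF f f1(1)], of "(cmod (functional ?u z))^2"] by simp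
  qed
  define N where "N = norm z2 + 1"
  have "N > 0"
    by (simp add: N_def add_nonneg_pos)
  \<comment> \<open>Multiplication by \<open>1 + \<i> * \<epsilon>\<close> costs at most
    \<open>m / 2\<close> of the real part and adds a positive amount to the imaginary part.\<close>
  define \<epsilon> where "\<epsilon> = m / (2 * N)"
  have "\<epsilon> > 0"
    using \<open>m > 0\<close> \<open>N > 0\<close> by (simp add: \<epsilon>_def)
  have "(1 + \<i> * \<epsilon>) *s z2 \<in> tube"
    unfolding tube_iff_dual
  proof (intro ballI conjI)
    fix f assume f: "f \<in> dual"
    have "Im (functional f z2) \<le> N"
      using abs_Im_le_cmod[of "functional f z2"] norm_functional_dual_le[OF f, of z2] by (simp add: N_def)
    then have "\<epsilon> * Im (functional f z2) \<le> \<epsilon> * N"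
      using \<open>\<epsilon> > 0\<close> by (intro mult_left_mono) auto
    also have "\<dots> = m / 2"
      using \<open>N > 0\<close> by (simp add: \<epsilon>_def)
    also have "\<dots> < m"
      using \<open>m > 0\<close> by simp
    finally show "0 < Re (functional f ((1 + \<i> * \<epsilon>) *s z2))"
      using z2_Re[OF f] unfolding functional_smult by simp
    have "0 < \<epsilon> * Re (functional f z2)"
      using z2_Re[OF f] \<open>m > 0\<close> \<open>\<epsilon> > 0\<close> by simp
    then show "0 < Im (functional f ((1 + \<i> * \<epsilon>) *s z2))"
      using z2_Im[OF f] unfolding functional_smult by simp
  qed
  moreover have "z = (1 / ((1 + \<i> * \<epsilon>) * c)) *s ((1 + \<i> * \<epsilon>) *s z2)"
    and "1 / ((1 + \<i> * \<epsilon>) * c) \<noteq> 0"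
  proof -
    have "1 + \<i> * \<epsilon> \<noteq> 0"
      by (simp add: complex_eq_iff)
    then show "z = (1 / ((1 + \<i> * \<epsilon>) * c)) *s ((1 + \<i> * \<epsilon>) *s z2)"
      and "1 / ((1 + \<i> * \<epsilon>) * c) \<noteq> 0"
      using \<open>c \<noteq> 0\<close> by (auto simp: z2_eq vector_smult_assoc)
  qed
  ultimately show ?thesis
    unfolding tube_cone_iff by blast
qed

text \<open>Because \<open>f\<close> and \<open>g\<close> are real on \<open>v0\<close> and
  \<open>v1\<close>, the cross terms of the product contribute \<open>Re (c0 * cnj c1)\<close> times
  a positive number. The condition on the coefficients makes them nonnegative, and the diagonal
  terms are at least \<open>m\<close>.\<close>

lemma bound_if_combination:
  assumes v: "v0 \<in> C" "v1 \<in> C" and c: "Re (c0 * cnj c1) \<ge> 0" "c0 \<noteq> 0 \<or> c1 \<noteq> 0"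
    and z: "z = c0 *s complexify v0 + c1 *s complexify v1"
  obtains \<delta> where "\<delta> > 0" "\<And>f g. f \<in> dual \<Longrightarrow> g \<in> dual \<Longrightarrow>
      \<delta> * (cmod (functional g z))^2 \<le> Re (functional f z * cnj (functional g z))"
proof -
  obtain e0 where e0: "e0 > 0" "\<And>f. f \<in> dual \<Longrightarrow> e0 \<le> f \<bullet> v0"
    using dual_lower_bound v by blast
  obtain e1 where e1: "e1 > 0" "\<And>f. f \<in> dual \<Longrightarrow> e1 \<le> f \<bullet> v1"
    using dual_lower_bound v by blast
  define m where "m = (cmod c0)^2 * e0^2 + (cmod c1)^2 * e1^2"
  have "m > 0"
    using c(2) e0 e1 by (auto simp: m_def intro: add_pos_nonneg add_nonneg_pos)
  have fz: "functional f z = c0 * of_real (f \<bullet> v0) + c1 * of_real (f \<bullet> v1)" for f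
    by (simp add: z functional_add functional_complexify)
  define N where "N = (norm z)^2 + 1"
  have "N > 0"
    by (simp add: N_def add_nonneg_pos)
  define \<delta> where "\<delta> = m / N"
  show thesis
  proof (rule that[of \<delta>])
    show "\<delta> > 0"
      using \<open>m > 0\<close> \<open>N > 0\<close> by (simp add: \<delta>_def)
    fix f g assume fg: "f \<in> dual" "g \<in> dual"
    have pos: "f \<bullet> v0 > 0" "f \<bullet> v1 > 0" "g \<bullet> v0 > 0" "g \<bullet> v1 > 0"
      using e0 e1 fg by (meson less_le_trans)+
    have sq: "e0^2 \<le> (f \<bullet> v0) * (g \<bullet> v0)" "e1^2 \<le> (f \<bullet> v1) * (g \<bullet> v1)"
      unfolding power2_eq_square using e0 e1 fg pos by (auto intro!: mult_mono)
    from pos have "0 \<le> Re (c0 * cnj c1) * ((f \<bullet> v0) * (g \<bullet> v1) + (f \<bullet> v1) * (g \<bullet> v0))"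
      using c(1) by (intro mult_nonneg_nonneg add_nonneg_nonneg) auto
    then have "(cmod c0)^2 * ((f \<bullet> v0) * (g \<bullet> v0)) + (cmod c1)^2 * ((f \<bullet> v1) * (g \<bullet> v1))
        \<le> Re (functional f z * cnj (functional g z))"
      unfolding fz cmod_power2 by (simp add: power2_eq_square algebra_simps)
    moreover have "m \<le> (cmod c0)^2 * ((f \<bullet> v0) * (g \<bullet> v0)) + (cmod c1)^2 * ((f \<bullet> v1) * (g \<bullet> v1))"
      unfolding m_def by (intro add_mono mult_left_mono sq) auto
    ultimately have m: "m \<le> Re (functional f z * cnj (functional g z))"
      by linarith
    have "cmod (functional g z) \<le> norm z"
      using norm_functional_dual_le fg by blast
    then have "(cmod (functional g z))^2 \<le> N"
      unfolding N_def using power_mono[of "cmod (functional g z)" "norm z" 2] norm_ge_zero[of "functional g z"]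
      by linarith
    then have "\<delta> * (cmod (functional g z))^2 \<le> \<delta> * N"
      using \<open>\<delta> > 0\<close> by (intro mult_left_mono) auto
    also have "\<dots> = m"
      using \<open>N > 0\<close> by (simp add: \<delta>_def)
    finally show "\<delta> * (cmod (functional g z))^2 \<le> Re (functional f z * cnj (functional g z))"
      using m by linarith
  qed
qed

text \<open>The converse of \<open>tube_cone_if_bound\<close>: a point over the tube is a
  combination with coefficients \<open>c\<close> and \<open>c * \<i>\<close>, the right-angled
  extreme case of the angle condition.\<close>

lemma tube_cone_bound:
  assumes "z \<in> tube_cone"
  obtains \<delta> where "\<delta> > 0" "\<And>f g. f \<in> dual \<Longrightarrow> g \<in> dual \<Longrightarrow>
      \<delta> * (cmod (functional g z))^2 \<le> Re (functional f z * cnj (functional g z))"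
proof -
  obtain c x y where c: "c \<noteq> 0" "x \<in> C" "y \<in> C" "z = c *s complex_vec x y"
    using assms by (auto simp: tube_cone_iff tube_def)
  then have "z = c *s complexify x + (c * \<i>) *s complexify y"
    by (simp add: complex_vec_eq vector_add_ldistrib vector_smult_assoc)
  moreover have "Re (c * cnj (c * \<i>)) \<ge> 0"
    by simp
  ultimately show thesis
    using bound_if_combination[OF c(2,3), of c "c * \<i>" z] c(1) that by blast
qed

text \<open>This is boundedness of the tube in the affine chart where \<open>unit_functional\<close>
  does not vanish: the functional controls the norm on \<open>C\<close>, hence on the real and
  imaginary parts of points of \<open>tube\<close>.\<close>

lemma norm_le_unit_functional:
  obtains M where "M > 0" "\<And>z. z \<in> tube_cone \<Longrightarrow> norm z \<le> M * cmod (functional unit_functional z)"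
proof -
  let ?u = unit_functional
  obtain \<delta> where \<delta>: "\<delta> > 0" "\<And>x. x \<in> C \<Longrightarrow> \<delta> * norm x \<le> ?u \<bullet> x"
    using unit_functional(2) by blast
  have "norm z \<le> 2 / \<delta> * cmod (functional ?u z)" if z: "z \<in> tube_cone" for z
  proof -
    obtain c x y where c: "x \<in> C" "y \<in> C" "z = c *s complex_vec x y"
      using z by (auto simp: tube_cone_iff tube_def)
    have "norm (complex_vec x y) \<le> norm x + norm y"
      by (rule norm_complex_vec_le)
    also have "\<dots> \<le> (?u \<bullet> x) / \<delta> + (?u \<bullet> y) / \<delta>"
      using \<delta> c by (intro add_mono) (auto simp: field_simps)
    also
    have "?u \<bullet> x + ?u \<bullet> y \<le> 2 * cmod (functional ?u (complex_vec x y))"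
      using abs_Re_le_cmod[of "functional ?u (complex_vec x y)"]
        abs_Im_le_cmod[of "functional ?u (complex_vec x y)"]
      by (simp add: functional_complex_vec)
    from divide_right_mono[OF this less_imp_le[OF \<delta>(1)]]
    have "(?u \<bullet> x) / \<delta> + (?u \<bullet> y) / \<delta> \<le> 2 / \<delta> * cmod (functional ?u (complex_vec x y))"
      by (simp add: add_divide_distrib)
    finally have "cmod c * norm (complex_vec x y) \<le> cmod c * (2 / \<delta> * cmod (functional ?u (complex_vec x y)))"
      by (intro mult_left_mono) auto
    then show ?thesis
      by (simp add: c norm_smult norm_mult mult_ac)
  qed
  then show thesis
    using that[of "2 / \<delta>"] \<delta>(1) by simp
qed

lemma unit_functional_nonzero: "z \<in> tube_cone \<Longrightarrow> functional unit_functional z \<noteq> 0"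
  by (rule norm_le_unit_functional) (force simp: tube_cone_def)

end

text \<open>One inclusion takes the coefficients 1 and \<open>\<i>\<close>. For the other, endpoints
  in the same half of the cone are covered by \<open>bound_if_combination\<close> after a common
  change of sign; endpoints in opposite halves must represent the same point.\<close>

lemma elliptic_tube_eq:
  assumes "proper_cone C" and C: "{v. v \<noteq> 0 \<and> proj_pt v \<in> D} = C \<union> uminus ` C"
  shows "elliptic_tube D = proper_cone.tube_domain C"
proof -
  interpret proper_cone C by fact
  have "0 \<notin> C"
    using C by blast
  have in_D: "proj_pt v \<in> D" if "v \<in> C" for v
    using C that by blast
  show ?thesis
  proof (intro equalityI subsetI)
    fix p assume "p \<in> tube_domain"
    then obtain x y where xy: "x \<in> C" "y \<in> C" "p = proj_pt (complex_vec x y)"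
      by (auto simp: tube_domain_def tube_def)
    have "complex_vec x y \<in> tube"
      using xy by (auto simp: tube_def)
    then have "complex_vec x y \<noteq> 0"
      by (rule tube_nonzero)
    have "complex_vec x y = 1 *s complexify x + \<i> *s complexify y"
      by (simp add: complex_vec_eq)
    moreover have "Re (1 * cnj \<i>) \<ge> 0"
      by simp
    ultimately have "p \<in> elliptic_segment x y"
      unfolding elliptic_segment_def using xy \<open>complex_vec x y \<noteq> 0\<close> by blast
    moreover have "closed_segment_proj x y \<subseteq> D"
      unfolding closed_segment_proj_def
    proof (rule image_subsetI)
      fix v assume "v \<in> {c0 *s x + c1 *s y | c0 c1. c0 * c1 \<ge> 0} - {0}"
      then obtain a b where v: "v = a *\<^sub>R x + b *\<^sub>R y" "a * b \<ge> 0" "v \<noteq> 0"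
        by (auto simp: scalar_mult_eq_scaleR)
      have nonneg: "proj_pt (a *\<^sub>R x + b *\<^sub>R y) \<in> D" if nn: "a \<ge> 0" "b \<ge> 0" "a *\<^sub>R x + b *\<^sub>R y \<noteq> 0" for a b
      proof -
        consider "a > 0" "b > 0" | "a = 0" "b > 0" | "a > 0" "b = 0"
          using nn by (cases "a = 0"; cases "b = 0") (auto simp: less_le)
        then have "a *\<^sub>R x + b *\<^sub>R y \<in> C"
          using cone_add cone_scale xy by cases auto
        then show ?thesis
          by (rule in_D)
      qed
      show "proj_pt v \<in> D"
      proof (cases "a \<ge> 0 \<and> b \<ge> 0")
        case False
        then have "a \<le> 0" "b \<le> 0"
          using v(2) by (auto simp: zero_le_mult_iff)
        moreover have "(- a) *\<^sub>R x + (- b) *\<^sub>R y = - v"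
          by (simp add: v)
        ultimately show ?thesis
          using nonneg[of "- a" "- b"] v(3) by (simp add: proj_pt_uminus)
      qed (use nonneg v in blast)
    qed
    ultimately show "p \<in> elliptic_tube D"
      unfolding elliptic_tube_def using xy \<open>0 \<notin> C\<close> by blast
  next
    fix p assume "p \<in> elliptic_tube D"
    then obtain v0 v1 where v: "v0 \<noteq> 0" "v1 \<noteq> 0" "closed_segment_proj v0 v1 \<subseteq> D"
      and p: "p \<in> elliptic_segment v0 v1"
      by (auto simp: elliptic_tube_def)
    have seg: "a *\<^sub>R v0 + b *\<^sub>R v1 \<in> C \<union> uminus ` C" if "a * b \<ge> 0" "a *\<^sub>R v0 + b *\<^sub>R v1 \<noteq> 0" for a b
    proof -
      have "proj_pt (a *\<^sub>R v0 + b *\<^sub>R v1) \<in> closed_segment_proj v0 v1"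
        unfolding closed_segment_proj_def using that by (auto simp: scalar_mult_eq_scaleR)
      then show ?thesis
        using v(3) that C by blast
    qed
    have disj: "C \<inter> uminus ` C = {}"
      using cone_add \<open>0 \<notin> C\<close> by (metis disjoint_iff imageE right_minus)
    have "v0 \<in> C \<union> uminus ` C" "v1 \<in> C \<union> uminus ` C"
      using seg[of 1 0] seg[of 0 1] v by auto
    obtain c0 c1 where c: "p = proj_pt (c0 *s complexify v0 + c1 *s complexify v1)"
      "c0 *s complexify v0 + c1 *s complexify v1 \<noteq> 0" "Re (c0 * cnj c1) \<ge> 0"
      using p by (auto simp: elliptic_segment_def)
    let ?z = "c0 *s complexify v0 + c1 *s complexify v1"

    have combination: "p \<in> tube_domain"
      if x: "x0 \<in> C" "x1 \<in> C" "Re (d0 * cnj d1) \<ge> 0" "?z = d0 *s complexify x0 + d1 *s complexify x1" for x0 x1 d0 d1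
    proof -
      have "d0 \<noteq> 0 \<or> d1 \<noteq> 0"
        using x(4) c(2) by auto
      then obtain \<delta> where "\<delta> > 0" "\<And>f g. f \<in> dual \<Longrightarrow> g \<in> dual \<Longrightarrow>
          \<delta> * (cmod (functional g ?z))^2 \<le> Re (functional f ?z * cnj (functional g ?z))"
        using bound_if_combination[OF x(1,2,3) _ x(4)] by blast
      then have "?z \<in> tube_cone"
        using tube_cone_if_bound c(2) by blast
      then show ?thesis
        by (simp add: tube_cone_def c(1))
    qed
    \<comment> \<open>The segment stays in the two halves except at 0, which
      \<open>closed_segment_proj\<close> leaves out; being connected, it can change halves only
      there.\<close>
    have opposite: "\<exists>\<mu>. v1 = \<mu> *\<^sub>R v0"
      if "v0 \<in> C \<and> - v1 \<in> C \<or> - v0 \<in> C \<and> v1 \<in> C"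
    proof -
      have "0 \<in> closed_segment v0 v1"
      proof (rule ccontr)
        assume "0 \<notin> closed_segment v0 v1"
        moreover have "x \<in> C \<union> uminus ` C" if x: "x \<in> closed_segment v0 v1" "x \<noteq> 0" for x
        proof -
          obtain u where "x = (1 - u) *\<^sub>R v0 + u *\<^sub>R v1" "0 \<le> u" "u \<le> 1"
            using x by (auto simp: in_segment)
          then show ?thesis
            using seg[of "1 - u" u] x(2) by simp
        qed
        ultimately have "closed_segment v0 v1 \<subseteq> C \<union> uminus ` C"
          by blast
        moreover have "connected (closed_segment v0 v1)" "v0 \<in> closed_segment v0 v1" "v1 \<in> closed_segment v0 v1"
          by auto
        moreover have "v0 \<in> C \<and> v1 \<in> uminus ` C \<or> v0 \<in> uminus ` C \<and> v1 \<in> C"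
          using that by (metis add.inverse_inverse imageI)
        ultimately show False
          using connectedD[OF _ open_cone open_negations[OF open_cone], of "closed_segment v0 v1"] disj
          by blast
      qed
      then obtain u where u: "(1 - u) *\<^sub>R v0 + u *\<^sub>R v1 = 0"
        by (auto simp: in_segment)
      then have "u \<noteq> 0"
        using v(1) by auto
      then have "v1 = (- (1 - u) / u) *\<^sub>R v0"
        using u by (simp add: eq_vector_fraction_iff add_eq_0_iff algebra_simps)
      then show ?thesis
        by blast
    qed
    have complexify_uminus: "complexify (- v) = - complexify v" for v :: "real ^ 'n"
      by (simp add: complexify_def vec_eq_iff)
    have complexify_scaleR: "complexify (\<mu> *\<^sub>R v) $ i = of_real \<mu> * complexify v $ i" for \<mu> i and v :: "real ^ 'n"
      by (simp add: complexify_def)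
    from \<open>v0 \<in> C \<union> uminus ` C\<close> \<open>v1 \<in> C \<union> uminus ` C\<close>
    consider "v0 \<in> C" "v1 \<in> C" | "- v0 \<in> C" "- v1 \<in> C"
      | "v0 \<in> C" "v0 \<in> C \<and> - v1 \<in> C \<or> - v0 \<in> C \<and> v1 \<in> C"
      | "- v0 \<in> C" "v0 \<in> C \<and> - v1 \<in> C \<or> - v0 \<in> C \<and> v1 \<in> C"
      by auto
    then show "p \<in> tube_domain"
    proof cases
      case 1
      then show ?thesis
        using combination[of v0 v1 c0 c1] c(3) by simp
    next
      case 2
      moreover have "?z = (- c0) *s complexify (- v0) + (- c1) *s complexify (- v1)"
        by (simp add: complexify_uminus vec_eq_iff)
      ultimately show ?thesis
        using combination[of "- v0" "- v1" "- c0" "- c1"] c(3) by simp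
    next
      case 3
      then obtain \<mu> where "v1 = \<mu> *\<^sub>R v0"
        using opposite by blast
      \<comment> \<open>The projective segment is a single point, so everything goes into the first
        coefficient; with second coefficient 0 the angle condition is trivial.\<close>
      then have "?z = (c0 + c1 * of_real \<mu>) *s complexify v0 + 0 *s complexify v0"
        by (simp add: vec_eq_iff[of "_ + _"] complexify_scaleR algebra_simps)
      then show ?thesis
        using combination[of v0 v0 "c0 + c1 * of_real \<mu>" 0] 3 by simp
    next
      case 4
      then obtain \<mu> where "v1 = \<mu> *\<^sub>R v0"
        using opposite by blast
      then have "?z = (- (c0 + c1 * of_real \<mu>)) *s complexify (- v0) + 0 *s complexify (- v0)"
        by (simp add: vec_eq_iff[of "_ + _"] complexify_scaleR complexify_uminus algebra_simps)
      then show ?thesis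
        using combination[of "- v0" "- v0" "- (c0 + c1 * of_real \<mu>)" 0] 4 by simp
    qed
  qed
qed

section \<open>Quotients of linear functionals\<close>

definition rep :: "(complex, 'n::finite) proj_space \<Rightarrow> complex ^ 'n"
  where "rep p = (SOME z. z \<noteq> 0 \<and> proj_pt z = p)"

lemma rep: "rep p \<noteq> 0" "proj_pt (rep p) = p"
  using someI_ex[OF proj_pt_surj[of p]] by (simp_all add: rep_def)

text \<open>Numerator and denominator have the same degree, so the choice made by \<open>rep\<close>
  does not affect the value.\<close>

definition ratio :: "real ^ 'n \<Rightarrow> real ^ 'n \<Rightarrow> (complex, 'n::finite) proj_space \<Rightarrow> complex"
  where "ratio f g p = functional f (rep p) / functional g (rep p)"

lemma ratio_proj_pt:
  assumes "z \<noteq> 0"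
  shows "ratio f g (proj_pt z) = functional f z / functional g z"
proof -
  obtain c where "c \<noteq> 0" "rep (proj_pt z) = c *s z"
    using proj_pt_eq_iff[OF assms rep(1)[of "proj_pt z"]] rep(2) by metis
  then show ?thesis
    by (simp add: ratio_def)
qed

lemma holomorphic_on_functional:
  fixes Z :: "complex \<Rightarrow> complex ^ 'n"
  assumes "\<And>i. (\<lambda>l. Z l $ i) holomorphic_on S"
  shows "(\<lambda>l. functional f (Z l)) holomorphic_on S"
  unfolding functional_def by (intro holomorphic_intros assms)

lemma affine_coords_chart:
  assumes "p \<in> chart_dom j"
  shows "affine_coords j p \<noteq> 0" "proj_pt (affine_coords j p) = p"
proof -
  obtain x where x: "x $ j = 1" "p = proj_pt x"
    using assms by (auto simp: chart_dom_def)
  then have "affine_coords j p = x"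
    by (simp add: affine_coords_proj_pt)
  then show "affine_coords j p \<noteq> 0" "proj_pt (affine_coords j p) = p"
    using x by auto
qed

text \<open>The affine coordinates are holomorphic lifts of \<open>h\<close> over the preimages of
  the charts. These are open and cover \<open>S\<close>, and the quotient does not depend on the
  lift.\<close>

lemma ratio_holomorphic:
  fixes h :: "complex \<Rightarrow> (complex, 'n::finite) proj_space"
  assumes h: "holomorphic_into_proj h S" and "open S"
    and nonzero: "\<And>l z. l \<in> S \<Longrightarrow> z \<noteq> 0 \<Longrightarrow> proj_pt z = h l \<Longrightarrow> functional g z \<noteq> 0"
  shows "(\<lambda>l. ratio f g (h l)) holomorphic_on S"
proof -
  define T where "T j = {l \<in> S. h l \<in> chart_dom j}" for j
  have "(\<lambda>l. ratio f g (h l)) holomorphic_on T j" for j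
  proof -
    let ?Z = "\<lambda>l. affine_coords j (h l)"
    have Z: "?Z l \<noteq> 0" "proj_pt (?Z l) = h l" if "l \<in> T j" for l
      using that affine_coords_chart by (auto simp: T_def)
    have "(\<lambda>l. functional f (?Z l) / functional g (?Z l)) holomorphic_on T j"
    proof (intro holomorphic_on_divide holomorphic_on_functional)
      show "functional g (?Z l) \<noteq> 0" if "l \<in> T j" for l
        using nonzero[of l "?Z l"] Z that by (auto simp: T_def)
    qed (use h in \<open>auto simp: holomorphic_into_proj_def T_def\<close>)
    then show ?thesis
    proof (rule holomorphic_transform)
      fix l assume "l \<in> T j"
      then show "functional f (?Z l) / functional g (?Z l) = ratio f g (h l)"
        using ratio_proj_pt[OF Z(1)] Z(2) by metis
    qed
  qed
  moreover have "open (T j)" for j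
  proof -
    have "continuous_on S h"
      using h by (simp add: holomorphic_into_proj_def)
    then have "open (h -` chart_dom j \<inter> S)"
      using continuous_on_open_vimage[OF \<open>open S\<close>] open_chart_dom by blast
    moreover have "T j = h -` chart_dom j \<inter> S"
      by (auto simp: T_def)
    ultimately show ?thesis
      by simp
  qed
  ultimately have "(\<lambda>l. ratio f g (h l)) holomorphic_on (\<Union>j\<in>UNIV. T j)"
    by (intro holomorphic_on_UN_open) auto
  moreover have "S \<subseteq> (\<Union>j\<in>UNIV. T j)"
  proof
    fix l assume l: "l \<in> S"
    obtain z where z: "z \<noteq> 0" "proj_pt z = h l"
      using proj_pt_surj by blast
    then obtain j where "z $ j \<noteq> 0"
      by (auto simp: vec_eq_iff)
    then show "l \<in> (\<Union>j\<in>UNIV. T j)"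
      using z l proj_pt_in_chart_dom_iff[OF z(1)] by (auto simp: T_def)
  qed
  ultimately show ?thesis
    by (rule holomorphic_on_subset)
qed

section \<open>Uniform limits and normal families of vector-valued functions\<close>

lemma norm_le_card:
  fixes x :: "complex ^ 'n::finite" and B :: real
  assumes "\<And>i. cmod (x $ i) \<le> B"
  shows "norm x \<le> CARD('n) * B"
proof -
  have "norm x \<le> (\<Sum>i\<in>UNIV. cmod (x $ i))"
    unfolding norm_vec_def by (rule L2_set_le_sum) simp
  also have "\<dots> \<le> (\<Sum>i\<in>(UNIV::'n set). B)"
    by (intro sum_mono assms)
  finally show ?thesis
    by simp
qed

lemma uniform_limit_vec:
  fixes F :: "'a \<Rightarrow> 'b \<Rightarrow> complex ^ 'n::finite"
  assumes "\<And>i. uniform_limit S (\<lambda>k l. F k l $ i) (\<lambda>l. G l $ i) A"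
  shows "uniform_limit S F G A"
proof (rule uniform_limitI)
  fix e :: real assume "e > 0"
  define d where "d = e / (2 * CARD('n))"
  have "d > 0"
    using \<open>e > 0\<close> by (simp add: d_def)
  have "\<forall>\<^sub>F k in A. \<forall>i. \<forall>l\<in>S. dist (F k l $ i) (G l $ i) < d"
    using uniform_limitD[OF assms \<open>d > 0\<close>] by (simp add: eventually_all_finite)
  then show "\<forall>\<^sub>F k in A. \<forall>l\<in>S. dist (F k l) (G l) < e"
  proof eventually_elim
    case (elim k)
    show ?case
    proof
      fix l assume "l \<in> S"
      then have "cmod ((F k l - G l) $ i) \<le> d" for i
        using elim by (simp add: dist_norm less_imp_le)
      then have "norm (F k l - G l) \<le> CARD('n) * d"
        by (rule norm_le_card)
      also have "\<dots> < e"
        using \<open>e > 0\<close> by (simp add: d_def)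
      finally show "dist (F k l) (G l) < e"
        by (simp add: dist_norm)
    qed
  qed
qed

lemma uniform_limit_subseq:
  assumes "uniform_limit S F G sequentially" "strict_mono (r :: nat \<Rightarrow> nat)"
  shows "uniform_limit S (\<lambda>k. F (r k)) G sequentially"
  using assms(1) unfolding uniform_limit_iff using eventually_subseq[OF assms(2)] by blast

text \<open>Montel's theorem for one index at a time, each time passing to a further subsequence;
  the index set is finite, so no diagonal argument is involved.\<close>

lemma Montel_finite_family:
  fixes F :: "nat \<Rightarrow> 'i \<Rightarrow> complex \<Rightarrow> complex"
  assumes "finite I" "open S"
    and F: "\<And>k i. i \<in> I \<Longrightarrow> F k i holomorphic_on S" "\<And>k i l. i \<in> I \<Longrightarrow> l \<in> S \<Longrightarrow> cmod (F k i l) \<le> B"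
  shows "\<exists>r G. strict_mono (r :: nat \<Rightarrow> nat) \<and> (\<forall>i\<in>I. G i holomorphic_on S \<and>
    (\<forall>K. compact K \<and> K \<subseteq> S \<longrightarrow> uniform_limit K (\<lambda>k. F (r k) i) (G i) sequentially))"
  using assms(1) F
proof (induction I)
  case empty
  show ?case
    by (intro exI[where x = id]) (auto simp: strict_mono_def)
next
  case (insert j I)
  have "\<exists>r G. strict_mono (r :: nat \<Rightarrow> nat) \<and> (\<forall>i\<in>I. G i holomorphic_on S \<and>
      (\<forall>K. compact K \<and> K \<subseteq> S \<longrightarrow> uniform_limit K (\<lambda>k. F (r k) i) (G i) sequentially))"
    by (rule insert.IH) (use insert.prems in auto)
  then obtain r G where r: "strict_mono (r :: nat \<Rightarrow> nat)" and G: "\<And>i. i \<in> I \<Longrightarrow> G i holomorphic_on S"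
    "\<And>i K. i \<in> I \<Longrightarrow> compact K \<Longrightarrow> K \<subseteq> S \<Longrightarrow> uniform_limit K (\<lambda>k. F (r k) i) (G i) sequentially"
    by blast
  obtain g s where g: "g holomorphic_on S" and s: "strict_mono (s :: nat \<Rightarrow> nat)"
    and lim: "\<And>K. compact K \<Longrightarrow> K \<subseteq> S \<Longrightarrow> uniform_limit K ((\<lambda>k. F (r k) j) \<circ> s) g sequentially"
  proof (rule Montel[OF \<open>open S\<close>, of "range (\<lambda>k. F (r k) j)" "\<lambda>k. F (r k) j"])
    show "h holomorphic_on S" if "h \<in> range (\<lambda>k. F (r k) j)" for h
      using that insert.prems(1) by auto
    show "\<exists>B. \<forall>h\<in>range (\<lambda>k. F (r k) j). \<forall>z\<in>K. cmod (h z) \<le> B" if "K \<subseteq> S" for K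
      using that insert.prems(2) by (intro exI[where x = B]) auto
  qed auto
  show ?case
  proof (intro exI[where x = "r \<circ> s"] exI[where x = "G(j := g)"] conjI ballI allI impI)
    show "strict_mono (r \<circ> s)"
      using r s by (rule strict_mono_o)
    fix i assume i: "i \<in> insert j I"
    show "(G(j := g)) i holomorphic_on S"
      using i g G(1) by auto
    fix K assume K: "compact K \<and> K \<subseteq> S"
    show "uniform_limit K (\<lambda>k. F ((r \<circ> s) k) i) ((G(j := g)) i) sequentially"
    proof (cases "i = j")
      case True
      then show ?thesis
        using lim[of K] K by (simp add: o_def)
    next
      case False
      then show ?thesis
        using uniform_limit_subseq[OF G(2)[of i K] s] i K by (simp add: o_def)
    qed
  qed
qed

lemma upper_semicontinuous_on_continuous:
  assumes "continuous_on S u"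
  shows "upper_semicontinuous_on S u"
proof -
  have "{x \<in> S. u x < c} = S \<inter> u -` {..<c}" for c
    by auto
  then show ?thesis
    unfolding upper_semicontinuous_on_def
    using continuous_openin_preimage_gen[OF assms open_lessThan] by simp
qed

lemma holomorphic_discs_in: "h \<in> holomorphic_discs \<Omega> \<Longrightarrow> l \<in> unit_disc \<Longrightarrow> h l \<in> \<Omega>"
  unfolding holomorphic_discs_def by blast

context proper_cone
begin

section \<open>The exhaustion function\<close>

lemma tube_domain_rep: "p \<in> tube_domain \<longleftrightarrow> rep p \<in> tube_cone"
  by (simp add: tube_cone_def rep)

lemma functional_nonzero:
  assumes "z \<in> tube_cone" "g \<in> dual"
  shows "functional g z \<noteq> 0"
proof
  assume g0: "functional g z = 0"
  obtain \<delta> where \<delta>: "\<delta> > 0" "\<And>f g. f \<in> dual \<Longrightarrow> g \<in> dual \<Longrightarrow>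
      \<delta> * (cmod (functional g z))^2 \<le> Re (functional f z * cnj (functional g z))"
    using tube_cone_bound[OF assms(1)] by blast
  have "z \<noteq> 0"
    using assms(1) by (simp add: tube_cone_def)
  then obtain g' where "g' \<in> dual" "functional g' z \<noteq> 0"
    using dual_separates by blast
  then show False
    using \<delta>(2)[OF assms(2), of g'] \<delta>(1) g0 by (simp add: mult_le_0_iff)
qed

text \<open>The \<open>E\<close> of the overview. On the tube the real parts are pluriharmonic, so
  the infimum satisfies the mean value inequality of superharmonic functions on complex
  lines.\<close>

definition energy :: "(complex, 'n) proj_space \<Rightarrow> real"
  where "energy p = (INF (f, g) \<in> dual \<times> dual. Re (ratio f g p))"

lemma energy_greatest:
  assumes "\<And>f g. f \<in> dual \<Longrightarrow> g \<in> dual \<Longrightarrow> c \<le> Re (ratio f g p)"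
  shows "c \<le> energy p"
  unfolding energy_def using assms dual_nonempty by (intro cINF_greatest) auto

lemma ratio_lower_bound:
  assumes "p \<in> tube_domain"
  obtains \<delta> where "\<delta> > 0" "\<And>f g. f \<in> dual \<Longrightarrow> g \<in> dual \<Longrightarrow> \<delta> \<le> Re (ratio f g p)"
proof -
  have z: "rep p \<in> tube_cone"
    using assms by (simp add: tube_domain_rep)
  obtain \<delta> where \<delta>: "\<delta> > 0" "\<And>f g. f \<in> dual \<Longrightarrow> g \<in> dual \<Longrightarrow>
      \<delta> * (cmod (functional g (rep p)))^2 \<le> Re (functional f (rep p) * cnj (functional g (rep p)))"
    using tube_cone_bound[OF z] by blast
  have "\<delta> \<le> Re (ratio f g p)" if "f \<in> dual" "g \<in> dual" for f g
    unfolding ratio_def Re_divide_cnj using \<delta>(2)[OF that] functional_nonzero[OF z that(2)]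
    by (simp add: pos_le_divide_eq)
  then show thesis
    using that \<delta>(1) by blast
qed

lemma energy_pos:
  assumes "p \<in> tube_domain"
  shows "0 < energy p"
proof -
  obtain \<delta> where "\<delta> > 0" and \<delta>: "\<And>f g. f \<in> dual \<Longrightarrow> g \<in> dual \<Longrightarrow> \<delta> \<le> Re (ratio f g p)"
    using ratio_lower_bound[OF assms] by blast
  then show ?thesis
    using energy_greatest[of \<delta> p, OF \<delta>] by linarith
qed

lemma energy_le:
  assumes "p \<in> tube_domain" "f \<in> dual" "g \<in> dual"
  shows "energy p \<le> Re (ratio f g p)"
proof -
  obtain \<delta> where "\<delta> > 0" and \<delta>: "\<And>f g. f \<in> dual \<Longrightarrow> g \<in> dual \<Longrightarrow> \<delta> \<le> Re (ratio f g p)"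
    using ratio_lower_bound[OF assms(1)] by blast
  from \<delta> have "bdd_below ((\<lambda>(f, g). Re (ratio f g p)) ` (dual \<times> dual))"
    by (intro bdd_belowI2[where m = \<delta>]) auto
  from cINF_lower[OF this, of "(f, g)"] show ?thesis
    using assms by (simp add: energy_def)
qed

lemma ratio_disc_holomorphic:
  assumes "h \<in> holomorphic_discs tube_domain" "g \<in> dual"
  shows "(\<lambda>l. ratio f g (h l)) holomorphic_on unit_disc"
proof (rule ratio_holomorphic)
  show "holomorphic_into_proj h unit_disc"
    using assms by (simp add: holomorphic_discs_def)
  fix l z assume "l \<in> unit_disc" "z \<noteq> 0" "proj_pt z = h l"
  then have "z \<in> tube_cone"
    using holomorphic_discs_in[OF assms(1), of l] by (simp add: tube_cone_def)
  then show "functional g z \<noteq> 0"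
    using assms(2) by (rule functional_nonzero)
qed simp

text \<open>The Harnack constant depends on \<open>a\<close> and \<open>b\<close> only, so the
  inequality passes to the infimum over \<open>f\<close> and \<open>g\<close>.\<close>

lemma energy_harnack:
  assumes h: "h \<in> holomorphic_discs tube_domain" and ab: "a \<in> unit_disc" "b \<in> unit_disc"
  shows "exp (- 2 * poincare_dist a b) * energy (h a) \<le> energy (h b)"
proof (rule energy_greatest)
  fix f g assume fg: "f \<in> dual" "g \<in> dual"
  have dom: "h l \<in> tube_domain" if "l \<in> unit_disc" for l
    using holomorphic_discs_in[OF h that] .
  have "exp (- 2 * poincare_dist a b) * energy (h a) \<le> exp (- 2 * poincare_dist a b) * Re (ratio f g (h a))"
    using energy_le[OF dom[OF ab(1)] fg] by simp
  also have "\<dots> \<le> Re (ratio f g (h b))"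
  proof (rule harnack[OF _ _ ab])
    show "0 < Re (ratio f g (h l))" if "l \<in> unit_disc" for l
      using energy_pos energy_le[OF _ fg] dom[OF that] by (meson less_le_trans)
  qed (rule ratio_disc_holomorphic[OF h fg(2)])
  finally show "exp (- 2 * poincare_dist a b) * energy (h a) \<le> Re (ratio f g (h b))" .
qed

text \<open>Points of the tube at bounded Kobayashi distance have comparable energies, so a bounded
  sequence cannot approach the boundary. The 2 is the exponent in Harnack's inequality.\<close>

lemma ln_energy_lipschitz:
  "ennreal (dist (ln (energy p)) (ln (energy q)) / 2) \<le> kobayashi tube_domain p q"
proof (rule kobayashi_lower_bound)
  fix h a b assume h: "h \<in> holomorphic_discs tube_domain" and ab: "a \<in> unit_disc" "b \<in> unit_disc"
  have le: "ln (energy (h a)) - 2 * poincare_dist a b \<le> ln (energy (h b))"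
    if ab: "a \<in> unit_disc" "b \<in> unit_disc" for a b
  proof -
    have pos: "energy (h a) > 0" "energy (h b) > 0"
      using h ab by (auto intro!: energy_pos holomorphic_discs_in[OF h] simp del: mem_ball)
    then have "ln (exp (- 2 * poincare_dist a b) * energy (h a)) \<le> ln (energy (h b))"
      using energy_harnack[OF h ab] by (subst ln_le_cancel_iff) auto
    then show ?thesis
      using pos by (simp add: ln_mult)
  qed
  show "dist (ln (energy (h a))) (ln (energy (h b))) \<le> 2 * poincare_dist a b"
    using le[OF ab] le[OF ab(2,1)] by (simp add: dist_real_def poincare_dist_commute[of b a])
qed simp

section \<open>The normalised section\<close>

text \<open>The coordinates in the affine chart of \<open>unit_functional\<close>, kept as vectors
  on which this functional is 1. On the tube they are holomorphic, bounded and injective.\<close>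

definition normal_rep :: "(complex, 'n) proj_space \<Rightarrow> complex ^ 'n"
  where "normal_rep p = (1 / functional unit_functional (rep p)) *s rep p"

lemma normal_rep_nth: "normal_rep p $ i = ratio (axis i 1) unit_functional p"
  by (simp add: normal_rep_def ratio_def functional_axis)

lemma normal_rep:
  assumes "p \<in> tube_domain"
  shows "normal_rep p \<in> tube_cone" "proj_pt (normal_rep p) = p"
    "functional unit_functional (normal_rep p) = 1" "normal_rep p \<noteq> 0"
proof -
  have nz: "functional unit_functional (rep p) \<noteq> 0"
    using assms unit_functional_nonzero by (simp add: tube_domain_rep)
  then show eq: "proj_pt (normal_rep p) = p"
    by (simp add: normal_rep_def proj_pt_smult rep)
  show "functional unit_functional (normal_rep p) = 1"
    using nz by (simp add: normal_rep_def)
  show "normal_rep p \<noteq> 0"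
    using nz rep(1) by (simp add: normal_rep_def)
  then show "normal_rep p \<in> tube_cone"
    using eq assms by (simp add: tube_cone_def)
qed

lemma norm_normal_rep_le:
  obtains M where "M > 0" "\<And>p. p \<in> tube_domain \<Longrightarrow> norm (normal_rep p) < M"
proof -
  obtain M where M: "M > 0" "\<And>z. z \<in> tube_cone \<Longrightarrow> norm z \<le> M * cmod (functional unit_functional z)"
    using norm_le_unit_functional by blast
  have "norm (normal_rep p) < M + 1" if "p \<in> tube_domain" for p
    using M(2)[OF normal_rep(1)[OF that]] normal_rep(3)[OF that] by simp
  then show thesis
    using that[of "M + 1"] M(1) by simp
qed

text \<open>Bounded holomorphic coordinates are Lipschitz by Schwarz's lemma. As they separate
  points, the pseudodistance is a distance, and its Cauchy sequences converge in
  coordinates.\<close>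

lemma normal_rep_lipschitz:
  obtains L where "L > 0"
    "\<And>p q. ennreal (dist (normal_rep p) (normal_rep q) / L) \<le> kobayashi tube_domain p q"
proof -
  obtain M where M: "M > 0" "\<And>p. p \<in> tube_domain \<Longrightarrow> norm (normal_rep p) < M"
    using norm_normal_rep_le by blast
  define L where "L = CARD('n) * (4 * M)"
  have "L > 0"
    using M(1) by (simp add: L_def)
  moreover have "ennreal (dist (normal_rep p) (normal_rep q) / L) \<le> kobayashi tube_domain p q" for p q
  proof (rule kobayashi_lower_bound[OF \<open>L > 0\<close>])
    fix h a b assume h: "h \<in> holomorphic_discs tube_domain" and ab: "a \<in> unit_disc" "b \<in> unit_disc"
    have "cmod (normal_rep (h a) $ i - normal_rep (h b) $ i) \<le> 4 * M * poincare_dist a b" for i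
    proof (rule bounded_holomorphic_lipschitz[OF _ _ ab])
      show "(\<lambda>l. normal_rep (h l) $ i) holomorphic_on unit_disc"
        unfolding normal_rep_nth by (rule ratio_disc_holomorphic[OF h unit_functional(1)])
      fix l assume "l \<in> unit_disc"
      then have "norm (normal_rep (h l)) < M"
        by (intro M(2) holomorphic_discs_in[OF h])
      then show "cmod (normal_rep (h l) $ i) < M"
        using Finite_Cartesian_Product.norm_nth_le[of "normal_rep (h l)" i] by linarith
    qed
    then have "norm (normal_rep (h a) - normal_rep (h b)) \<le> CARD('n) * (4 * M * poincare_dist a b)"
      by (intro norm_le_card) simp
    then show "dist (normal_rep (h a)) (normal_rep (h b)) \<le> L * poincare_dist a b"
      by (simp add: L_def dist_norm mult_ac)
  qed
  ultimately show thesis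
    using that by blast
qed

text \<open>For \<open>\<delta> > 0\<close> the nonzero vectors in it are those over the set
  \<open>E \<ge> \<delta>\<close>, a sublevel set of the exhaustion \<open>- E\<close>. Without
  denominators the set is closed in the whole vector space, at the price of containing 0.\<close>

definition sublevel :: "real \<Rightarrow> (complex ^ 'n) set"
  where "sublevel \<delta> = {z. \<forall>f\<in>dual. \<forall>g\<in>dual.
    \<delta> * (cmod (functional g z))^2 \<le> Re (functional f z * cnj (functional g z))}"

lemma closed_sublevel: "closed (sublevel \<delta>)"
proof -
  have "sublevel \<delta> = (\<Inter>f\<in>dual. \<Inter>g\<in>dual.
      {z. \<delta> * (cmod (functional g z))^2 \<le> Re (functional f z * cnj (functional g z))})"
    by (auto simp: sublevel_def)
  also have "closed \<dots>"
    by (intro closed_INT ballI closed_Collect_le continuous_intros)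
  finally show ?thesis .
qed

lemma sublevel_subset: "\<delta> > 0 \<Longrightarrow> z \<in> sublevel \<delta> \<Longrightarrow> z \<noteq> 0 \<Longrightarrow> z \<in> tube_cone"
  using tube_cone_if_bound by (simp add: sublevel_def)

lemma in_sublevel:
  assumes z: "z \<in> tube_cone" and "\<delta> \<le> energy (proj_pt z)"
  shows "z \<in> sublevel \<delta>"
  unfolding sublevel_def
proof (intro CollectI ballI)
  fix f g assume fg: "f \<in> dual" "g \<in> dual"
  have z': "z \<noteq> 0" "proj_pt z \<in> tube_domain"
    using z by (auto simp: tube_cone_def)
  have "functional g z \<noteq> 0"
    using functional_nonzero[OF z fg(2)] .
  have "\<delta> \<le> Re (functional f z / functional g z)"
    using energy_le[OF z'(2) fg] assms(2) by (simp add: ratio_proj_pt[OF z'(1)])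
  then show "\<delta> * (cmod (functional g z))^2 \<le> Re (functional f z * cnj (functional g z))"
    unfolding Re_divide_cnj using \<open>functional g z \<noteq> 0\<close> by (simp add: pos_le_divide_eq)
qed

text \<open>A limit lies in any closed set that the sequence visits infinitely often, and the
  normalisation by \<open>unit_functional\<close> passes to the limit and excludes 0. Asking only
  for infinitely many indices lets the negation say that the energy tends to 0.\<close>

lemma limit_in_tube_cone:
  fixes p :: "nat \<Rightarrow> (complex, 'n) proj_space"
  assumes "\<delta> > 0" and p: "\<And>k. p k \<in> tube_domain" and lim: "(\<lambda>k. normal_rep (p k)) \<longlonglongrightarrow> z"
    and freq: "\<exists>\<^sub>F k in sequentially. \<delta> \<le> energy (p k)"
  shows "z \<in> tube_cone"
proof -
  have "z \<in> sublevel \<delta>"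
  proof (rule ccontr)
    assume "z \<notin> sublevel \<delta>"
    then have "\<forall>\<^sub>F k in sequentially. normal_rep (p k) \<in> - sublevel \<delta>"
      using lim closed_sublevel by (intro topological_tendstoD) auto
    with freq have "\<exists>\<^sub>F k in sequentially. \<delta> \<le> energy (p k) \<and> normal_rep (p k) \<in> - sublevel \<delta>"
      by (rule frequently_eventually_frequently)
    then obtain k where "\<delta> \<le> energy (p k)" "normal_rep (p k) \<notin> sublevel \<delta>"
      by (auto dest: frequently_ex)
    then show False
      using in_sublevel[of "normal_rep (p k)"] normal_rep[OF p] by simp
  qed
  moreover have "z \<noteq> 0"
  proof
    assume "z = 0"
    moreover have "(\<lambda>k. functional unit_functional (normal_rep (p k))) \<longlonglongrightarrow> functional unit_functional z"
      using lim by (rule tendsto_functional)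
    ultimately show False
      using normal_rep(3)[OF p] by (simp add: LIMSEQ_const_iff)
  qed
  ultimately show ?thesis
    using sublevel_subset[OF \<open>\<delta> > 0\<close>] by blast
qed

section \<open>Completeness\<close>

lemma ball_in_tube_cone:
  assumes "z \<in> tube_cone"
  obtains r where "r > 0" "ball z r \<subseteq> tube_cone"
  using open_tube_cone assms open_contains_ball by blast

lemma tube_kobayashi_finite:
  assumes "p \<in> tube_domain" "q \<in> tube_domain"
  shows "kobayashi tube_domain p q < \<infinity>"
proof -
  obtain z w where "z \<in> tube" "w \<in> tube" "p = proj_pt z" "q = proj_pt w"
    using assms by (auto simp: tube_domain_def)
  then show ?thesis
    using kobayashi_finite[OF open_tube_domain convex_connected[OF convex_tube]] tube_subset_tube_cone
    by (auto simp: tube_cone_def)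
qed

definition kdist :: "(complex, 'n) proj_space \<Rightarrow> (complex, 'n) proj_space \<Rightarrow> real"
  where "kdist p q = enn2real (kobayashi tube_domain p q)"

lemma le_kdist:
  assumes "p \<in> tube_domain" "q \<in> tube_domain" "ennreal x \<le> kobayashi tube_domain p q"
  shows "x \<le> kdist p q"
proof -
  have "enn2real (ennreal x) \<le> kdist p q"
    unfolding kdist_def using assms tube_kobayashi_finite[OF assms(1,2)] by (intro enn2real_mono) auto
  moreover have "0 \<le> kdist p q"
    by (simp add: kdist_def)
  ultimately show ?thesis
    by (cases "x \<ge> 0") auto
qed

lemma kdist_ball:
  assumes "ball z r \<subseteq> tube_cone" "dist z w < r"
  shows "kdist (proj_pt z) (proj_pt w) \<le> artanh (dist z w / r)"
proof -
  have "r > 0"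
    using assms(2) zero_le_dist[of z w] by linarith
  have "0 \<le> dist z w / r" "dist z w / r < 1"
    using assms(2) \<open>r > 0\<close> by auto
  then have "0 \<le> artanh (dist z w / r)"
    by (simp add: artanh_def)
  have "kobayashi tube_domain (proj_pt z) (proj_pt w) \<le> ennreal (artanh (dist z w / r))"
    using assms by (intro kobayashi_ball) (auto simp: tube_cone_def)
  then have "kdist (proj_pt z) (proj_pt w) \<le> enn2real (ennreal (artanh (dist z w / r)))"
    unfolding kdist_def by (intro enn2real_mono) auto
  then show ?thesis
    using \<open>0 \<le> artanh (dist z w / r)\<close> by simp
qed

lemma Metric_space_kdist: "Metric_space tube_domain kdist"
proof
  show "0 \<le> kdist p q" "kdist p q = kdist q p" for p q
    by (auto simp: kdist_def kobayashi_commute)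
  show "kdist p q = 0 \<longleftrightarrow> p = q" if pq: "p \<in> tube_domain" "q \<in> tube_domain" for p q
  proof
    assume 0: "kdist p q = 0"
    obtain L where L: "L > 0" "\<And>p q. ennreal (dist (normal_rep p) (normal_rep q) / L) \<le> kobayashi tube_domain p q"
      using normal_rep_lipschitz by blast
    have "dist (normal_rep p) (normal_rep q) / L \<le> 0"
      using le_kdist[OF pq L(2)] 0 by simp
    then have "normal_rep p = normal_rep q"
      using L(1) by (simp add: divide_le_0_iff)
    then show "p = q"
      using normal_rep(2)[OF pq(1)] normal_rep(2)[OF pq(2)] by metis
  qed (simp add: kdist_def)
  show "kdist p s \<le> kdist p q + kdist q s"
    if "p \<in> tube_domain" "q \<in> tube_domain" "s \<in> tube_domain" for p q s
  proof -
    have fin: "kobayashi tube_domain p q < \<infinity>" "kobayashi tube_domain q s < \<infinity>"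
      using tube_kobayashi_finite that by auto
    have "kdist p s \<le> enn2real (kobayashi tube_domain p q + kobayashi tube_domain q s)"
      unfolding kdist_def using fin by (intro enn2real_mono kobayashi_triangle) (auto simp: ennreal_add_less_top)
    also have "\<dots> = kdist p q + kdist q s"
      unfolding kdist_def using fin by (intro enn2real_plus) auto
    finally show ?thesis .
  qed
qed

text \<open>The coordinates converge because they are Lipschitz, the energy bound places the limit
  in the tube, and small linear discs around the limit turn convergence of coordinates into
  convergence for \<open>kdist\<close>.\<close>

lemma mcomplete_kdist: "Metric_space.mcomplete tube_domain kdist"
proof -
  interpret K: Metric_space tube_domain kdist
    by (rule Metric_space_kdist)
  obtain L where L: "L > 0" "\<And>p q. ennreal (dist (normal_rep p) (normal_rep q) / L) \<le> kobayashi tube_domain p q"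
    using normal_rep_lipschitz by blast
  show ?thesis
    unfolding K.mcomplete_def
  proof (intro allI impI)
    fix \<sigma> assume cauchy: "K.MCauchy \<sigma>"
    then have \<sigma>: "\<sigma> k \<in> tube_domain" for k
      by (auto simp: K.MCauchy_def)
    have "Cauchy (\<lambda>k. normal_rep (\<sigma> k))"
      unfolding Cauchy_def
    proof (intro allI impI)
      fix e :: real assume "e > 0"
      then obtain N where N: "\<And>n m. N \<le> n \<Longrightarrow> N \<le> m \<Longrightarrow> kdist (\<sigma> n) (\<sigma> m) < e / L"
        using cauchy L(1) unfolding K.MCauchy_def by (meson divide_pos_pos)
      have "dist (normal_rep (\<sigma> m)) (normal_rep (\<sigma> n)) < e" if "m \<ge> N" "n \<ge> N" for m n
      proof -
        have "dist (normal_rep (\<sigma> m)) (normal_rep (\<sigma> n)) / L < e / L"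
          using le_kdist[OF \<sigma> \<sigma> L(2)] N[OF that] by (rule le_less_trans)
        then show ?thesis
          using L(1) by (simp add: divide_less_cancel)
      qed
      then show "\<exists>N. \<forall>m\<ge>N. \<forall>n\<ge>N. dist (normal_rep (\<sigma> m)) (normal_rep (\<sigma> n)) < e"
        by blast
    qed
    then obtain z where z: "(\<lambda>k. normal_rep (\<sigma> k)) \<longlonglongrightarrow> z"
      using Cauchy_convergent_iff convergent_def by blast
    obtain N where N: "\<And>n m. N \<le> n \<Longrightarrow> N \<le> m \<Longrightarrow> kdist (\<sigma> n) (\<sigma> m) < 1"
      using cauchy unfolding K.MCauchy_def by (meson zero_less_one)
    \<comment> \<open>From index \<open>N\<close> on the distance to \<open>\<sigma> N\<close> is
      below 1, so \<open>ln\<close> of the energy drops by less than 2.\<close>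
    have "exp (- 2) * energy (\<sigma> N) \<le> energy (\<sigma> n)" if "n \<ge> N" for n
    proof -
      have "dist (ln (energy (\<sigma> N))) (ln (energy (\<sigma> n))) / 2 < 1"
        using le_kdist[OF \<sigma> \<sigma> ln_energy_lipschitz] N[OF order_refl that] by (rule le_less_trans)
      then have "ln (energy (\<sigma> N)) - 2 \<le> ln (energy (\<sigma> n))"
        by (simp add: dist_real_def)
      then have "exp (ln (energy (\<sigma> N)) - 2) \<le> exp (ln (energy (\<sigma> n)))"
        by simp
      then show ?thesis
        using energy_pos[OF \<sigma>] by (simp add: exp_diff exp_minus field_simps)
    qed
    then have "\<forall>\<^sub>F n in sequentially. exp (- 2) * energy (\<sigma> N) \<le> energy (\<sigma> n)"
      by (auto simp: eventually_sequentially)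
    then have "z \<in> tube_cone"
      using energy_pos[OF \<sigma>, of N] \<sigma> z
      by (intro limit_in_tube_cone[where \<delta> = "exp (- 2) * energy (\<sigma> N)"]) (auto intro: eventually_frequently)
    then obtain r where r: "r > 0" "ball z r \<subseteq> tube_cone"
      using ball_in_tube_cone by blast
    have "limitin K.mtopology \<sigma> (proj_pt z) sequentially"
      unfolding K.limitin_metric
    proof (intro conjI allI impI)
      show "proj_pt z \<in> tube_domain"
        using \<open>z \<in> tube_cone\<close> by (simp add: tube_cone_def)
      fix e :: real assume "e > 0"
      have "((\<lambda>k. artanh (dist z (normal_rep (\<sigma> k)) / r)) \<longlonglongrightarrow> 0)"
        using filterlim_compose[OF tendsto_artanh_dist[OF r(1)] z] .
      then have "\<forall>\<^sub>F k in sequentially. artanh (dist z (normal_rep (\<sigma> k)) / r) < e"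
        using \<open>e > 0\<close> order_tendstoD(2) by blast
      moreover have "\<forall>\<^sub>F k in sequentially. dist (normal_rep (\<sigma> k)) z < r"
        using z r(1) tendstoD by blast
      ultimately show "\<forall>\<^sub>F k in sequentially. \<sigma> k \<in> tube_domain \<and> kdist (\<sigma> k) (proj_pt z) < e"
      proof eventually_elim
        case (elim k)
        have "kdist (proj_pt z) (proj_pt (normal_rep (\<sigma> k))) < e"
          using kdist_ball[OF r(2), of "normal_rep (\<sigma> k)"] elim by (simp add: dist_commute)
        then show ?case
          using \<sigma> by (simp add: normal_rep(2) K.commute)
      qed
    qed
    then show "\<exists>x. limitin K.mtopology \<sigma> x sequentially"
      by blast
  qed
qed

theorem tube_complete_kobayashi_hyperbolic: "complete_kobayashi_hyperbolic tube_domain"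
  unfolding complete_kobayashi_hyperbolic_def
  using tube_kobayashi_finite Metric_space_kdist mcomplete_kdist by (simp add: kdist_def[abs_def])

section \<open>Hyperconvexity\<close>

text \<open>Nearby vectors have small Kobayashi distance by \<open>kdist_ball\<close>, and
  \<open>ln\<close> of the energy is Lipschitz for it. This gives both semicontinuities at
  once.\<close>

lemma continuous_on_energy: "continuous_on tube_domain energy"
proof (rule continuous_on_proj_space[OF open_tube_domain])
  have "isCont (\<lambda>w. energy (proj_pt w)) z" if z: "z \<in> tube_cone" for z
  proof -
    obtain r where r: "r > 0" "ball z r \<subseteq> tube_cone"
      using ball_in_tube_cone[OF z] by blast
    have bound: "dist (ln (energy (proj_pt w))) (ln (energy (proj_pt z))) \<le> 2 * artanh (dist z w / r)"
      if "w \<in> ball z r" for w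
    proof -
      have "proj_pt z \<in> tube_domain" "proj_pt w \<in> tube_domain"
        using z r that by (auto simp: tube_cone_def)
      then have "dist (ln (energy (proj_pt z))) (ln (energy (proj_pt w))) / 2 \<le> artanh (dist z w / r)"
        using le_kdist[OF _ _ ln_energy_lipschitz] kdist_ball[OF r(2), of w] that
        by (meson mem_ball order_trans)
      then show ?thesis
        by (simp add: dist_commute)
    qed
    have "((\<lambda>w. 2 * artanh (dist z w / r)) \<longlongrightarrow> 2 * 0) (nhds z)"
      by (intro tendsto_intros tendsto_artanh_dist r(1))
    then have lim: "((\<lambda>w. 2 * artanh (dist z w / r)) \<longlongrightarrow> 0) (nhds z)"
      by simp
    have "\<forall>\<^sub>F w in nhds z. w \<in> ball z r"
      using r(1) by (intro eventually_nhds_in_open) auto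
    then have upper: "\<forall>\<^sub>F w in nhds z.
        dist (ln (energy (proj_pt w))) (ln (energy (proj_pt z))) \<le> 2 * artanh (dist z w / r)"
      using bound by (rule eventually_mono)
    have "((\<lambda>w. dist (ln (energy (proj_pt w))) (ln (energy (proj_pt z)))) \<longlongrightarrow> 0) (nhds z)"
      by (rule tendsto_sandwich[OF always_eventually upper tendsto_const lim]) simp
    then have "((\<lambda>w. ln (energy (proj_pt w))) \<longlongrightarrow> ln (energy (proj_pt z))) (nhds z)"
      by (subst tendsto_dist_iff)
    then have "((\<lambda>w. exp (ln (energy (proj_pt w)))) \<longlongrightarrow> exp (ln (energy (proj_pt z)))) (nhds z)"
      by (rule tendsto_exp)
    moreover have "\<forall>\<^sub>F w in nhds z. exp (ln (energy (proj_pt w))) = energy (proj_pt w)"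
      using eventually_nhds_in_open[OF open_tube_cone z]
      by eventually_elim (simp add: tube_cone_def energy_pos)
    moreover have "exp (ln (energy (proj_pt z))) = energy (proj_pt z)"
      using z by (simp add: tube_cone_def energy_pos)
    ultimately have "((\<lambda>w. energy (proj_pt w)) \<longlongrightarrow> energy (proj_pt z)) (nhds z)"
      using filterlim_cong[OF refl refl, of "\<lambda>w. exp (ln (energy (proj_pt w)))" "\<lambda>w. energy (proj_pt w)" "nhds z"]
      by simp
    then show ?thesis
      unfolding isCont_def by (rule tendsto_mono[rotated]) (simp add: at_within_def)
  qed
  then show "continuous_on {v. v \<noteq> 0 \<and> proj_pt v \<in> tube_domain} (\<lambda>v. energy (proj_pt v))"
    by (intro continuous_at_imp_continuous_on) (simp add: tube_cone_def)
qed

text \<open>Each \<open>Re (f / g)\<close> equals its circle means and dominates the energy. So the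
  mean of the energy is at most the value of every \<open>Re (f / g)\<close> at the centre, hence at
  most their infimum.\<close>

lemma energy_superharmonic:
  fixes a b :: "complex ^ 'n"
  assumes ab: "a $ j = 1" "b $ j = 0"
  defines "S \<equiv> {l. proj_pt (a + l *s b) \<in> tube_domain}"
  shows "subharmonic_on S (\<lambda>l. - energy (proj_pt (a + l *s b)))"
proof -
  define Z where "Z l = a + l *s b" for l
  have Z_nz: "Z l \<noteq> 0" for l
  proof
    assume "Z l = 0"
    then have "Z l $ j = 0"
      by simp
    then show False
      using ab by (simp add: Z_def)
  qed
  have S_iff: "l \<in> S \<longleftrightarrow> Z l \<in> tube_cone" for l
    using Z_nz by (simp add: S_def Z_def tube_cone_def)
  have Z_hol: "(\<lambda>l. Z l $ i) holomorphic_on T" for i T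
    unfolding Z_def vector_add_component vector_smult_component by (intro holomorphic_intros)
  have "continuous_on UNIV (\<lambda>l. \<chi> i. Z l $ i)"
    by (intro continuous_on_vec_lambda holomorphic_on_imp_continuous_on Z_hol)
  then have "continuous_on UNIV Z"
    by simp
  then have Z_cont: "continuous_on T Z" for T
    by (rule continuous_on_subset) simp
  have cont: "continuous_on S (\<lambda>l. energy (proj_pt (Z l)))"
  proof (rule continuous_on_compose2[OF continuous_on_energy])
    show "continuous_on S (\<lambda>l. proj_pt (Z l))"
      using Z_nz by (intro continuous_on_compose2[OF continuous_on_proj_pt Z_cont]) auto
  qed (auto simp: S_def Z_def)
  have mean: "set_integrable lborel {0..2 * pi} (\<lambda>t. - energy (proj_pt (Z (c + of_real r * cis t)))) \<and>
      - energy (proj_pt (Z c)) \<le> 1 / (2 * pi) * (LINT t:{0..2 * pi}|lborel. - energy (proj_pt (Z (c + of_real r * cis t))))"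
    if r: "0 < r" "cball c r \<subseteq> S" for c r
  proof -
    let ?e = "\<lambda>t. energy (proj_pt (Z (c + of_real r * cis t)))"
    have circle: "c + of_real r * cis t \<in> S" for t
      using r by (intro subsetD[OF r(2)]) (simp add: dist_norm norm_mult)
    have e_cont: "continuous_on {0..2 * pi} ?e"
      by (rule continuous_on_compose2[OF cont]) (use circle in \<open>auto intro!: continuous_intros\<close>)
    then have int: "set_integrable lborel {0..2 * pi} (\<lambda>t. - ?e t)"
      by (intro borel_integrable_atLeastAtMost' continuous_intros)
    have "c \<in> S"
      using r by auto
    have "integral {0..2 * pi} ?e / (2 * pi) \<le> energy (proj_pt (Z c))"
    proof (rule energy_greatest)
      fix f g assume fg: "f \<in> dual" "g \<in> dual"
      define h where "h l = functional f (Z l) / functional g (Z l)" for l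
      have "functional g (Z l) \<noteq> 0" if "l \<in> S" for l
        using functional_nonzero[OF _ fg(2)] that S_iff by blast
      then have "h holomorphic_on S"
        unfolding h_def by (intro holomorphic_on_divide holomorphic_on_functional Z_hol)
      then have "((\<lambda>t. h (c + of_real r * cis t)) has_integral of_real (2 * pi) * h c) {0..2 * pi}"
        using r by (intro mean_value_holomorphic)
      from has_integral_linear[OF this bounded_linear_Re]
      have "((\<lambda>t. Re (h (c + of_real r * cis t))) has_integral 2 * pi * Re (h c)) {0..2 * pi}"
        by (simp add: o_def)
      moreover have "(?e has_integral integral {0..2 * pi} ?e) {0..2 * pi}"
        using integrable_continuous_interval[OF e_cont] by (rule integrable_integral)
      moreover have "?e t \<le> Re (h (c + of_real r * cis t))" for t
        using energy_le[OF _ fg, of "proj_pt (Z (c + of_real r * cis t))"] circle[of t]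
        by (simp add: h_def ratio_proj_pt[OF Z_nz] S_def Z_def[symmetric])
      ultimately have "integral {0..2 * pi} ?e \<le> 2 * pi * Re (h c)"
        using has_integral_le by blast
      then show "integral {0..2 * pi} ?e / (2 * pi) \<le> Re (ratio f g (proj_pt (Z c)))"
        by (simp add: h_def ratio_proj_pt[OF Z_nz] pos_divide_le_eq mult.commute)
    qed
    moreover have "(LINT t:{0..2 * pi}|lborel. - ?e t) = - integral {0..2 * pi} ?e"
      using set_borel_integral_eq_integral(2)[OF int] by simp
    ultimately show ?thesis
      using int by simp
  qed
  show ?thesis
    unfolding subharmonic_on_def using mean cont
    by (auto simp: Z_def intro!: upper_semicontinuous_on_continuous continuous_on_minus)
qed

theorem tube_hyperconvex: "hyperconvex tube_domain"
  unfolding hyperconvex_def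
proof (intro exI[where x = "\<lambda>p. - energy p"] conjI ballI allI impI)
  show cont: "continuous_on tube_domain (\<lambda>p. - energy p)"
    by (intro continuous_on_minus continuous_on_energy)
  show "plurisubharmonic_on tube_domain (\<lambda>p. - energy p)"
    unfolding plurisubharmonic_on_def
    using upper_semicontinuous_on_continuous[OF cont] energy_superharmonic by blast
  show "- energy p < 0" if "p \<in> tube_domain" for p
    using energy_pos[OF that] by simp
  fix c :: real assume "c < 0"
  \<comment> \<open>Restricting to representatives of norm 1 makes the closed homogeneous set
    compact and removes 0.\<close>
  let ?B = "sublevel (- c) \<inter> sphere 0 1"
  have B: "?B \<subseteq> tube_cone"
    using sublevel_subset[of "- c"] \<open>c < 0\<close> by force
  show "\<exists>K. compact K \<and> K \<subseteq> tube_domain \<and> {p \<in> tube_domain. - energy p < c} \<subseteq> K"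
  proof (intro exI[where x = "proj_pt ` ?B"] conjI)
    have "compact ?B"
      using closed_sublevel by (simp add: closed_Int_compact)
    moreover have "continuous_on ?B proj_pt"
      by (rule continuous_on_subset[OF continuous_on_proj_pt]) auto
    ultimately show "compact (proj_pt ` ?B)"
      by (rule compact_continuous_image[rotated])
    show "proj_pt ` ?B \<subseteq> tube_domain"
      using B by (auto simp: tube_cone_def)
    show "{p \<in> tube_domain. - energy p < c} \<subseteq> proj_pt ` ?B"
    proof
      fix p assume p: "p \<in> {p \<in> tube_domain. - energy p < c}"
      let ?z = "of_real (1 / norm (rep p)) *s rep p"
      have eq: "proj_pt ?z = p"
        using rep by (subst proj_pt_smult) auto
      have "norm ?z = 1"
        using rep(1) by (simp only: norm_smult) (simp add: norm_divide)
      moreover have "?z \<in> tube_cone"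
        using p eq \<open>norm ?z = 1\<close> by (auto simp: tube_cone_def)
      then have "?z \<in> sublevel (- c)"
        using p eq by (intro in_sublevel) auto
      ultimately have "?z \<in> ?B"
        by simp
      then show "p \<in> proj_pt ` ?B"
        using eq by force
    qed
  qed
qed

section \<open>Tautness\<close>

theorem tube_taut: "taut tube_domain"
  unfolding taut_def
proof (intro allI impI)
  fix f :: "nat \<Rightarrow> complex \<Rightarrow> (complex, 'n) proj_space"
  assume f: "\<forall>k. f k \<in> holomorphic_discs tube_domain"
  have dom: "f k l \<in> tube_domain" if "l \<in> unit_disc" for k l
    using holomorphic_discs_in f that by blast
  obtain M where M: "M > 0" "\<And>p. p \<in> tube_domain \<Longrightarrow> norm (normal_rep p) < M"
    using norm_normal_rep_le by blast
  have "\<exists>r G. strict_mono (r :: nat \<Rightarrow> nat) \<and> (\<forall>i\<in>UNIV. G i holomorphic_on unit_disc \<and>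
    (\<forall>K. compact K \<and> K \<subseteq> unit_disc \<longrightarrow> uniform_limit K (\<lambda>k l. normal_rep (f (r k) l) $ i) (G i) sequentially))"
  proof (rule Montel_finite_family[where B = M])
    show "(\<lambda>l. normal_rep (f k l) $ i) holomorphic_on unit_disc" for k i
      unfolding normal_rep_nth using f by (intro ratio_disc_holomorphic unit_functional(1)) simp
    show "cmod (normal_rep (f k l) $ i) \<le> M" if "l \<in> unit_disc" for k i l
      using Finite_Cartesian_Product.norm_nth_le[of "normal_rep (f k l)" i] M(2)[OF dom[OF that, of k]] by linarith
  qed auto
  then obtain r G' where r: "strict_mono (r :: nat \<Rightarrow> nat)"
    and G: "\<forall>i\<in>UNIV. G' i holomorphic_on unit_disc \<and> (\<forall>K. compact K \<and> K \<subseteq> unit_disc \<longrightarrow>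
      uniform_limit K (\<lambda>k l. normal_rep (f (r k) l) $ i) (G' i) sequentially)"
    by blast
  from G have G': "\<And>i. G' i holomorphic_on unit_disc"
    "\<And>i K. compact K \<Longrightarrow> K \<subseteq> unit_disc \<Longrightarrow> uniform_limit K (\<lambda>k l. normal_rep (f (r k) l) $ i) (G' i) sequentially"
    by blast+
  define G where "G l = (\<chi> i. G' i l)" for l
  have G_hol: "(\<lambda>l. G l $ i) holomorphic_on unit_disc" for i
    using G'(1) by (simp add: G_def)
  have G_unif: "uniform_limit K (\<lambda>k l. normal_rep (f (r k) l) $ i) (\<lambda>l. G l $ i) sequentially"
    if "compact K" "K \<subseteq> unit_disc" for K i
    using G'(2)[OF that] by (simp add: G_def)
  have G_lim: "(\<lambda>k. normal_rep (f (r k) l)) \<longlonglongrightarrow> G l" if "l \<in> unit_disc" for l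
    using tendsto_uniform_limitI[OF G_unif[of "{l}"], of l] that by (intro vec_tendstoI) auto
  show "\<exists>r. strict_mono r \<and> ((\<exists>g\<in>holomorphic_discs tube_domain. locally_uniformly_to (f \<circ> r) g unit_disc) \<or>
      compactly_divergent (f \<circ> r) unit_disc tube_domain)"
  proof (intro exI conjI)
    show "strict_mono r"
      by (rule r)
    show "(\<exists>g\<in>holomorphic_discs tube_domain. locally_uniformly_to (f \<circ> r) g unit_disc) \<or>
      compactly_divergent (f \<circ> r) unit_disc tube_domain"
    \<comment> \<open>Whether the energy at the centres stays away from 0 infinitely often or tends
      to 0 is decided along the subsequence on which the coordinates already converge.\<close>
    proof (cases "\<exists>\<delta>>0. \<exists>\<^sub>F k in sequentially. \<delta> \<le> energy (f (r k) 0)")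
      case True
      then obtain \<delta> where \<delta>: "\<delta> > 0" "\<exists>\<^sub>F k in sequentially. \<delta> \<le> energy (f (r k) 0)"
        by blast
      have G_cone: "G l \<in> tube_cone" if l: "l \<in> unit_disc" for l
      proof (rule limit_in_tube_cone[OF _ dom[OF l] G_lim[OF l]])
        \<comment> \<open>Harnack carries the lower bound from the centre to \<open>l\<close>,
          losing a factor that does not depend on \<open>k\<close>.\<close>
        let ?c = "exp (- 2 * poincare_dist 0 l)"
        show "0 < ?c * \<delta>"
          using \<delta>(1) by simp
        show "\<exists>\<^sub>F k in sequentially. ?c * \<delta> \<le> energy (f (r k) l)"
          using \<delta>(2)
        proof (rule frequently_mono[rotated], intro allI impI)
          fix k assume "\<delta> \<le> energy (f (r k) 0)"
          then have "?c * \<delta> \<le> ?c * energy (f (r k) 0)"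
            by simp
          also have "\<dots> \<le> energy (f (r k) l)"
            using f l by (intro energy_harnack) auto
          finally show "?c * \<delta> \<le> energy (f (r k) l)" .
        qed
      qed
      then have G_nz: "G l \<noteq> 0" if "l \<in> unit_disc" for l
        using that by (auto simp: tube_cone_def)
      let ?g = "\<lambda>l. proj_pt (G l)"
      have "?g \<in> holomorphic_discs tube_domain"
        using holomorphic_into_proj_proj_pt[OF G_hol G_nz] G_cone
        by (auto simp: holomorphic_discs_def tube_cone_def)
      moreover have "locally_uniformly_to (f \<circ> r) ?g unit_disc"
        unfolding locally_uniformly_to_def
      proof
        fix l0 assume l0: "l0 \<in> unit_disc"
        obtain j where j: "G l0 $ j \<noteq> 0"
          using G_nz[OF l0] by (auto simp: vec_eq_iff)
        \<comment> \<open>A lower bound for coordinate \<open>j\<close> of the limit on a whole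
          neighbourhood: it keeps the coordinates of nearly all discs nonzero and makes the
          quotients converge uniformly.\<close>
        define c where "c = cmod (G l0 $ j) / 2"
        have "c > 0"
          using j by (simp add: c_def)
        define U where "U = {l \<in> unit_disc. c < cmod (G l $ j)}"
        have "open ((\<lambda>l. cmod (G l $ j)) -` {c<..} \<inter> unit_disc)"
        proof -
          have "continuous_on unit_disc (\<lambda>l. cmod (G l $ j))"
            by (intro continuous_on_norm holomorphic_on_imp_continuous_on G_hol)
          then show ?thesis
            using continuous_on_open_vimage[OF open_ball] open_greaterThan by blast
        qed
        moreover have "U = (\<lambda>l. cmod (G l $ j)) -` {c<..} \<inter> unit_disc"
          by (auto simp: U_def)
        ultimately have "open U" "l0 \<in> U"
          using l0 j by (auto simp: U_def c_def)
        then obtain \<rho> where \<rho>: "\<rho> > 0" "cball l0 \<rho> \<subseteq> U"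
          using open_contains_cball by blast
        let ?N = "ball l0 \<rho>"
        have "U \<subseteq> unit_disc"
          by (auto simp: U_def)
        then have N_disc: "cball l0 \<rho> \<subseteq> unit_disc" "?N \<subseteq> unit_disc"
          using \<rho>(2) ball_subset_cball by blast+
        have N_c: "c \<le> cmod (G l $ j)" if "l \<in> ?N" for l
        proof -
          have "l \<in> U"
            using that \<rho>(2) ball_subset_cball by blast
          then show ?thesis
            by (simp add: U_def)
        qed
        have unif: "uniform_limit ?N (\<lambda>k l. normal_rep (f (r k) l) $ i) (\<lambda>l. G l $ i) sequentially" for i
          using G_unif[OF compact_cball N_disc(1)] by (rule uniform_limit_on_subset) auto
        have coords_g: "affine_coords j (?g l) $ i = G l $ i / G l $ j" if "l \<in> ?N" for l i
          using N_c[OF that] \<open>c > 0\<close> by (subst affine_coords_proj_pt) auto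
        have chart: "\<forall>\<^sub>F k in sequentially. \<forall>l\<in>?N. normal_rep (f (r k) l) $ j \<noteq> 0"
          using uniform_limitD[OF unif[of j] \<open>c > 0\<close>]
        proof eventually_elim
          case (elim k)
          show ?case
          proof
            fix l assume "l \<in> ?N"
            then show "normal_rep (f (r k) l) $ j \<noteq> 0"
              using elim N_c[of l] by (force simp: dist_norm)
          qed
        qed
        have coords_f: "\<forall>\<^sub>F k in sequentially. \<forall>l\<in>?N. f (r k) l \<in> chart_dom j \<and>
            (\<forall>i. affine_coords j (f (r k) l) $ i = normal_rep (f (r k) l) $ i / normal_rep (f (r k) l) $ j)"
          using chart
        proof eventually_elim
          case (elim k)
          show ?case
          proof
            fix l assume l: "l \<in> ?N"
            then have p: "f (r k) l \<in> tube_domain"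
              using N_disc dom by blast
            have "proj_pt (normal_rep (f (r k) l)) \<in> chart_dom j"
              using proj_pt_in_chart_dom_iff[OF normal_rep(4)[OF p]] elim l by blast
            moreover have "affine_coords j (proj_pt (normal_rep (f (r k) l))) $ i =
                normal_rep (f (r k) l) $ i / normal_rep (f (r k) l) $ j" for i
              using elim l by (subst affine_coords_proj_pt) auto
            ultimately show "f (r k) l \<in> chart_dom j \<and>
                (\<forall>i. affine_coords j (f (r k) l) $ i = normal_rep (f (r k) l) $ i / normal_rep (f (r k) l) $ j)"
              by (simp add: normal_rep(2)[OF p])
          qed
        qed
        have "uniform_limit ?N (\<lambda>k l. affine_coords j (f (r k) l)) (\<lambda>l. affine_coords j (?g l)) sequentially"
        proof (rule uniform_limit_vec)
          fix i
          have bdd: "bounded ((\<lambda>l. G l $ i) ` ?N)"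
          proof (rule bounded_subset)
            show "bounded ((\<lambda>l. G l $ i) ` cball l0 \<rho>)"
              by (intro compact_imp_bounded compact_continuous_image compact_cball
                  continuous_on_subset[OF holomorphic_on_imp_continuous_on[OF G_hol]] N_disc(1))
          qed auto
          have "uniform_limit ?N (\<lambda>k l. normal_rep (f (r k) l) $ i / normal_rep (f (r k) l) $ j)
              (\<lambda>l. G l $ i / G l $ j) sequentially"
            using uniform_lim_divide[OF unif[of i] unif[of j] bdd N_c \<open>c > 0\<close>] by simp
          then show "uniform_limit ?N (\<lambda>k l. affine_coords j (f (r k) l) $ i) (\<lambda>l. affine_coords j (?g l) $ i) sequentially"
          proof (rule uniform_limit_cong[THEN iffD1, rotated 2])
            show "\<forall>\<^sub>F k in sequentially. \<forall>l\<in>?N. normal_rep (f (r k) l) $ i / normal_rep (f (r k) l) $ j =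
                affine_coords j (f (r k) l) $ i"
              using coords_f by eventually_elim auto
          qed (use coords_g in simp)
        qed
        moreover have "?g ` ?N \<subseteq> chart_dom j"
        proof (rule image_subsetI)
          fix l assume l: "l \<in> ?N"
          then have "G l \<noteq> 0"
            using G_nz N_disc by blast
          then show "?g l \<in> chart_dom j"
            using N_c[OF l] \<open>c > 0\<close> by (subst proj_pt_in_chart_dom_iff) auto
        qed
        moreover have "\<forall>\<^sub>F k in sequentially. (f \<circ> r) k ` ?N \<subseteq> chart_dom j"
          using coords_f by eventually_elim auto
        ultimately show "\<exists>N j. open N \<and> l0 \<in> N \<and> N \<subseteq> unit_disc \<and> ?g ` N \<subseteq> chart_dom j \<and>
            (\<forall>\<^sub>F k in sequentially. (f \<circ> r) k ` N \<subseteq> chart_dom j) \<and>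
            uniform_limit N (\<lambda>k w. affine_coords j ((f \<circ> r) k w)) (\<lambda>w. affine_coords j (?g w)) sequentially"
          using \<rho>(1) N_disc(2) by (intro exI[where x = ?N] exI[where x = j]) auto
      qed
      ultimately show ?thesis
        by blast
    next
      case False
      then have small: "\<forall>\<^sub>F k in sequentially. energy (f (r k) 0) < \<delta>" if "\<delta> > 0" for \<delta>
        using that by (auto simp: frequently_def not_le)
      have "compactly_divergent (f \<circ> r) unit_disc tube_domain"
        unfolding compactly_divergent_def
      proof (intro allI impI)
        fix K L assume "compact K \<and> K \<subseteq> unit_disc \<and> compact L \<and> L \<subseteq> tube_domain"
        then have K: "compact K" "K \<subseteq> unit_disc" and L: "compact L" "L \<subseteq> tube_domain"
          by auto
        show "\<forall>\<^sub>F k in sequentially. (f \<circ> r) k ` K \<inter> L = {}"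
        proof (cases "K = {} \<or> L = {}")
          case False
          \<comment> \<open>The energy has a positive minimum on \<open>L\<close>. A disc meeting
            \<open>L\<close> over \<open>K\<close> would, by Harnack, have energy at its centre
            bounded below uniformly.\<close>
          obtain p where p: "p \<in> L" "\<And>q. q \<in> L \<Longrightarrow> energy p \<le> energy q"
            using continuous_attains_inf[OF L(1) _ continuous_on_subset[OF continuous_on_energy L(2)]] False
            by blast
          obtain l1 where l1: "l1 \<in> K" "\<And>l. l \<in> K \<Longrightarrow> cmod l \<le> cmod l1"
            using continuous_attains_sup[OF K(1), of cmod] False by (auto intro: continuous_intros)
          have "cmod l1 < 1"
            using l1(1) K(2) by auto
          \<comment> \<open>A lower bound for the Harnack factor
            \<open>(1 - cmod l) / (1 + cmod l)\<close> over all of \<open>K\<close>, since the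
            denominator is at most 2.\<close>
          define c where "c = (1 - cmod l1) / 2"
          have "c > 0"
            using \<open>cmod l1 < 1\<close> by (simp add: c_def)
          have "energy p > 0"
            using p(1) L(2) energy_pos by blast
          have "c * energy p \<le> energy (f (r k) 0)" if "l \<in> K" "f (r k) l \<in> L" for k l
          proof -
            have l: "l \<in> unit_disc" "cmod l \<le> cmod l1"
              using that K(2) l1(2) by auto
            have "c \<le> (1 - cmod l) / (1 + cmod l)"
              unfolding c_def using l \<open>cmod l1 < 1\<close> by (intro frac_le) (auto intro: add_pos_nonneg)
            also have "\<dots> = exp (- 2 * poincare_dist l 0)"
              using exp_poincare_dist[of l 0] l(1) by simp
            finally have "c * energy p \<le> exp (- 2 * poincare_dist l 0) * energy (f (r k) l)"
              using p(2)[OF that(2)] \<open>energy p > 0\<close> \<open>c > 0\<close> by (intro mult_mono) auto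
            also have "\<dots> \<le> energy (f (r k) 0)"
              using f l(1) by (intro energy_harnack) auto
            finally show ?thesis .
          qed
          moreover have "\<forall>\<^sub>F k in sequentially. energy (f (r k) 0) < c * energy p"
            using \<open>c > 0\<close> \<open>energy p > 0\<close> by (intro small) simp
          ultimately show ?thesis
            by (auto elim!: eventually_mono simp: not_le[symmetric])
        qed auto
      qed
      then show ?thesis
        by blast
    qed
  qed
qed

end

theorem corollary4p8:
  fixes n :: nat and D :: "(real, 'n::finite) proj_space set"
  assumes "n \<ge> 1" and "CARD('n) = n + 1"
    and "open D" and "properly_convex D"
  shows "complete_kobayashi_hyperbolic (elliptic_tube D) \<and>
    taut (elliptic_tube D) \<and>
    hyperconvex (elliptic_tube D)"
proof -
  \<comment> \<open>The empty set lies in every projective hyperplane, and the vectors with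
    vanishing coordinate \<open>i\<close> provide one.\<close>
  have "D \<noteq> {}"
  proof
    assume "D = {}"
    obtain i :: 'n where True
      by blast
    let ?V = "{x :: real ^ 'n. \<forall>k. k \<notin> - {i} \<longrightarrow> x $ k = 0}"
    have "vec.dim ?V = card (UNIV - {i})"
      using dim_substandard_cart[of "- {i}"] by (simp add: Compl_eq_Diff_UNIV)
    then have "vec.dim ?V + 1 = CARD('n)"
      using assms(1,2) by (simp add: card_Diff_singleton)
    moreover have "vec.subspace ?V"
      by (simp add: vec.subspace_def)
    ultimately have "projective_hyperplane (proj_pt ` (?V - {0}) :: (real, 'n) proj_space set)"
      unfolding projective_hyperplane_def by blast
    then show False
      using assms(4) \<open>D = {}\<close> unfolding properly_convex_def by blast
  qed
  obtain C where C: "open C" "C \<noteq> {}" "\<And>x y. x \<in> C \<Longrightarrow> y \<in> C \<Longrightarrow> x + y \<in> C"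
    "\<And>c x. 0 < c \<Longrightarrow> x \<in> C \<Longrightarrow> c *\<^sub>R x \<in> C"
    "\<And>x. x \<in> closure C \<Longrightarrow> - x \<in> closure C \<Longrightarrow> x = 0"
    "{v. v \<noteq> 0 \<and> proj_pt v \<in> D} = C \<union> uminus ` C"
    using properly_convex_cone[OF assms(3,4) \<open>D \<noteq> {}\<close>] by blast
  then interpret proper_cone C
    by unfold_locales
  have "elliptic_tube D = tube_domain"
    using C(6) by (intro elliptic_tube_eq) unfold_locales
  then show ?thesis
    using tube_complete_kobayashi_hyperbolic tube_taut tube_hyperconvex by simp
qed

end
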